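(* Let $l\in\mathbb N$. The specific relative entropy between two $\mathbb R^l$-valued martingale Black-Scholes models $M^{\Gamma_1}$, $M^{\Gamma_2}$ with parameters $\Gamma_1,\Gamma_2\in\mathbb R^{l\times l}$, starting at the same point, is $$h_l(\mathcal L(M^{\Gamma_1})|\mathcal L(M^{\Gamma_2}))=\frac12\left(\mathrm{tr}\big((\Gamma_2\Gamma_2^T)^{-1}(\Gamma_1\Gamma_1^T)\big)-l-\log\frac{\det(\Gamma_1\Gamma_1^T)}{\det(\Gamma_2\Gamma_2^T)}\right).$$
   Context: The martingale Black-Scholes model $M^\Gamma$ with (constant) parameter $\Gamma\in\mathbb R^{l\times l}$, on the time interval $[0,1]$, is the solution of the SDE $dM_t^\Gamma=\mathrm{diag}(M_t^\Gamma)\,\Gamma\,dB_t$, i.e. $dM_t^i=M_t^i\sum_{k=1}^l\Gamma_{ik}\,dB_t^k$ for $i=1,\dots,l$, with $B$ a standard $\mathbb R^l$-valued Brownian motion. $\mathcal L(\cdot)$ denotes the law; $\mathrm{tr}$ and $\det$ are trace and determinant. $C:=C([0,1];\mathbb R^l)$ is the space of continuous paths, $X_t(\omega)=\omega(t)$ the canonical process, $\mathcal F=\sigma(X_t:t\in[0,1])$. Relative entropy: $H(\mu|\nu)=\int\log\frac{d\mu}{d\nu}\,d\mu$ if $\mu\ll\nu$, and $+\infty$ otherwise. For $n\in\mathbb N$, $\mathcal F^n:=\sigma(X_{k/n}:k=0,1,\dots,n)$ and $H(\mathbb Q|\mathbb P)|_{\mathcal F^n}$ is the relative entropy between the restrictions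 of $\mathbb Q$ and $\mathbb P$ to $\mathcal F^n$. For probability measures $\mathbb Q,\mathbb P$ on $(C,\mathcal F)$ under which $X$ is a martingale, the specific relative entropy is $h_l(\mathbb Q|\mathbb P):=\liminf_{n\to\infty}2^{-n}H(\mathbb Q|\mathbb P)|_{\mathcal F^{2^n}}$.
   Formalization: The common starting point is assumed to have all coordinates nonzero (from a zero coordinate that component stays zero and the formula fails), and Γ₂Γ₂ᵀ is assumed invertible so that the right-hand side is defined. *)

theory Defs
  imports "HOL-Probability.Probability"
begin

section \<open>Filtered probability spaces and Brownian motion\<close>

text \<open>The time index is all of \<open>real\<close>, but only the times in \<open>{0..1}\<close> are used below.\<close>

locale filtered_prob_space = prob_space P + filtration "space P" F
  for P :: "'a measure" and F :: "real \<Rightarrow> 'a measure" +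
  assumes sets_F_subset: "\<And>t. sets (F t) \<subseteq> sets P"

definition adapted :: "(real \<Rightarrow> 'a measure) \<Rightarrow> (real \<Rightarrow> 'a \<Rightarrow> 'b::topological_space) \<Rightarrow> bool" where
  "adapted F X \<longleftrightarrow> (\<forall>t\<in>{0..1}. X t \<in> borel_measurable (F t))"

definition continuous_paths :: "'a measure \<Rightarrow> (real \<Rightarrow> 'a \<Rightarrow> 'b::topological_space) \<Rightarrow> bool" where
  "continuous_paths P X \<longleftrightarrow> (\<forall>\<omega>\<in>space P. continuous_on {0..1} (\<lambda>t. X t \<omega>))"

definition standard_brownian_motion ::
  "'a measure \<Rightarrow> (real \<Rightarrow> 'a measure) \<Rightarrow> (real \<Rightarrow> 'a \<Rightarrow> real^'l) \<Rightarrow> bool" where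
  "standard_brownian_motion P F B \<longleftrightarrow>
     adapted F B \<and> continuous_paths P B \<and> (AE \<omega> in P. B 0 \<omega> = 0) \<and>
     (\<forall>s t. 0 \<le> s \<and> s < t \<and> t \<le> 1 \<longrightarrow>
        prob_space.indep_set P (sets (F s))
          (sets (vimage_algebra (space P) (\<lambda>\<omega>. B t \<omega> - B s \<omega>) borel)) \<and>
        prob_space.indep_vars P (\<lambda>_. borel) (\<lambda>k \<omega>. (B t \<omega> - B s \<omega>) $ k) UNIV \<and>
        (\<forall>k. distributed P lborel (\<lambda>\<omega>. (B t \<omega> - B s \<omega>) $ k)
               (normal_density 0 (sqrt (t - s)))))"

section \<open>The Ito integral\<close>

text \<open>
  A triple \<open>N\<close>, \<open>\<tau>\<close>, \<open>\<xi>\<close> stands for the simple process on \<open>[0, t]\<close> that equals \<open>\<xi> k\<close> on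
  \<open>(\<tau> k, \<tau> (k + 1)]\<close> for \<open>k < N\<close>, and \<open>0\<close> elsewhere.
\<close>

definition simple_process ::
  "'a measure \<Rightarrow> (real \<Rightarrow> 'a measure) \<Rightarrow> real \<Rightarrow> nat \<Rightarrow> (nat \<Rightarrow> real) \<Rightarrow> (nat \<Rightarrow> 'a \<Rightarrow> real) \<Rightarrow> bool" where
  "simple_process P F t N \<tau> \<xi> \<longleftrightarrow>
     (\<forall>k\<le>N. \<tau> k \<in> {0..t}) \<and> (\<forall>k<N. \<tau> k \<le> \<tau> (Suc k)) \<and>
     (\<forall>k<N. \<xi> k \<in> borel_measurable (F (\<tau> k))) \<and>
     (\<exists>c. \<forall>k<N. \<forall>\<omega>\<in>space P. \<bar>\<xi> k \<omega>\<bar> \<le> c)"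

definition simple_value ::
  "nat \<Rightarrow> (nat \<Rightarrow> real) \<Rightarrow> (nat \<Rightarrow> 'a \<Rightarrow> real) \<Rightarrow> real \<Rightarrow> 'a \<Rightarrow> real" where
  "simple_value N \<tau> \<xi> s \<omega> = (\<Sum>k<N. \<xi> k \<omega> * indicator {\<tau> k<..\<tau> (Suc k)} s)"

definition simple_integral ::
  "(real \<Rightarrow> 'a \<Rightarrow> real) \<Rightarrow> nat \<Rightarrow> (nat \<Rightarrow> real) \<Rightarrow> (nat \<Rightarrow> 'a \<Rightarrow> real) \<Rightarrow> 'a \<Rightarrow> real" where
  "simple_integral W N \<tau> \<xi> \<omega> = (\<Sum>k<N. \<xi> k \<omega> * (W (\<tau> (Suc k)) \<omega> - W (\<tau> k) \<omega>))"

definition progressively_measurable ::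
  "(real \<Rightarrow> 'a measure) \<Rightarrow> real \<Rightarrow> (real \<Rightarrow> 'a \<Rightarrow> real) \<Rightarrow> bool" where
  "progressively_measurable F t H \<longleftrightarrow>
     (\<forall>u\<in>{0..t}. (\<lambda>(s, \<omega>). H s \<omega>) \<in> borel_measurable (restrict_space borel {0..u} \<Otimes>\<^sub>M F u))"

text \<open>
  \<open>has_ito_integral P F W H t J\<close> says that \<open>J\<close> is (a version of) the Ito integral over
  \<open>[0, t]\<close> of the progressively measurable process \<open>H\<close> against the one-dimensional Brownian
  motion \<open>W\<close>: there are simple processes \<open>H\<^sub>n\<close> such that the integral over \<open>[0, t]\<close> of
  \<open>(H\<^sub>n - H)\<^sup>2\<close> tends to 0 in probability and the elementary integrals of the \<open>H\<^sub>n\<close>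
  tend to \<open>J\<close> in probability. Such a sequence exists iff \<open>H\<close> is almost surely
  square integrable on \<open>[0, t]\<close>.
\<close>

definition has_ito_integral ::
  "'a measure \<Rightarrow> (real \<Rightarrow> 'a measure) \<Rightarrow> (real \<Rightarrow> 'a \<Rightarrow> real) \<Rightarrow> (real \<Rightarrow> 'a \<Rightarrow> real) \<Rightarrow>
     real \<Rightarrow> ('a \<Rightarrow> real) \<Rightarrow> bool" where
  "has_ito_integral P F W H t J \<longleftrightarrow>
     progressively_measurable F t H \<and> J \<in> borel_measurable P \<and>
     (\<exists>N \<tau> \<xi>.
        (\<forall>n. simple_process P F t (N n) (\<tau> n) (\<xi> n)) \<and>
        (\<forall>\<epsilon>>0. (\<lambda>n. measure P {\<omega>\<in>space P.
            (\<integral>\<^sup>+s\<in>{0..t}. ennreal ((simple_value (N n) (\<tau> n) (\<xi> n) s \<omega> - H s \<omega>)\<^sup>2) \<partial>lborel)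
              > ennreal \<epsilon>}) \<longlonglongrightarrow> 0) \<and>
        (\<forall>\<epsilon>>0. (\<lambda>n. measure P {\<omega>\<in>space P.
            \<bar>simple_integral W (N n) (\<tau> n) (\<xi> n) \<omega> - J \<omega>\<bar> > \<epsilon>}) \<longlonglongrightarrow> 0))"

section \<open>The martingale Black-Scholes model\<close>

text \<open>\<open>M\<close> is a continuous adapted solution on \<open>[0, 1]\<close> of
  \<open>dM\<^sup>i = M\<^sup>i (\<Sum>k. \<Gamma>\<^sub>i\<^sub>k dB\<^sup>k)\<close>, started at the point \<open>x\<close>.\<close>

definition black_scholes_model ::
  "'a measure \<Rightarrow> (real \<Rightarrow> 'a measure) \<Rightarrow> (real \<Rightarrow> 'a \<Rightarrow> real^'l) \<Rightarrow> real^'l^'l \<Rightarrow> real^'l \<Rightarrow>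
     (real \<Rightarrow> 'a \<Rightarrow> real^'l) \<Rightarrow> bool" where
  "black_scholes_model P F B \<Gamma> x M \<longleftrightarrow>
     filtered_prob_space P F \<and> standard_brownian_motion P F B \<and>
     adapted F M \<and> continuous_paths P M \<and> (AE \<omega> in P. M 0 \<omega> = x) \<and>
     (\<forall>t\<in>{0..1}. \<forall>i. \<exists>J.
        (\<forall>k. has_ito_integral P F (\<lambda>s \<omega>. B s \<omega> $ k) (\<lambda>s \<omega>. M s \<omega> $ i * \<Gamma> $ i $ k) t (J k)) \<and>
        (AE \<omega> in P. M t \<omega> $ i = M 0 \<omega> $ i + (\<Sum>k\<in>UNIV. J k \<omega>)))"

section \<open>Path space\<close>

text \<open>\<open>C([0,1])\<close>; paths are extended by \<open>undefined\<close> outside \<open>{0..1}\<close> so that equality of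
  functions is equality on \<open>{0..1}\<close>.\<close>

definition path_space :: "(real \<Rightarrow> 'b::topological_space) set" where
  "path_space = {\<omega> \<in> extensional {0..1}. continuous_on {0..1} \<omega>}"

text \<open>The \<open>\<sigma>\<close>-algebra generated by the coordinates \<open>X\<^sub>t(\<omega>) = \<omega> t\<close>, \<open>t \<in> T\<close>.\<close>

definition path_sigma :: "real set \<Rightarrow> (real \<Rightarrow> 'b::topological_space) measure" where
  "path_sigma T = sigma path_space {{\<omega> \<in> path_space. \<omega> t \<in> A} | t A. t \<in> T \<and> A \<in> sets borel}"

definition path_law ::
  "'a measure \<Rightarrow> (real \<Rightarrow> 'a \<Rightarrow> 'b::topological_space) \<Rightarrow> (real \<Rightarrow> 'b) measure" where
  "path_law P M = distr P (path_sigma {0..1}) (\<lambda>\<omega>. \<lambda>t\<in>{0..1}. M t \<omega>)"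

section \<open>Specific relative entropy\<close>

text \<open>
  The negative part of \<open>log (d\<mu>/d\<nu>)\<close> always has finite \<open>\<mu>\<close>-integral when \<open>\<mu>\<close> and \<open>\<nu>\<close> are
  probability measures, so failure of integrability means that the integral is \<open>\<infinity>\<close>.
\<close>

definition relative_entropy :: "'a measure \<Rightarrow> 'a measure \<Rightarrow> ereal" where
  "relative_entropy \<mu> \<nu> =
     (if absolutely_continuous \<nu> \<mu> \<and> integrable \<mu> (entropy_density (exp 1) \<nu> \<mu>)
      then ereal (KL_divergence (exp 1) \<nu> \<mu>) else \<infinity>)"

definition grid_sigma :: "nat \<Rightarrow> (real \<Rightarrow> 'b::topological_space) measure" where
  "grid_sigma n = path_sigma ((\<lambda>k. real k / real n) ` {0..n})"

definition specific_relative_entropy ::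
  "(real \<Rightarrow> real^'l) measure \<Rightarrow> (real \<Rightarrow> real^'l) measure \<Rightarrow> ereal" where
  "specific_relative_entropy Q P =
     liminf (\<lambda>n. ereal (1 / 2 ^ n) *
       relative_entropy (restr_to_subalg Q (grid_sigma (2 ^ n)))
                        (restr_to_subalg P (grid_sigma (2 ^ n))))"

text \<open>The logarithm on \<open>[0, \<infinity>)\<close> with \<open>log 0 = -\<infinity>\<close>.\<close>

definition ext_ln :: "real \<Rightarrow> ereal" where
  "ext_ln y = (if y > 0 then ereal (ln y) else - \<infinity>)"

end

theory Submission
  imports Defs
begin

text \<open>
  An Ito integral of a continuous process is the limit in probability of its Riemann sums, so a
  solution of \<open>dX = X dW\<close> and the stochastic exponential of \<open>W\<close> satisfy the same limit relation; a
  Gronwall argument on the truncated second moment of their difference shows that they agree. Hence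
  the model is a geometric Brownian motion, and its logarithmic returns over a grid of mesh \<open>1/N\<close> are
  independent Gaussian vectors with covariance \<open>\<Gamma>\<Gamma>\<^sup>T/N\<close> and mean of order \<open>1/N\<close>. The relative
  entropy on the grid is therefore \<open>N\<close> times that of two Gaussian laws. The covariances contribute
  a term independent of \<open>N\<close> to the latter and the means a term of order \<open>1/N\<close>, which vanishes in
  the limit. If \<open>\<Gamma>\<^sub>1\<close> is singular, the first law charges a hyperplane that is null for the second
  one, and both sides are infinite.
\<close>

section \<open>Convergence in probability\<close>

text \<open>\<open>has_ito_integral\<close> provides one unspecified approximating sequence and no
  integrability of the solution, so no moment of \<open>M\<close> is available before its explicit
  form is known. Limits are therefore taken in probability, and second moments only after a cutoff:
  of integrands by their accumulated energy, of paths by a level K. Riemann sums are the common form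
  because they are bilinear: the sum of the integrals against the components of \<open>B\<close>
  becomes a single Riemann sum against the inner product of a row of \<Gamma> with \<open>B\<close>.

  For the entropy, the paths of both models are decoded with the same matrix
  \<open>\<Gamma>\<^sub>2\<close>. In these coordinates a step of the second model is a standard
  Gaussian b scaled to variance 1/N, and a step of the first is A b + d/N, where A is the inverse of
  \<open>\<Gamma>\<^sub>2\<close> times \<open>\<Gamma>\<^sub>1\<close> and d does not depend on N.
  The expected log density of one step is (|A|^2 - l)/2 - ln |det A| + |d|^2/(2N); the squared
  Frobenius norm |A|^2 is the trace in the theorem and the square of det A is the quotient of the
  determinants. Decoding divides successive values of a coordinate, and a coordinate started at 0
  would stay there.\<close>

definition tendsto_prob :: "'a measure \<Rightarrow> (nat \<Rightarrow> 'a \<Rightarrow> real) \<Rightarrow> ('a \<Rightarrow> real) \<Rightarrow> bool" where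
  "tendsto_prob P X Y \<longleftrightarrow>
     (\<forall>\<epsilon>>0. (\<lambda>n. measure P {w\<in>space P. \<bar>X n w - Y w\<bar> > \<epsilon>}) \<longlonglongrightarrow> 0)"

lemma tendsto_0_squeeze:
  fixes f g :: "nat \<Rightarrow> real"
  assumes "\<And>n. 0 \<le> f n" "\<And>n. f n \<le> g n" "g \<longlonglongrightarrow> 0"
  shows "f \<longlonglongrightarrow> 0"
  by (rule Lim_null_comparison[of f g]) (use assms in auto)

context prob_space
begin

text \<open>Dominated convergence for indicators. It serves where the index from which an estimate
  holds depends on the outcome, for instance through the modulus of continuity of a single
  path.\<close>

lemma prob_tendsto_0:
  assumes [measurable]: "\<And>n. A n \<in> events"
    and ev: "\<And>w. w \<in> space M \<Longrightarrow> eventually (\<lambda>n. w \<notin> A n) sequentially"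
  shows "(\<lambda>n. prob (A n)) \<longlonglongrightarrow> 0"
proof -
  have "(\<lambda>n. expectation (indicator (A n) :: 'a \<Rightarrow> real)) \<longlonglongrightarrow> expectation (\<lambda>_. 0::real)"
  proof (rule integral_dominated_convergence[where w = "\<lambda>_. 1"])
    show "AE w in M. (\<lambda>n. indicator (A n) w :: real) \<longlonglongrightarrow> 0"
    proof (rule AE_I2)
      fix w assume "w \<in> space M"
      from ev[OF this] show "(\<lambda>n. indicator (A n) w :: real) \<longlonglongrightarrow> 0"
        by (intro tendsto_eventually) (auto elim!: eventually_mono)
    qed
  qed (auto simp: indicator_def)
  then show ?thesis by simp
qed

lemma tendsto_prob_pointwise:
  assumes [measurable]: "\<And>n. X n \<in> borel_measurable M" "Y \<in> borel_measurable M"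
    and lim: "\<And>w. w \<in> space M \<Longrightarrow> (\<lambda>n. X n w) \<longlonglongrightarrow> Y w"
  shows "tendsto_prob M X Y"
  unfolding tendsto_prob_def
proof (intro allI impI prob_tendsto_0)
  fix \<epsilon> :: real and w assume "\<epsilon> > 0" "w \<in> space M"
  from lim[OF this(2)] this(1) have "eventually (\<lambda>n. dist (X n w) (Y w) < \<epsilon>) sequentially"
    by (rule tendstoD)
  then show "\<forall>\<^sub>F n in sequentially. w \<notin> {w \<in> space M. \<epsilon> < \<bar>X n w - Y w\<bar>}"
    by eventually_elim (auto simp: dist_real_def)
qed measurable

lemma tendsto_prob_add:
  assumes [measurable]: "\<And>n. X n \<in> borel_measurable M" "Y \<in> borel_measurable M"
    "\<And>n. X' n \<in> borel_measurable M" "Y' \<in> borel_measurable M"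
    and lim: "tendsto_prob M X Y" "tendsto_prob M X' Y'"
  shows "tendsto_prob M (\<lambda>n w. X n w + X' n w) (\<lambda>w. Y w + Y' w)"
  unfolding tendsto_prob_def
proof (intro allI impI)
  fix \<epsilon> :: real assume "\<epsilon> > 0"
  define a where "a n = prob {w\<in>space M. \<bar>X n w - Y w\<bar> > \<epsilon>/2}" for n
  define b where "b n = prob {w\<in>space M. \<bar>X' n w - Y' w\<bar> > \<epsilon>/2}" for n
  have lim0: "(\<lambda>n. a n + b n) \<longlonglongrightarrow> 0"
    using lim half_gt_zero[OF \<open>\<epsilon> > 0\<close>] unfolding a_def b_def tendsto_prob_def
    by (intro tendsto_add_zero) blast+
  have le: "prob {w\<in>space M. \<bar>X n w + X' n w - (Y w + Y' w)\<bar> > \<epsilon>} \<le> a n + b n" for n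
  proof -
    have "prob {w\<in>space M. \<bar>X n w + X' n w - (Y w + Y' w)\<bar> > \<epsilon>} \<le>
       prob ({w\<in>space M. \<bar>X n w - Y w\<bar> > \<epsilon>/2} \<union> {w\<in>space M. \<bar>X' n w - Y' w\<bar> > \<epsilon>/2})"
    proof (rule finite_measure_mono)
      have "\<epsilon>/2 < \<bar>a - c\<bar> \<or> \<epsilon>/2 < \<bar>b - d\<bar>" if "\<epsilon> < \<bar>a + b - (c + d)\<bar>" for a b c d :: real
        using that by linarith
      then show "{w\<in>space M. \<bar>X n w + X' n w - (Y w + Y' w)\<bar> > \<epsilon>} \<subseteq>
        {w\<in>space M. \<bar>X n w - Y w\<bar> > \<epsilon>/2} \<union> {w\<in>space M. \<bar>X' n w - Y' w\<bar> > \<epsilon>/2}"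
        by blast
    qed measurable
    also have "\<dots> \<le> a n + b n"
      unfolding a_def b_def by (rule measure_subadditive) auto
    finally show ?thesis .
  qed
  show "(\<lambda>n. prob {w\<in>space M. \<bar>X n w + X' n w - (Y w + Y' w)\<bar> > \<epsilon>}) \<longlonglongrightarrow> 0"
    by (rule tendsto_0_squeeze[OF measure_nonneg le lim0])
qed

lemma tendsto_prob_cmult:
  assumes [measurable]: "\<And>n. X n \<in> borel_measurable M" "Y \<in> borel_measurable M"
    and lim: "tendsto_prob M X Y"
  shows "tendsto_prob M (\<lambda>n w. c * X n w) (\<lambda>w. c * Y w)"
proof (cases "c = 0")
  case False
  show ?thesis
    unfolding tendsto_prob_def
  proof (intro allI impI)
    fix \<epsilon> :: real assume "\<epsilon> > 0"
    have "\<bar>c * x - c * y\<bar> > \<epsilon> \<longleftrightarrow> \<bar>x - y\<bar> > \<epsilon> / \<bar>c\<bar>" for x y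
      using False pos_divide_less_eq[of "\<bar>c\<bar>" \<epsilon> "\<bar>x - y\<bar>"]
      by (simp add: right_diff_distrib[symmetric] abs_mult mult.commute)
    then show "(\<lambda>n. prob {w\<in>space M. \<bar>c * X n w - c * Y w\<bar> > \<epsilon>}) \<longlonglongrightarrow> 0"
      using lim \<open>\<epsilon> > 0\<close> False unfolding tendsto_prob_def by simp
  qed
qed (simp add: tendsto_prob_def)

lemma tendsto_prob_sum:
  assumes "finite I"
    and [measurable]: "\<And>i n. i \<in> I \<Longrightarrow> X i n \<in> borel_measurable M" "\<And>i. i \<in> I \<Longrightarrow> Y i \<in> borel_measurable M"
    and lim: "\<And>i. i \<in> I \<Longrightarrow> tendsto_prob M (X i) (Y i)"
  shows "tendsto_prob M (\<lambda>n w. \<Sum>i\<in>I. X i n w) (\<lambda>w. \<Sum>i\<in>I. Y i w)"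
  using assms
proof (induction I rule: finite_induct)
  case (insert i I)
  then show ?case
    by (simp, intro tendsto_prob_add borel_measurable_sum) auto
qed (simp add: tendsto_prob_def)

text \<open>Chebyshev's inequality, without centring.\<close>

lemma prob_abs_gt_le:
  assumes [measurable]: "X \<in> borel_measurable M" and int: "integrable M (\<lambda>w. (X w)\<^sup>2)" and "\<epsilon> > 0"
  shows "prob {w\<in>space M. \<bar>X w\<bar> > \<epsilon>} \<le> expectation (\<lambda>w. (X w)\<^sup>2) / \<epsilon>\<^sup>2"
proof -
  have "prob {w\<in>space M. \<bar>X w\<bar> > \<epsilon>} \<le> prob {w\<in>space M. \<epsilon>\<^sup>2 \<le> (X w)\<^sup>2}"
    using \<open>\<epsilon> > 0\<close> by (intro finite_measure_mono) (auto simp: abs_le_square_iff[symmetric])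
  also have "\<dots> \<le> expectation (\<lambda>w. (X w)\<^sup>2) / \<epsilon>\<^sup>2"
    using \<open>\<epsilon> > 0\<close> by (intro integral_Markov_inequality_measure[where A = "{}"]) (auto simp: int)
  finally show ?thesis .
qed

lemma tendsto_prob_L2:
  assumes [measurable]: "\<And>n. X n \<in> borel_measurable M" "Y \<in> borel_measurable M"
    and int: "\<And>n. integrable M (\<lambda>w. (X n w - Y w)\<^sup>2)"
    and lim: "(\<lambda>n. expectation (\<lambda>w. (X n w - Y w)\<^sup>2)) \<longlonglongrightarrow> 0"
  shows "tendsto_prob M X Y"
  unfolding tendsto_prob_def
proof (intro allI impI)
  fix \<epsilon> :: real assume "\<epsilon> > 0"
  have lim0: "(\<lambda>n. expectation (\<lambda>w. (X n w - Y w)\<^sup>2) / \<epsilon>\<^sup>2) \<longlonglongrightarrow> 0"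
    using tendsto_divide_zero[OF lim] .
  have le: "prob {w\<in>space M. \<bar>X n w - Y w\<bar> > \<epsilon>} \<le> expectation (\<lambda>w. (X n w - Y w)\<^sup>2) / \<epsilon>\<^sup>2" for n
    by (rule prob_abs_gt_le[of "\<lambda>w. X n w - Y w"]) (use int \<open>\<epsilon> > 0\<close> in measurable)
  show "(\<lambda>n. prob {w\<in>space M. \<bar>X n w - Y w\<bar> > \<epsilon>}) \<longlonglongrightarrow> 0"
    by (rule tendsto_0_squeeze[OF measure_nonneg le lim0])
qed

lemma tendsto_prob_cong_AE:
  assumes [measurable]: "\<And>n. X n \<in> borel_measurable M" "Y \<in> borel_measurable M"
    "\<And>n. X' n \<in> borel_measurable M" "Y' \<in> borel_measurable M"
    and "\<And>n. AE w in M. X n w = X' n w" "AE w in M. Y w = Y' w"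
    and lim: "tendsto_prob M X Y"
  shows "tendsto_prob M X' Y'"
proof -
  have "prob {w\<in>space M. \<bar>X n w - Y w\<bar> > \<epsilon>} = prob {w\<in>space M. \<bar>X' n w - Y' w\<bar> > \<epsilon>}" for n \<epsilon>
  proof (rule finite_measure_eq_AE)
    show "AE w in M. (w \<in> {w \<in> space M. \<epsilon> < \<bar>X n w - Y w\<bar>}) = (w \<in> {w \<in> space M. \<epsilon> < \<bar>X' n w - Y' w\<bar>})"
      using assms(5)[of n] assms(6) by eventually_elim auto
  qed measurable
  with lim show ?thesis unfolding tendsto_prob_def by simp
qed

lemma integrable_mult_L2:
  fixes X Y :: "'a \<Rightarrow> real"
  assumes [measurable]: "X \<in> borel_measurable M" "Y \<in> borel_measurable M"
    and "integrable M (\<lambda>w. (X w)\<^sup>2)" "integrable M (\<lambda>w. (Y w)\<^sup>2)"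
  shows "integrable M (\<lambda>w. X w * Y w)"
proof (rule Bochner_Integration.integrable_bound)
  show "integrable M (\<lambda>w. (X w)\<^sup>2 + (Y w)\<^sup>2)"
    using assms by auto
  have "\<bar>a * b\<bar> \<le> a\<^sup>2 + b\<^sup>2" for a b :: real
    using sum_squares_bound[of "\<bar>a\<bar>" "\<bar>b\<bar>"] mult_nonneg_nonneg[of "\<bar>a\<bar>" "\<bar>b\<bar>"]
    by (simp only: abs_mult power2_abs) linarith
  then show "AE w in M. norm (X w * Y w) \<le> norm ((X w)\<^sup>2 + (Y w)\<^sup>2)"
    by auto
qed measurable

end

section \<open>Orthogonality of increments independent of the past\<close>

context filtered_prob_space
begin

lemma measurable_F_mono: "s \<le> t \<Longrightarrow> X \<in> measurable (F s) N \<Longrightarrow> X \<in> measurable (F t) N"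
  using sets_F_mono[of s t] space_F by (auto simp: measurable_def)

lemma measurable_F_P: "X \<in> measurable (F s) N \<Longrightarrow> X \<in> measurable P N"
  using sets_F_subset[of s] space_F by (auto simp: measurable_def)

lemma indep_var_of_indep_set:
  assumes ind: "indep_set (sets (F s)) (sets (vimage_algebra (space P) Z borel))"
    and Z: "Z \<in> borel_measurable P" and X: "X \<in> borel_measurable (F s)"
  shows "indep_var borel X borel Z"
  unfolding indep_var_eq
proof (intro conjI)
  show "random_variable borel X" using X by (rule measurable_F_P)
  show "random_variable borel Z" by (rule Z)
  have 1: "sigma_sets (space P) {X -` A \<inter> space P |A. A \<in> sets borel} \<subseteq> sets (F s)"
    using measurable_sets[OF X] sets.sigma_sets_subset[of _ "F s"]
    by (intro sets.sigma_sets_subset[of _ "F s", unfolded space_F]) (auto simp: space_F)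
  have 2: "sigma_sets (space P) {Z -` A \<inter> space P |A. A \<in> sets borel} = sets (vimage_algebra (space P) Z borel)"
    by (rule sets_vimage_algebra[symmetric])
  show "indep_set (sigma_sets (space P) {X -` A \<inter> space P |A. A \<in> sets borel})
     (sigma_sets (space P) {Z -` A \<inter> space P |A. A \<in> sets borel})"
    unfolding 2 using ind 1 unfolding indep_set_def
    by (elim indep_sets_mono_sets) (auto split: bool.split)
qed

text \<open>A discrete Ito isometry. The mixed term of the last summand with the sum S of the
  earlier ones vanishes because S times \<open>\<xi> n\<close> is known at time \<open>s n\<close>,
  hence independent of the centred \<open>\<eta> n\<close>; independence also makes the product
  integrable. The measurability in the conclusion feeds the induction. The factors
  \<open>\<eta>\<close> are kept general because both the increments of a Brownian motion and the
  remainders \<open>exp_remainder\<close> are inserted for them.\<close>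

lemma expectation_orthogonal_sum:
  fixes s :: "nat \<Rightarrow> real" and \<xi> \<eta> :: "nat \<Rightarrow> 'a \<Rightarrow> real"
  assumes mono: "\<And>j. j < n \<Longrightarrow> s j \<le> s (Suc j)"
    and \<xi>: "\<And>j. j < n \<Longrightarrow> \<xi> j \<in> borel_measurable (F (s j))"
    and \<eta>: "\<And>j. j < n \<Longrightarrow> \<eta> j \<in> borel_measurable (F (s (Suc j)))"
    and ind: "\<And>j X. j < n \<Longrightarrow> X \<in> borel_measurable (F (s j)) \<Longrightarrow> indep_var borel X borel (\<eta> j)"
    and \<xi>2: "\<And>j. j < n \<Longrightarrow> integrable P (\<lambda>w. (\<xi> j w)\<^sup>2)"
    and \<eta>2: "\<And>j. j < n \<Longrightarrow> integrable P (\<lambda>w. (\<eta> j w)\<^sup>2)"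
    and \<eta>0: "\<And>j. j < n \<Longrightarrow> expectation (\<eta> j) = 0"
  shows "integrable P (\<lambda>w. (\<Sum>j<n. \<xi> j w * \<eta> j w)\<^sup>2) \<and>
    expectation (\<lambda>w. (\<Sum>j<n. \<xi> j w * \<eta> j w)\<^sup>2) =
      (\<Sum>j<n. expectation (\<lambda>w. (\<xi> j w)\<^sup>2) * expectation (\<lambda>w. (\<eta> j w)\<^sup>2)) \<and>
    (\<lambda>w. \<Sum>j<n. \<xi> j w * \<eta> j w) \<in> borel_measurable (F (s n))"
  using assms
proof (induction n)
  case (Suc n)
  define S where "S w = (\<Sum>j<n. \<xi> j w * \<eta> j w)" for w
  have IH: "integrable P (\<lambda>w. (S w)\<^sup>2)"
    "expectation (\<lambda>w. (S w)\<^sup>2) = (\<Sum>j<n. expectation (\<lambda>w. (\<xi> j w)\<^sup>2) * expectation (\<lambda>w. (\<eta> j w)\<^sup>2))"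
    "S \<in> borel_measurable (F (s n))"
    unfolding S_def[abs_def] using Suc.IH Suc.prems by auto
  have \<xi>n: "\<xi> n \<in> borel_measurable (F (s n))" and \<eta>n: "\<eta> n \<in> borel_measurable (F (s (Suc n)))"
    using Suc.prems(2,3) by auto
  note [measurable] = measurable_F_P[OF \<xi>n] measurable_F_P[OF \<eta>n] measurable_F_P[OF IH(3)]
  have int: "integrable P (\<lambda>w. (\<xi> n w)\<^sup>2)" "integrable P (\<lambda>w. (\<eta> n w)\<^sup>2)"
    using Suc.prems by auto
  have int1: "integrable P (\<eta> n)"
    using integrable_mult_L2[of "\<eta> n" "\<lambda>_. 1"] int by simp
  have i1: "indep_var borel (\<lambda>w. S w * \<xi> n w) borel (\<eta> n)"
    by (rule Suc.prems) (use IH(3) \<xi>n in auto)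
  have i2: "indep_var borel (\<lambda>w. (\<xi> n w)\<^sup>2) borel (\<eta> n)"
    by (rule Suc.prems) (use \<xi>n in auto)
  have i2: "indep_var borel (\<lambda>w. (\<xi> n w)\<^sup>2) borel (\<lambda>w. (\<eta> n w)\<^sup>2)"
    using indep_var_compose[OF i2, of "\<lambda>x. x" borel "\<lambda>x. x\<^sup>2" borel] by (simp add: comp_def)
  have intS: "integrable P (\<lambda>w. S w * \<xi> n w)"
    by (rule integrable_mult_L2) (use IH int in auto)
  have e1: "integrable P (\<lambda>w. S w * \<xi> n w * \<eta> n w)" "expectation (\<lambda>w. S w * \<xi> n w * \<eta> n w) = 0"
    using indep_var_integrable[OF i1 intS int1] indep_var_lebesgue_integral[OF i1 intS int1] Suc.prems(7)
    by auto
  have e2: "integrable P (\<lambda>w. (\<xi> n w)\<^sup>2 * (\<eta> n w)\<^sup>2)"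
    "expectation (\<lambda>w. (\<xi> n w)\<^sup>2 * (\<eta> n w)\<^sup>2) = expectation (\<lambda>w. (\<xi> n w)\<^sup>2) * expectation (\<lambda>w. (\<eta> n w)\<^sup>2)"
    using indep_var_integrable[OF i2 int] indep_var_lebesgue_integral[OF i2 int] by auto
  have eq: "(\<Sum>j<Suc n. \<xi> j w * \<eta> j w)\<^sup>2 = (S w)\<^sup>2 + 2 * (S w * \<xi> n w * \<eta> n w) + (\<xi> n w)\<^sup>2 * (\<eta> n w)\<^sup>2" for w
    by (simp add: S_def power2_eq_square algebra_simps)
  have "(\<lambda>w. S w + \<xi> n w * \<eta> n w) \<in> borel_measurable (F (s (Suc n)))"
    using measurable_F_mono[OF _ IH(3)] measurable_F_mono[OF _ \<xi>n] \<eta>n Suc.prems(1)[of n]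
    by (intro borel_measurable_add borel_measurable_times) auto
  then have m: "(\<lambda>w. \<Sum>j<Suc n. \<xi> j w * \<eta> j w) \<in> borel_measurable (F (s (Suc n)))"
    by (simp add: S_def)
  show ?case
    unfolding eq using IH e1 e2 m by auto
qed simp

end

section \<open>Simple processes on a common partition\<close>

text \<open>Comparing a node with a point of a cell amounts to comparing indices; this settles every
  indicator of a left-open, right-closed cell below.\<close>

lemma strict_partition_less_iff:
  fixes s :: "nat \<Rightarrow> real"
  assumes s: "\<And>i j. i < j \<Longrightarrow> j \<le> n \<Longrightarrow> s i < s j"
    and "j < n" "a \<le> n" "s j < u" "u \<le> s (Suc j)"
  shows "s a < u \<longleftrightarrow> a \<le> j"
proof
  assume "s a < u"
  show "a \<le> j"
  proof (rule ccontr)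
    assume "\<not> a \<le> j"
    then have "s (Suc j) \<le> s a" using s[of "Suc j" a] assms(3) by (cases "Suc j = a") auto
    then show False using \<open>s a < u\<close> assms(5) by simp
  qed
next
  assume "a \<le> j"
  then have "s a \<le> s j" using s[of a j] assms(2) by (cases "a = j") auto
  then show "s a < u" using assms(4) by simp
qed

text \<open>A simple process is constant on the cells of any finer partition. The right endpoint
  represents the cell, since cells contain it and not the left one.\<close>

lemma simple_value_refine:
  fixes s :: "nat \<Rightarrow> real"
  assumes s: "\<And>i j. i < j \<Longrightarrow> j \<le> n \<Longrightarrow> s i < s j"
    and \<tau>: "\<And>k. k \<le> N \<Longrightarrow> \<tau> k \<in> s ` {..n}"
    and u: "j < n" "s j < u" "u \<le> s (Suc j)"
  shows "simple_value N \<tau> \<xi> u w = simple_value N \<tau> \<xi> (s (Suc j)) w"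
  unfolding simple_value_def
proof (rule sum.cong)
  fix k assume k: "k \<in> {..<N}"
  have *: "\<tau> k' < u \<longleftrightarrow> \<tau> k' < s (Suc j)" if k': "k' \<le> N" for k'
  proof -
    obtain a where a: "\<tau> k' = s a" "a \<le> n" using \<tau>[OF k'] by auto
    have "s j < s (Suc j)" using s[of j "Suc j"] u(1) by simp
    then show ?thesis
      unfolding a using strict_partition_less_iff[where s = s, OF s u(1) a(2) u(2,3)]
        strict_partition_less_iff[where s = s and u = "s (Suc j)", OF s u(1) a(2)] by simp
  qed
  show "\<xi> k w * indicator {\<tau> k<..\<tau> (Suc k)} u = \<xi> k w * indicator {\<tau> k<..\<tau> (Suc k)} (s (Suc j))"
    using *[of k] *[of "Suc k"] k by (auto simp: indicator_def not_less[symmetric])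
qed simp

lemma simple_value_strict:
  fixes s :: "nat \<Rightarrow> real"
  assumes s: "\<And>i j. i < j \<Longrightarrow> j \<le> n \<Longrightarrow> s i < s j"
    and u: "j < n" "s j < u" "u \<le> s (Suc j)"
  shows "simple_value n s \<xi> u w = \<xi> j w"
proof -
  have "simple_value n s \<xi> u w = (\<Sum>k<n. if k = j then \<xi> k w else 0)"
    unfolding simple_value_def
  proof (rule sum.cong)
    fix k assume k: "k \<in> {..<n}"
    have "s k < u \<longleftrightarrow> k \<le> j" "s (Suc k) < u \<longleftrightarrow> Suc k \<le> j"
      using k by (intro strict_partition_less_iff[where s = s, OF s u(1) _ u(2,3)]; simp)+
    then show "\<xi> k w * indicator {s k<..s (Suc k)} u = (if k = j then \<xi> k w else 0)"
      by (auto simp: indicator_def not_less[symmetric])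
  qed simp
  then show ?thesis using u(1) by simp
qed

text \<open>Each coarse increment of \<open>W\<close> telescopes over the fine cells inside it. This
  makes elementary integrals on different partitions comparable, by writing both on the union of
  their nodes.\<close>

lemma simple_integral_refine:
  fixes s :: "nat \<Rightarrow> real"
  assumes s: "\<And>i j. i < j \<Longrightarrow> j \<le> n \<Longrightarrow> s i < s j"
    and \<tau>: "\<And>k. k \<le> N \<Longrightarrow> \<tau> k \<in> s ` {..n}"
    and mono: "\<And>k. k < N \<Longrightarrow> \<tau> k \<le> \<tau> (Suc k)"
  shows "simple_integral W N \<tau> \<xi> w =
    (\<Sum>j<n. simple_value N \<tau> \<xi> (s (Suc j)) w * (W (s (Suc j)) w - W (s j) w))"
proof -
  have *: "(\<Sum>j<n. indicator {\<tau> k<..\<tau> (Suc k)} (s (Suc j)) * (W (s (Suc j)) w - W (s j) w)) =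
      W (\<tau> (Suc k)) w - W (\<tau> k) w" if k: "k < N" for k
  proof -
    obtain a where a: "\<tau> k = s a" "a \<le> n" using \<tau>[of k] k by auto
    obtain b where b: "\<tau> (Suc k) = s b" "b \<le> n" using \<tau>[of "Suc k"] k by auto
    have ab: "a \<le> b"
      using mono[OF k] s[of b a] a b by (cases "a \<le> b") auto
    have sj: "s j < s (Suc j)" if "j < n" for j using s[of j "Suc j"] that by simp
    have "(\<Sum>j<n. indicator {\<tau> k<..\<tau> (Suc k)} (s (Suc j)) * (W (s (Suc j)) w - W (s j) w)) =
      (\<Sum>j<n. if j \<in> {a..<b} then W (s (Suc j)) w - W (s j) w else 0)"
    proof (rule sum.cong)
      fix j assume "j \<in> {..<n}"
      then have "s a < s (Suc j) \<longleftrightarrow> a \<le> j" "s b < s (Suc j) \<longleftrightarrow> b \<le> j"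
        using a b sj by (intro strict_partition_less_iff[where s = s, OF s]; simp)+
      then show "indicator {\<tau> k<..\<tau> (Suc k)} (s (Suc j)) * (W (s (Suc j)) w - W (s j) w) =
        (if j \<in> {a..<b} then W (s (Suc j)) w - W (s j) w else 0)"
        unfolding a b by (auto simp: indicator_def not_less[symmetric])
    qed simp
    also have "\<dots> = (\<Sum>j\<in>{a..<b}. W (s (Suc j)) w - W (s j) w)"
      using b(2) by (subst sum.inter_restrict[symmetric]) (auto intro!: sum.cong)
    also have "\<dots> = W (s b) w - W (s a) w"
      using ab by (rule sum_Suc_diff')
    finally show ?thesis using a b by simp
  qed
  have "(\<Sum>j<n. simple_value N \<tau> \<xi> (s (Suc j)) w * (W (s (Suc j)) w - W (s j) w)) =
    (\<Sum>j<n. \<Sum>k<N. \<xi> k w * (indicator {\<tau> k<..\<tau> (Suc k)} (s (Suc j)) * (W (s (Suc j)) w - W (s j) w)))"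
    unfolding simple_value_def sum_distrib_right mult.assoc ..
  also have "\<dots> = (\<Sum>k<N. \<xi> k w * (\<Sum>j<n. indicator {\<tau> k<..\<tau> (Suc k)} (s (Suc j)) * (W (s (Suc j)) w - W (s j) w)))"
    by (subst sum.swap) (simp only: sum_distrib_left)
  also have "\<dots> = simple_integral W N \<tau> \<xi> w"
    unfolding simple_integral_def by (intro sum.cong refl) (simp only: * lessThan_iff)
  finally show ?thesis by simp
qed

lemma finite_set_strict_enumeration:
  fixes T :: "real set"
  assumes "finite T" "T \<noteq> {}"
  obtains n s where "\<And>i j. i < j \<Longrightarrow> j \<le> n \<Longrightarrow> s i < s j" "s ` {..n::nat} = T"
proof
  let ?xs = "sorted_list_of_set T"
  have l: "length ?xs > 0" using assms by (cases ?xs) auto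
  show "?xs ! i < ?xs ! j" if "i < j" "j \<le> length ?xs - 1" for i j
    using that l strict_sorted_list_of_set[of T] by (intro sorted_wrt_nth_less[of "(<)"]) auto
  have "{..length ?xs - 1} = {0..<length ?xs}" using l by auto
  then show "(!) ?xs ` {..length ?xs - 1} = T"
    using nth_image[of "length ?xs" ?xs] assms(1) by simp
qed

text \<open>On the cell ending at \<open>s (Suc j)\<close> only those \<open>\<xi> k\<close>
  contribute whose time lies strictly before that endpoint. As that time is itself a node, it is at
  most \<open>s j\<close>, so the value is already known there.\<close>

lemma (in filtered_prob_space) simple_value_predictable:
  fixes s :: "nat \<Rightarrow> real"
  assumes s: "\<And>i j. i < j \<Longrightarrow> j \<le> n \<Longrightarrow> s i < s j"
    and \<tau>: "\<And>k. k \<le> N \<Longrightarrow> \<tau> k \<in> s ` {..n}"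
    and \<xi>: "\<And>k. k < N \<Longrightarrow> \<xi> k \<in> borel_measurable (F (\<tau> k))"
    and j: "j < n"
  shows "(\<lambda>w. simple_value N \<tau> \<xi> (s (Suc j)) w) \<in> borel_measurable (F (s j))"
  unfolding simple_value_def
proof (rule borel_measurable_sum)
  fix k assume k: "k \<in> {..<N}"
  show "(\<lambda>w. \<xi> k w * indicator {\<tau> k<..\<tau> (Suc k)} (s (Suc j))) \<in> borel_measurable (F (s j))"
  proof (cases "\<tau> k < s (Suc j)")
    case True
    obtain a where a: "\<tau> k = s a" "a \<le> n" using \<tau>[of k] k by auto
    have sj: "s j < s (Suc j)" using s[of j "Suc j"] j by simp
    have "a \<le> j"
      using True strict_partition_less_iff[where s = s, OF s j a(2) sj order_refl] unfolding a by simp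
    then have "\<tau> k \<le> s j" using s[of a j] j unfolding a by (cases "a = j") auto
    from measurable_F_mono[OF this \<xi>] k show ?thesis by simp
  qed simp
qed

section \<open>Integration against a process with orthogonal increments\<close>

text \<open>The second-order structure on which the integration theory rests, without normality. The
  rate \<open>v\<close> is 1 for a component of the Brownian motion and the squared norm of a row of
  \<Gamma> for the noise of one coordinate; it may be 0.\<close>

locale orthogonal_increments = filtered_prob_space P F
  for P :: "'a measure" and F +
  fixes W :: "real \<Rightarrow> 'a \<Rightarrow> real" and v :: real
  assumes W_adapted: "\<And>t. t \<in> {0..1} \<Longrightarrow> W t \<in> borel_measurable (F t)"
    and W_indep: "\<And>s t X. 0 \<le> s \<Longrightarrow> s < t \<Longrightarrow> t \<le> 1 \<Longrightarrow> X \<in> borel_measurable (F s) \<Longrightarrow>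
      indep_var borel X borel (\<lambda>w. W t w - W s w)"
    and W_integrable: "\<And>s t. 0 \<le> s \<Longrightarrow> s < t \<Longrightarrow> t \<le> 1 \<Longrightarrow> integrable P (\<lambda>w. (W t w - W s w)\<^sup>2)"
    and W_mean: "\<And>s t. 0 \<le> s \<Longrightarrow> s < t \<Longrightarrow> t \<le> 1 \<Longrightarrow> expectation (\<lambda>w. W t w - W s w) = 0"
    and W_variance: "\<And>s t. 0 \<le> s \<Longrightarrow> s < t \<Longrightarrow> t \<le> 1 \<Longrightarrow>
      expectation (\<lambda>w. (W t w - W s w)\<^sup>2) = v * (t - s)"
    and v_nonneg: "0 \<le> v"
begin

lemma W_measurable: "t \<in> {0..1} \<Longrightarrow> W t \<in> borel_measurable P"
  using W_adapted by (rule measurable_F_P)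

lemma W_isometry:
  assumes s: "\<And>i j. i < j \<Longrightarrow> j \<le> n \<Longrightarrow> s i < s j" and s01: "\<And>j. j \<le> n \<Longrightarrow> s j \<in> {0..1}"
    and e: "\<And>j. j < n \<Longrightarrow> e j \<in> borel_measurable (F (s j))"
    and e2: "\<And>j. j < n \<Longrightarrow> integrable P (\<lambda>w. (e j w)\<^sup>2)"
  shows "integrable P (\<lambda>w. (\<Sum>j<n. e j w * (W (s (Suc j)) w - W (s j) w))\<^sup>2) \<and>
    expectation (\<lambda>w. (\<Sum>j<n. e j w * (W (s (Suc j)) w - W (s j) w))\<^sup>2) =
      v * (\<Sum>j<n. expectation (\<lambda>w. (e j w)\<^sup>2) * (s (Suc j) - s j))"
proof -
  have sj: "s j < s (Suc j)" "0 \<le> s j" "s (Suc j) \<le> 1" if "j < n" for j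
    using s[of j "Suc j"] s01[of j] s01[of "Suc j"] that by auto
  have \<eta>: "(\<lambda>w. W (s (Suc j)) w - W (s j) w) \<in> borel_measurable (F (s (Suc j)))" if "j < n" for j
  proof (rule borel_measurable_diff)
    show "W (s (Suc j)) \<in> borel_measurable (F (s (Suc j)))"
      using s01[of "Suc j"] that by (intro W_adapted) simp
    show "W (s j) \<in> borel_measurable (F (s (Suc j)))"
      using s01[of j] sj[OF that] that by (intro measurable_F_mono[OF _ W_adapted[of "s j"]]) simp_all
  qed
  have *: "integrable P (\<lambda>w. (\<Sum>j<n. e j w * (W (s (Suc j)) w - W (s j) w))\<^sup>2) \<and>
    expectation (\<lambda>w. (\<Sum>j<n. e j w * (W (s (Suc j)) w - W (s j) w))\<^sup>2) =
      (\<Sum>j<n. expectation (\<lambda>w. (e j w)\<^sup>2) * expectation (\<lambda>w. (W (s (Suc j)) w - W (s j) w)\<^sup>2)) \<and>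
    (\<lambda>w. \<Sum>j<n. e j w * (W (s (Suc j)) w - W (s j) w)) \<in> borel_measurable (F (s n))"
  proof (rule expectation_orthogonal_sum)
    fix j assume j: "j < n"
    note sj = sj[OF j]
    show "s j \<le> s (Suc j)" using sj by simp
    show "e j \<in> borel_measurable (F (s j))" by (rule e[OF j])
    show "(\<lambda>w. W (s (Suc j)) w - W (s j) w) \<in> borel_measurable (F (s (Suc j)))" by (rule \<eta>[OF j])
    show "indep_var borel X borel (\<lambda>w. W (s (Suc j)) w - W (s j) w)"
      if "X \<in> borel_measurable (F (s j))" for X
      by (rule W_indep[OF sj(2,1,3) that])
    show "integrable P (\<lambda>w. (e j w)\<^sup>2)" by (rule e2[OF j])
    show "integrable P (\<lambda>w. (W (s (Suc j)) w - W (s j) w)\<^sup>2)" by (rule W_integrable[OF sj(2,1,3)])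
    show "expectation (\<lambda>w. W (s (Suc j)) w - W (s j) w) = 0" by (rule W_mean[OF sj(2,1,3)])
  qed
  have eq: "(\<Sum>j<n. expectation (\<lambda>w. (e j w)\<^sup>2) * expectation (\<lambda>w. (W (s (Suc j)) w - W (s j) w)\<^sup>2)) =
    v * (\<Sum>j<n. expectation (\<lambda>w. (e j w)\<^sup>2) * (s (Suc j) - s j))"
    unfolding sum_distrib_left by (intro sum.cong refl) (use sj in \<open>simp add: W_variance\<close>)
  show ?thesis
    using * unfolding eq by blast
qed

lemma simple_integral_measurable:
  assumes "simple_process P F t N \<tau> \<xi>" "t \<le> 1"
  shows "simple_integral W N \<tau> \<xi> \<in> borel_measurable P"
  unfolding simple_integral_def[abs_def]
proof (intro borel_measurable_sum borel_measurable_times borel_measurable_diff)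
  fix k assume k: "k \<in> {..<N}"
  then have "\<tau> k \<in> {0..t}" "\<tau> (Suc k) \<in> {0..t}" "\<xi> k \<in> borel_measurable (F (\<tau> k))"
    using assms by (auto simp: simple_process_def)
  with \<open>t \<le> 1\<close> show "\<xi> k \<in> borel_measurable P" "W (\<tau> (Suc k)) \<in> borel_measurable P"
    "W (\<tau> k) \<in> borel_measurable P"
    by - (rule measurable_F_P, assumption, (rule W_measurable, simp)+)
qed

lemma simple_value_joint_measurable:
  assumes "simple_process P F t N \<tau> \<xi>"
  shows "(\<lambda>(s, w). simple_value N \<tau> \<xi> s w) \<in> borel_measurable (borel \<Otimes>\<^sub>M P)"
proof -
  have \<xi>: "\<xi> k \<in> borel_measurable P" if "k \<in> {..<N}" for k
    using assms measurable_F_P[of "\<xi> k" "\<tau> k"] that by (auto simp: simple_process_def)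
  show ?thesis
    unfolding simple_value_def split_beta'
    by (intro borel_measurable_sum borel_measurable_times measurable_compose[OF measurable_snd \<xi>]
        measurable_compose[OF measurable_fst borel_measurable_indicator]) auto
qed

text \<open>Stopping the integrand once its accumulated energy exceeds \<open>\<delta>\<close> bounds the second
  moment of the integral without any integrability assumption.\<close>

lemma prob_predictable_sum_le:
  assumes s: "\<And>i j. i < j \<Longrightarrow> j \<le> n \<Longrightarrow> s i < s j" and s01: "\<And>j. j \<le> n \<Longrightarrow> s j \<in> {0..1}"
    and d: "\<And>j. j < n \<Longrightarrow> d j \<in> borel_measurable (F (s j))"
    and "\<epsilon> > 0" "\<delta> > 0"
  shows "prob {w\<in>space P. \<bar>\<Sum>j<n. d j w * (W (s (Suc j)) w - W (s j) w)\<bar> > \<epsilon>} \<le>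
    prob {w\<in>space P. (\<Sum>j<n. (d j w)\<^sup>2 * (s (Suc j) - s j)) > \<delta>} + v * \<delta> / \<epsilon>\<^sup>2"
proof -
  define C where "C k w = (\<Sum>j<k. (d j w)\<^sup>2 * (s (Suc j) - s j))" for k w
  \<comment> \<open>The cutoff at index j tests \<open>C (Suc j)\<close>, which already contains the
    j-th term. It is predictable because \<open>d j\<close> is known at time \<open>s j\<close>, and
    it keeps the total energy of \<open>e\<close> at most \<delta>, without overshoot.\<close>
  define e where "e j w = (if C (Suc j) w \<le> \<delta> then d j w else 0)" for j w
  have sj: "s j < s (Suc j)" "0 \<le> s j" "s (Suc j) \<le> 1" if "j < n" for j
    using s[of j "Suc j"] s01[of j] s01[of "Suc j"] that by auto
  have smono: "s i \<le> s j" if "i \<le> j" "j < n" for i j using s[of i j] that by (cases "i = j") auto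
  have C: "C (Suc j) \<in> borel_measurable (F (s j))" if "j < n" for j
    unfolding C_def[abs_def] using that smono
    by (intro borel_measurable_sum borel_measurable_times borel_measurable_power)
       (auto intro!: measurable_F_mono[OF _ d])
  have e: "e j \<in> borel_measurable (F (s j))" if "j < n" for j
    unfolding e_def[abs_def] using C[OF that] d[OF that] by measurable
  have C_mono: "C i w \<le> C j w" if "i \<le> j" "j \<le> n" for i j w
    unfolding C_def using that sj by (intro sum_mono2) (auto simp: less_imp_le)
  \<comment> \<open>The bound by \<open>C k w\<close> closes the induction: if \<open>d k\<close> is
    kept, the new total is at most \<open>C (Suc k) w\<close>, which does not exceed \<delta>; if it
    is cut off, the total does not change.\<close>
  have E: "(\<Sum>j<k. (e j w)\<^sup>2 * (s (Suc j) - s j)) \<le> min \<delta> (C k w)" if "k \<le> n" for k w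
    using that
  proof (induction k)
    case (Suc k)
    then have *: "(\<Sum>j<k. (e j w)\<^sup>2 * (s (Suc j) - s j)) \<le> min \<delta> (C k w)" by simp
    have "C k w \<le> C (Suc k) w" using Suc.prems by (intro C_mono) auto
    moreover have "C (Suc k) w = C k w + (d k w)\<^sup>2 * (s (Suc k) - s k)" by (simp add: C_def)
    ultimately show ?case using * by (simp add: e_def)
  qed (use \<open>\<delta> > 0\<close> in \<open>simp add: C_def\<close>)
  have e_bound: "(e j w)\<^sup>2 * (s (Suc j) - s j) \<le> \<delta>" if "j < n" for j w
  proof -
    have "(e j w)\<^sup>2 * (s (Suc j) - s j) \<le> (\<Sum>j<n. (e j w)\<^sup>2 * (s (Suc j) - s j))"
      using that sj by (intro member_le_sum) (auto simp: less_imp_le)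
    then show ?thesis using E[of n w] by simp
  qed
  \<comment> \<open>Cells have positive length, so an energy bound bounds \<open>e j\<close> itself,
    although \<open>d j\<close> need not be square integrable.\<close>
  have e2: "integrable P (\<lambda>w. (e j w)\<^sup>2)" if "j < n" for j
  proof (rule integrable_const_bound[where B = "\<delta> / (s (Suc j) - s j)"])
    show "AE w in P. norm ((e j w)\<^sup>2) \<le> \<delta> / (s (Suc j) - s j)"
      using e_bound[OF that] sj[OF that] by (auto simp: pos_le_divide_eq)
    show "(\<lambda>w. (e j w)\<^sup>2) \<in> borel_measurable P"
      using measurable_F_P[OF e[OF that]] by measurable
  qed
  define S where "S w = (\<Sum>j<n. e j w * (W (s (Suc j)) w - W (s j) w))" for w
  define D where "D w = (\<Sum>j<n. d j w * (W (s (Suc j)) w - W (s j) w))" for w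
  have Wm: "W (s j) \<in> borel_measurable P" if "j \<le> n" for j using s01[OF that] by (rule W_measurable)
  have Sm[measurable]: "S \<in> borel_measurable P"
    unfolding S_def[abs_def]
    by (intro borel_measurable_sum borel_measurable_times borel_measurable_diff Wm measurable_F_P[OF e]) auto
  have Dm[measurable]: "D \<in> borel_measurable P"
    unfolding D_def[abs_def]
    by (intro borel_measurable_sum borel_measurable_times borel_measurable_diff Wm measurable_F_P[OF d]) auto
  have Cm[measurable]: "C n \<in> borel_measurable P"
    unfolding C_def[abs_def]
    by (intro borel_measurable_sum borel_measurable_times borel_measurable_power measurable_F_P[OF d]) auto
  have S: "integrable P (\<lambda>w. (S w)\<^sup>2)"
    "expectation (\<lambda>w. (S w)\<^sup>2) = v * (\<Sum>j<n. expectation (\<lambda>w. (e j w)\<^sup>2) * (s (Suc j) - s j))"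
    unfolding S_def using W_isometry[where s = s and e = e and n = n, OF s s01 e e2] by auto
  have "(\<Sum>j<n. expectation (\<lambda>w. (e j w)\<^sup>2) * (s (Suc j) - s j)) =
    expectation (\<lambda>w. \<Sum>j<n. (e j w)\<^sup>2 * (s (Suc j) - s j))"
    using e2 by (subst Bochner_Integration.integral_sum) auto
  also have "\<dots> \<le> expectation (\<lambda>w. \<delta>)"
    using e2 E[of n] by (intro integral_mono) auto
  finally have ES: "expectation (\<lambda>w. (S w)\<^sup>2) \<le> v * \<delta>"
    unfolding S using v_nonneg by (intro mult_left_mono) (auto simp: prob_space)
  have "S w = D w" if "C n w \<le> \<delta>" for w
  proof -
    have "C (Suc j) w \<le> \<delta>" if "j < n" for j
      using C_mono[of "Suc j" n w] that \<open>C n w \<le> \<delta>\<close> by simp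
    then show ?thesis unfolding S_def D_def by (intro sum.cong) (auto simp: e_def)
  qed
  \<comment> \<open>Where the total energy stays within \<delta> nothing is cut off and
    \<open>S\<close> equals \<open>D\<close>. Chebyshev's inequality is then applied to
    \<open>S\<close> only.\<close>
  then have sub: "{w\<in>space P. \<bar>D w\<bar> > \<epsilon>} \<subseteq> {w\<in>space P. C n w > \<delta>} \<union> {w\<in>space P. \<bar>S w\<bar> > \<epsilon>}"
    by (smt (verit, del_insts) UnCI mem_Collect_eq subsetI)
  then have "prob {w\<in>space P. \<bar>D w\<bar> > \<epsilon>} \<le> prob ({w\<in>space P. C n w > \<delta>} \<union> {w\<in>space P. \<bar>S w\<bar> > \<epsilon>})"
    by (intro finite_measure_mono) auto
  also have "\<dots> \<le> prob {w\<in>space P. C n w > \<delta>} + prob {w\<in>space P. \<bar>S w\<bar> > \<epsilon>}"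
    by (rule measure_subadditive) auto
  also have "prob {w\<in>space P. \<bar>S w\<bar> > \<epsilon>} \<le> v * \<delta> / \<epsilon>\<^sup>2"
    using prob_abs_gt_le[OF Sm S(1) \<open>\<epsilon> > 0\<close>] ES divide_right_mono[OF ES, of "\<epsilon>\<^sup>2"] by simp
  finally show ?thesis unfolding C_def D_def by simp
qed

text \<open>Continuity of the elementary integral in probability with respect to the energy distance
  of the integrands. On the union of the nodes the difference of the two processes is again a
  predictable step process, so the previous estimate applies; its discrete energy is dominated by
  the integrated one.\<close>

lemma prob_simple_integral_diff_le:
  assumes p: "simple_process P F t N \<tau> \<xi>" and p': "simple_process P F t N' \<tau>' \<xi>'"
    and t: "t \<le> 1" and "\<epsilon> > 0" "\<delta> > 0"
  shows "prob {w\<in>space P. \<bar>simple_integral W N \<tau> \<xi> w - simple_integral W N' \<tau>' \<xi>' w\<bar> > \<epsilon>} \<le>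
    prob {w\<in>space P. (\<integral>\<^sup>+s\<in>{0..t}. ennreal ((simple_value N \<tau> \<xi> s w - simple_value N' \<tau>' \<xi>' s w)\<^sup>2) \<partial>lborel)
      > ennreal \<delta>} + v * \<delta> / \<epsilon>\<^sup>2"
proof -
  obtain n s where s: "\<And>i j. i < j \<Longrightarrow> j \<le> n \<Longrightarrow> s i < s j" and im: "s ` {..n::nat} = \<tau> ` {..N} \<union> \<tau>' ` {..N'}"
    by (rule finite_set_strict_enumeration[of "\<tau> ` {..N} \<union> \<tau>' ` {..N'}"]) auto
  have st: "s j \<in> {0..t}" if "j \<le> n" for j
  proof -
    have "s j \<in> \<tau> ` {..N} \<union> \<tau>' ` {..N'}" using that unfolding im[symmetric] by auto
    then show ?thesis using p p' by (auto simp: simple_process_def)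
  qed
  then have s01: "s j \<in> {0..1}" if "j \<le> n" for j using that t by force
  have \<tau>: "\<tau> k \<in> s ` {..n}" if "k \<le> N" for k using im that by auto
  have \<tau>': "\<tau>' k \<in> s ` {..n}" if "k \<le> N'" for k using im that by auto
  define V where "V u w = simple_value N \<tau> \<xi> u w - simple_value N' \<tau>' \<xi>' u w" for u w
  define d where "d j w = V (s (Suc j)) w" for j w
  have sj: "s j < s (Suc j)" if "j < n" for j
    using s[of j "Suc j"] that by auto
  have d: "d j \<in> borel_measurable (F (s j))" if "j < n" for j
    unfolding d_def[abs_def] V_def using p p' that
    by (intro borel_measurable_diff simple_value_predictable[where s = s and \<tau> = \<tau>, OF s \<tau>] simple_value_predictable[where s = s and \<tau> = \<tau>', OF s \<tau>'])
       (auto simp: simple_process_def)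
  have I: "simple_integral W N \<tau> \<xi> w - simple_integral W N' \<tau>' \<xi>' w =
    (\<Sum>j<n. d j w * (W (s (Suc j)) w - W (s j) w))" for w
    using p p' unfolding d_def V_def left_diff_distrib sum_subtractf
    by (intro arg_cong2[where f = "(-)"] simple_integral_refine[where s = s and \<tau> = \<tau>, OF s \<tau>] simple_integral_refine[where s = s and \<tau> = \<tau>', OF s \<tau>'])
       (auto simp: simple_process_def)
  have [measurable]: "(\<lambda>(s, w). V s w) \<in> borel_measurable (borel \<Otimes>\<^sub>M P)"
    using simple_value_joint_measurable[OF p] simple_value_joint_measurable[OF p'] unfolding V_def by measurable
  have le: "ennreal (\<Sum>j<n. (d j w)\<^sup>2 * (s (Suc j) - s j)) \<le> (\<integral>\<^sup>+u\<in>{0..t}. ennreal ((V u w)\<^sup>2) \<partial>lborel)"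
    if "w \<in> space P" for w
  proof -
    have Vm[measurable]: "(\<lambda>u. V u w) \<in> borel_measurable borel"
      using that by measurable
    have "ennreal (\<Sum>j<n. (d j w)\<^sup>2 * (s (Suc j) - s j)) = (\<Sum>j<n. ennreal ((d j w)\<^sup>2) * ennreal (s (Suc j) - s j))"
      using sj by (subst sum_ennreal[symmetric]) (auto intro!: sum.cong simp: ennreal_mult less_imp_le)
    also have "\<dots> = (\<Sum>j<n. \<integral>\<^sup>+u. ennreal ((d j w)\<^sup>2) * indicator {s j<..s (Suc j)} u \<partial>lborel)"
      using sj by (intro sum.cong) (auto simp: nn_integral_cmult less_imp_le)
    also have "\<dots> = (\<integral>\<^sup>+u. (\<Sum>j<n. ennreal ((d j w)\<^sup>2) * indicator {s j<..s (Suc j)} u) \<partial>lborel)"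
      by (subst nn_integral_sum) auto
    also have "\<dots> \<le> (\<integral>\<^sup>+u\<in>{0..t}. ennreal ((V u w)\<^sup>2) \<partial>lborel)"
    proof (rule nn_integral_mono)
      fix u
      show "(\<Sum>j<n. ennreal ((d j w)\<^sup>2) * indicator {s j<..s (Suc j)} u) \<le> ennreal ((V u w)\<^sup>2) * indicator {0..t} u"
      proof (cases "\<exists>j<n. s j < u \<and> u \<le> s (Suc j)")
        case True
        then obtain j where j: "j < n" "s j < u" "u \<le> s (Suc j)" by auto
        have "(\<Sum>j<n. ennreal ((d j w)\<^sup>2) * indicator {s j<..s (Suc j)} u) =
          (\<Sum>k<n. if k = j then ennreal ((d k w)\<^sup>2) else 0)"
        proof (rule sum.cong)
          fix k assume k: "k \<in> {..<n}"
          have "s k < u \<longleftrightarrow> k \<le> j" "s (Suc k) < u \<longleftrightarrow> Suc k \<le> j"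
            using k by (intro strict_partition_less_iff[where s = s, OF s j(1) _ j(2,3)]; simp)+
          then show "ennreal ((d k w)\<^sup>2) * indicator {s k<..s (Suc k)} u = (if k = j then ennreal ((d k w)\<^sup>2) else 0)"
            by (auto simp: indicator_def not_less[symmetric])
        qed simp
        also have "\<dots> = ennreal ((d j w)\<^sup>2)" using j(1) by simp
        also have "d j w = V u w"
          unfolding d_def V_def
          by (simp only: simple_value_refine[where s = s and \<tau> = \<tau> and N = N, OF s \<tau> j]
              simple_value_refine[where s = s and \<tau> = \<tau>' and N = N', OF s \<tau>' j])
        also have "u \<in> {0..t}" using st[of j] st[of "Suc j"] j by auto
        ultimately show ?thesis by simp
      next
        case False
        then have "(\<Sum>j<n. ennreal ((d j w)\<^sup>2) * indicator {s j<..s (Suc j)} u) = 0"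
          by (intro sum.neutral) (auto simp: indicator_def)
        then show ?thesis by simp
      qed
    qed
    finally show ?thesis .
  qed
  have "prob {w\<in>space P. \<bar>\<Sum>j<n. d j w * (W (s (Suc j)) w - W (s j) w)\<bar> > \<epsilon>} \<le>
    prob {w\<in>space P. (\<Sum>j<n. (d j w)\<^sup>2 * (s (Suc j) - s j)) > \<delta>} + v * \<delta> / \<epsilon>\<^sup>2"
    using s s01 d assms(4,5) by (rule prob_predictable_sum_le)
  also have "prob {w\<in>space P. (\<Sum>j<n. (d j w)\<^sup>2 * (s (Suc j) - s j)) > \<delta>} \<le>
    prob {w\<in>space P. (\<integral>\<^sup>+u\<in>{0..t}. ennreal ((V u w)\<^sup>2) \<partial>lborel) > ennreal \<delta>}"
  proof (rule finite_measure_mono)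
    show "{w\<in>space P. (\<Sum>j<n. (d j w)\<^sup>2 * (s (Suc j) - s j)) > \<delta>} \<subseteq>
      {w\<in>space P. (\<integral>\<^sup>+u\<in>{0..t}. ennreal ((V u w)\<^sup>2) \<partial>lborel) > ennreal \<delta>}"
    proof safe
      fix w assume w: "w \<in> space P" and gt: "(\<Sum>j<n. (d j w)\<^sup>2 * (s (Suc j) - s j)) > \<delta>"
      have "ennreal \<delta> < ennreal (\<Sum>j<n. (d j w)\<^sup>2 * (s (Suc j) - s j))"
        using gt \<open>\<delta> > 0\<close> by (intro ennreal_lessI) auto
      also note le[OF w]
      finally show "ennreal \<delta> < (\<integral>\<^sup>+u\<in>{0..t}. ennreal ((V u w)\<^sup>2) \<partial>lborel)" .
    qed
  qed measurable
  finally show ?thesis unfolding I V_def by simp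
qed

end

section \<open>Ito integrals as limits of Riemann sums\<close>

text \<open>There are m + 1 cells, so the mesh is positive and defined for every m.\<close>

definition grid :: "real \<Rightarrow> nat \<Rightarrow> nat \<Rightarrow> real" where
  "grid t m j = t * real j / real (Suc m)"

definition riemann_sum :: "(real \<Rightarrow> 'a \<Rightarrow> real) \<Rightarrow> (real \<Rightarrow> 'a \<Rightarrow> real) \<Rightarrow> real \<Rightarrow> nat \<Rightarrow> 'a \<Rightarrow> real" where
  "riemann_sum W H t m w =
     (\<Sum>j<Suc m. H (grid t m j) w * (W (grid t m (Suc j)) w - W (grid t m j) w))"

lemma grid_strict: "0 < t \<Longrightarrow> i < j \<Longrightarrow> grid t m i < grid t m j"
  unfolding grid_def by (intro divide_strict_right_mono mult_strict_left_mono) auto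

lemma grid_0 [simp]: "grid t m 0 = 0"
  by (simp add: grid_def)

lemma grid_last [simp]: "grid t m (Suc m) = t"
  by (simp add: grid_def)

lemma grid_step: "grid t m (Suc j) - grid t m j = t / real (Suc m)"
  unfolding grid_def diff_divide_distrib[symmetric] by (simp add: algebra_simps)

lemma grid_range: "0 < t \<Longrightarrow> j \<le> Suc m \<Longrightarrow> grid t m j \<in> {0..t}"
  using grid_strict[of t 0 j m] grid_strict[of t j "Suc m" m]
  by (cases "j = 0"; cases "j = Suc m") auto

lemma grid_cell:
  assumes "0 < t" "0 < u" "u \<le> t"
  obtains j where "j < Suc m" "grid t m j < u" "u \<le> grid t m (Suc j)"
proof -
  define k where "k = (LEAST k. u \<le> grid t m k)"
  have ex: "u \<le> grid t m (Suc m)" using assms by simp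
  have k: "u \<le> grid t m k" unfolding k_def using ex by (rule LeastI)
  have "k \<le> Suc m" unfolding k_def using ex by (rule Least_le)
  have "k \<noteq> 0" using k assms by (cases k) auto
  then obtain j where j: "k = Suc j" by (cases k) auto
  have "\<not> u \<le> grid t m j"
    using not_less_Least[of j "\<lambda>k. u \<le> grid t m k"] j unfolding k_def by auto
  with that[of j] k j \<open>k \<le> Suc m\<close> show thesis by auto
qed

lemma ennreal_square_diff_le:
  "ennreal ((a - b)\<^sup>2) \<le> 2 * ennreal ((a - c)\<^sup>2) + 2 * ennreal ((b - c)\<^sup>2)"
proof -
  have "(a - b)\<^sup>2 \<le> 2 * (a - c)\<^sup>2 + 2 * (b - c)\<^sup>2"
    using zero_le_power2[of "a + b - 2 * c"] by (simp add: power2_eq_square algebra_simps)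
  then have "ennreal ((a - b)\<^sup>2) \<le> ennreal (2 * (a - c)\<^sup>2 + 2 * (b - c)\<^sup>2)"
    by (rule ennreal_leI)
  then show ?thesis by (simp add: ennreal_plus ennreal_mult)
qed

lemma continuous_on_Icc_bounded:
  fixes f :: "real \<Rightarrow> real"
  assumes "continuous_on {a..b} f"
  obtains K where "\<And>s. s \<in> {a..b} \<Longrightarrow> \<bar>f s\<bar> \<le> K"
proof -
  have "bounded (f ` {a..b})"
    by (intro compact_imp_bounded compact_continuous_image assms) simp
  then obtain K where "\<forall>x\<in>f ` {a..b}. norm x \<le> K" unfolding bounded_iff by blast
  then show thesis using that[of K] by auto
qed

lemma square_diff_measurable:
  fixes X Y :: "real \<Rightarrow> real"
  assumes [measurable]: "X \<in> borel_measurable borel" "Y \<in> borel_measurable borel"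
  shows "(\<lambda>s. ennreal ((X s - Y s)\<^sup>2) * indicator {0..t} s) \<in> borel_measurable lborel"
  by measurable

text \<open>Progressive measurability concerns the strip [0, t] only. Clamping the time into [0, t]
  yields a function jointly measurable on the whole product, as needed for the energy integrals to
  be random variables, and changes nothing on the strip.\<close>

lemma (in filtered_prob_space) progressively_measurable_joint:
  assumes pm: "progressively_measurable F t H" and t: "0 \<le> t"
  shows "(\<lambda>(s, w). H (max 0 (min t s)) w) \<in> borel_measurable (borel \<Otimes>\<^sub>M P)"
proof -
  have 1: "(\<lambda>(s, w). H s w) \<in> borel_measurable (restrict_space borel {0..t} \<Otimes>\<^sub>M F t)"
    using pm t unfolding progressively_measurable_def by auto
  have id: "(\<lambda>w. w) \<in> measurable P (F t)"
    using sets_F_subset[of t] sets.sets_into_space[of _ P] by (auto simp: measurable_def space_F Int_absorb2)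
  have 2: "(\<lambda>(s, w). (max 0 (min t s), w)) \<in> measurable (borel \<Otimes>\<^sub>M P) (restrict_space borel {0..t} \<Otimes>\<^sub>M F t)"
    unfolding split_beta'
  proof (rule measurable_Pair)
    show "(\<lambda>x. max 0 (min t (fst x))) \<in> measurable (borel \<Otimes>\<^sub>M P) (restrict_space borel {0..t})"
      using t by (intro measurable_restrict_space2) auto
    show "(\<lambda>x. snd x) \<in> measurable (borel \<Otimes>\<^sub>M P) (F t)"
      using measurable_compose[OF measurable_snd id] .
  qed
  from measurable_compose[OF 2 1] show ?thesis by (simp add: split_beta')
qed

context orthogonal_increments
begin

lemma riemann_sum_measurable:
  assumes "0 < t" "t \<le> 1" and H: "\<And>s. s \<in> {0..t} \<Longrightarrow> H s \<in> borel_measurable P"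
  shows "riemann_sum W H t m \<in> borel_measurable P"
  unfolding riemann_sum_def[abs_def]
proof (intro borel_measurable_sum borel_measurable_times borel_measurable_diff)
  fix j assume "j \<in> {..<Suc m}"
  then have *: "grid t m j \<in> {0..t}" "grid t m (Suc j) \<in> {0..t}"
    using grid_range[OF \<open>0 < t\<close>, of j m] grid_range[OF \<open>0 < t\<close>, of "Suc j" m] by auto
  show "H (grid t m j) \<in> borel_measurable P" by (rule H[OF *(1)])
  show "W (grid t m j) \<in> borel_measurable P" "W (grid t m (Suc j)) \<in> borel_measurable P"
    using * \<open>t \<le> 1\<close> by (auto intro!: W_measurable)
qed

text \<open>The approximating sequence inside \<open>has_ito_integral\<close> is arbitrary. The step
  processes of a continuous integrand also approach it in energy, so
  \<open>prob_simple_integral_diff_le\<close> forces their elementary integrals to the same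
  limit.\<close>

lemma ito_integral_riemann_sum:
  assumes ito: "has_ito_integral P F W H t J" and t: "0 < t" "t \<le> 1"
    and H: "\<And>s. s \<in> {0..t} \<Longrightarrow> H s \<in> borel_measurable (F s)"
    and cont: "\<And>w. w \<in> space P \<Longrightarrow> continuous_on {0..t} (\<lambda>s. H s w)"
  shows "tendsto_prob P (riemann_sum W H t) J"
proof -
  from ito have pm: "progressively_measurable F t H" and J[measurable]: "J \<in> borel_measurable P"
    unfolding has_ito_integral_def by auto
  from ito obtain N \<tau> \<xi> where
    sp: "\<And>n. simple_process P F t (N n) (\<tau> n) (\<xi> n)" and
    l1: "\<And>\<epsilon>. \<epsilon> > 0 \<Longrightarrow> (\<lambda>n. prob {w\<in>space P.
            (\<integral>\<^sup>+s\<in>{0..t}. ennreal ((simple_value (N n) (\<tau> n) (\<xi> n) s w - H s w)\<^sup>2) \<partial>lborel)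
              > ennreal \<epsilon>}) \<longlonglongrightarrow> 0" and
    l2: "\<And>\<epsilon>. \<epsilon> > 0 \<Longrightarrow> (\<lambda>n. prob {w\<in>space P.
            \<bar>simple_integral W (N n) (\<tau> n) (\<xi> n) w - J w\<bar> > \<epsilon>}) \<longlonglongrightarrow> 0"
    unfolding has_ito_integral_def by blast
  define H' where "H' s w = H (max 0 (min t s)) w" for s w
  have H'm: "(\<lambda>(s, w). H' s w) \<in> borel_measurable (borel \<Otimes>\<^sub>M P)"
    unfolding H'_def using progressively_measurable_joint[OF pm] t by simp
  have H': "H' s w = H s w" if "s \<in> {0..t}" for s w
    using that by (simp add: H'_def)
  define V where "V n s w = simple_value (N n) (\<tau> n) (\<xi> n) s w" for n s w
  have Vm: "(\<lambda>(s, w). V n s w) \<in> borel_measurable (borel \<Otimes>\<^sub>M P)" for n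
    unfolding V_def by (rule simple_value_joint_measurable[OF sp])
  \<comment> \<open>A simple process has to be bounded uniformly over outcomes, whereas H is bounded
    only along each path. Truncating at level m makes the Riemann integrand admissible, and along a
    given path the truncation is inactive for large m.\<close>
  define \<zeta> where "\<zeta> m j w = max (- real m) (min (real m) (H (grid t m j) w))" for m j w
  have sp': "simple_process P F t (Suc m) (grid t m) (\<zeta> m)" for m
    unfolding simple_process_def
  proof (intro conjI allI impI)
    fix k
    show "k \<le> Suc m \<Longrightarrow> grid t m k \<in> {0..t}" using grid_range[OF t(1)] .
    show "grid t m k \<le> grid t m (Suc k)" using grid_strict[OF t(1), of k "Suc k" m] by simp
    assume "k < Suc m"
    then have "H (grid t m k) \<in> borel_measurable (F (grid t m k))"
      using grid_range[OF t(1), of k m] by (intro H) auto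
    then show "\<zeta> m k \<in> borel_measurable (F (grid t m k))"
      unfolding \<zeta>_def by measurable
  next
    show "\<exists>c. \<forall>k<Suc m. \<forall>w\<in>space P. \<bar>\<zeta> m k w\<bar> \<le> c"
      by (rule exI[of _ "real m"]) (auto simp: \<zeta>_def)
  qed
  define G where "G m s w = simple_value (Suc m) (grid t m) (\<zeta> m) s w" for m s w
  have Gm: "(\<lambda>(s, w). G m s w) \<in> borel_measurable (borel \<Otimes>\<^sub>M P)" for m
    unfolding G_def by (rule simple_value_joint_measurable[OF sp'])
  define R where "R m = simple_integral W (Suc m) (grid t m) (\<zeta> m)" for m
  define I where "I n = simple_integral W (N n) (\<tau> n) (\<xi> n)" for n
  have Rm[measurable]: "R m \<in> borel_measurable P" for m
    unfolding R_def by (rule simple_integral_measurable[OF sp' t(2)])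
  have Im[measurable]: "I m \<in> borel_measurable P" for m
    unfolding I_def by (rule simple_integral_measurable[OF sp t(2)])
  define E where "E A B w = (\<integral>\<^sup>+s\<in>{0..t}. ennreal ((A s w - B s w)\<^sup>2) \<partial>lborel)"
    for A B :: "real \<Rightarrow> 'a \<Rightarrow> real" and w
  have Em: "E A B \<in> borel_measurable P"
    if [measurable]: "(\<lambda>(s, w). A s w) \<in> borel_measurable (borel \<Otimes>\<^sub>M P)"
      "(\<lambda>(s, w). B s w) \<in> borel_measurable (borel \<Otimes>\<^sub>M P)" for A B
    unfolding E_def[abs_def] by measurable
  have E_H': "E A H' w = (\<integral>\<^sup>+s\<in>{0..t}. ennreal ((A s w - H s w)\<^sup>2) \<partial>lborel)" for A w
    unfolding E_def by (intro nn_integral_cong) (auto simp: H' indicator_def)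
  have E_triangle: "E A B w \<le> 2 * E A H' w + 2 * E B H' w"
    if A: "(\<lambda>(s, w). A s w) \<in> borel_measurable (borel \<Otimes>\<^sub>M P)"
      and B: "(\<lambda>(s, w). B s w) \<in> borel_measurable (borel \<Otimes>\<^sub>M P)" and w: "w \<in> space P" for A B w
  proof -
    have [measurable]: "(\<lambda>s. X s w) \<in> borel_measurable borel"
      if "(\<lambda>(s, w). X s w) \<in> borel_measurable (borel \<Otimes>\<^sub>M P)" for X :: "real \<Rightarrow> 'a \<Rightarrow> real"
      using measurable_compose[OF measurable_Pair2'[OF w, of borel] that] by simp
    note m = this[OF A] this[OF B] this[OF H'm]
    have "E A B w \<le> (\<integral>\<^sup>+s. 2 * (ennreal ((A s w - H' s w)\<^sup>2) * indicator {0..t} s) +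
        2 * (ennreal ((B s w - H' s w)\<^sup>2) * indicator {0..t} s) \<partial>lborel)"
      unfolding E_def
    proof (rule nn_integral_mono)
      fix s
      show "ennreal ((A s w - B s w)\<^sup>2) * indicator {0..t} s \<le>
        2 * (ennreal ((A s w - H' s w)\<^sup>2) * indicator {0..t} s) +
        2 * (ennreal ((B s w - H' s w)\<^sup>2) * indicator {0..t} s)"
        using ennreal_square_diff_le[of "A s w" "B s w" "H' s w"]
        by (cases "s \<in> {0..t}") simp_all
    qed
    also have "\<dots> = 2 * E A H' w + 2 * E B H' w"
      unfolding E_def
      by (simp only: nn_integral_add[OF
            borel_measurable_times_ennreal[OF borel_measurable_const square_diff_measurable[OF m(1,3)]]
            borel_measurable_times_ennreal[OF borel_measurable_const square_diff_measurable[OF m(2,3)]]]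
          nn_integral_cmult[OF square_diff_measurable[OF m(1,3)]]
          nn_integral_cmult[OF square_diff_measurable[OF m(2,3)]])
    finally show ?thesis .
  qed
  \<comment> \<open>This convergence is pathwise: once m exceeds a bound of the path and the mesh is
    below its modulus of continuity for \<open>sqrt \<delta>\<close>, the energy is at most \<delta>
    t, hence at most \<delta>.\<close>
  have G_lim: "(\<lambda>m. prob {w\<in>space P. E (G m) H' w > ennreal \<delta>}) \<longlonglongrightarrow> 0" if \<delta>: "\<delta> > 0" for \<delta>
  proof (rule prob_tendsto_0)
    show "{w\<in>space P. E (G m) H' w > ennreal \<delta>} \<in> events" for m
      using Em[OF Gm[of m] H'm] by measurable
    fix w assume w: "w \<in> space P"
    obtain K where K: "\<And>s. s \<in> {0..t} \<Longrightarrow> \<bar>H s w\<bar> \<le> K"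
      using continuous_on_Icc_bounded[OF cont[OF w]] by blast
    have "uniformly_continuous_on {0..t} (\<lambda>s. H s w)"
      by (rule compact_uniformly_continuous[OF cont[OF w]]) simp
    then obtain d where d: "d > 0" "\<And>s s'. s \<in> {0..t} \<Longrightarrow> s' \<in> {0..t} \<Longrightarrow> \<bar>s' - s\<bar> < d \<Longrightarrow> \<bar>H s' w - H s w\<bar> < sqrt \<delta>"
      unfolding uniformly_continuous_on_def dist_real_def using \<delta> by (metis real_sqrt_gt_zero)
    have "(\<lambda>m. t / real (Suc m)) \<longlonglongrightarrow> 0"
      by (rule LIMSEQ_Suc[OF lim_const_over_n])
    then have "eventually (\<lambda>m. t / real (Suc m) < d) sequentially"
      using d(1) by (rule order_tendstoD(2))
    moreover have "eventually (\<lambda>m. K \<le> real m) sequentially"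
      using filterlim_real_sequentially by (simp add: filterlim_at_top)
    ultimately show "eventually (\<lambda>m. w \<notin> {w\<in>space P. E (G m) H' w > ennreal \<delta>}) sequentially"
    proof eventually_elim
      case (elim m)
      have G: "\<bar>G m u w - H' u w\<bar> \<le> sqrt \<delta>" if u: "0 < u" "u \<le> t" for u
      proof -
        obtain j where j: "j < Suc m" "grid t m j < u" "u \<le> grid t m (Suc j)"
          using grid_cell[OF t(1) u] .
        have gj: "grid t m j \<in> {0..t}" using grid_range[OF t(1), of j m] j(1) by simp
        have "G m u w = \<zeta> m j w"
          unfolding G_def by (rule simple_value_strict[where s = "grid t m"]) (use j grid_strict[OF t(1)] in auto)
        also have "\<dots> = H (grid t m j) w" using K[OF gj] elim(2) by (auto simp: \<zeta>_def)
        finally show ?thesis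
          using d(2)[of u "grid t m j"] gj u j elim(1) grid_step[of t m j] by (simp add: H' abs_minus_commute)
      qed
      have "E (G m) H' w \<le> (\<integral>\<^sup>+s. ennreal \<delta> * indicator {0..t} s \<partial>lborel)"
        unfolding E_def
      proof (rule nn_integral_mono_AE)
        \<comment> \<open>Time 0 belongs to no left-open cell, so the step process is 0 there; the
          estimate holds off this single point.\<close>
        show "AE s in lborel. ennreal ((G m s w - H' s w)\<^sup>2) * indicator {0..t} s \<le> ennreal \<delta> * indicator {0..t} s"
          using AE_lborel_singleton[of 0]
        proof eventually_elim
          case (elim s)
          have "(G m s w - H' s w)\<^sup>2 \<le> \<delta>" if "s \<in> {0..t}"
          proof -
            have "(G m s w - H' s w)\<^sup>2 \<le> (sqrt \<delta>)\<^sup>2"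
              using G[of s] elim that \<delta> by (subst abs_le_square_iff[symmetric]) auto
            then show ?thesis using \<delta> by simp
          qed
          then show ?case by (auto simp: indicator_def intro!: ennreal_leI)
        qed
      qed
      also have "\<dots> = ennreal \<delta> * ennreal t"
        using t by (subst nn_integral_cmult_indicator) auto
      also have "\<dots> \<le> ennreal \<delta>"
        using t \<delta> by (subst ennreal_mult[symmetric]) (auto intro!: ennreal_leI mult_left_le)
      finally show ?case by (simp add: not_less)
    qed
  qed
  have V_lim: "(\<lambda>m. prob {w\<in>space P. E (V m) H' w > ennreal \<delta>}) \<longlonglongrightarrow> 0" if \<delta>: "\<delta> > 0" for \<delta>
    unfolding E_H' unfolding V_def using l1[OF \<delta>] .
  have R_lim: "tendsto_prob P R J"
    unfolding tendsto_prob_def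
  proof (intro allI impI)
    fix \<epsilon> :: real assume \<epsilon>: "\<epsilon> > 0"
    \<comment> \<open>The distance from \<open>R\<close> to \<open>J\<close> is split at
      \<open>I\<close>, half of \<epsilon> for each part. The quarters of \<delta> absorb the two
      factors 2 in \<open>E_triangle\<close>.\<close>
    have bound: "prob {w\<in>space P. \<bar>R m w - J w\<bar> > \<epsilon>} \<le>
        prob {w\<in>space P. E (G m) H' w > ennreal (\<delta> / 4)} + prob {w\<in>space P. E (V m) H' w > ennreal (\<delta> / 4)}
        + v * \<delta> / (\<epsilon> / 2)\<^sup>2 + prob {w\<in>space P. \<bar>I m w - J w\<bar> > \<epsilon> / 2}"
      if \<delta>: "\<delta> > 0" for m \<delta>
    proof -
      have "\<epsilon> / 2 < \<bar>a - b\<bar> \<or> \<epsilon> / 2 < \<bar>b - c\<bar>" if "\<epsilon> < \<bar>a - c\<bar>" for a b c :: real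
        using that by linarith
      then have "prob {w\<in>space P. \<bar>R m w - J w\<bar> > \<epsilon>} \<le>
        prob ({w\<in>space P. \<bar>R m w - I m w\<bar> > \<epsilon> / 2} \<union> {w\<in>space P. \<bar>I m w - J w\<bar> > \<epsilon> / 2})"
        by (intro finite_measure_mono) (blast, measurable)
      also have "\<dots> \<le> prob {w\<in>space P. \<bar>R m w - I m w\<bar> > \<epsilon> / 2} + prob {w\<in>space P. \<bar>I m w - J w\<bar> > \<epsilon> / 2}"
        by (rule measure_subadditive) auto
      also have "prob {w\<in>space P. \<bar>R m w - I m w\<bar> > \<epsilon> / 2} \<le>
        prob {w\<in>space P. E (G m) (V m) w > ennreal \<delta>} + v * \<delta> / (\<epsilon> / 2)\<^sup>2"
        unfolding R_def I_def E_def G_def V_def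
        by (rule prob_simple_integral_diff_le[OF sp' sp t(2)]) (use \<epsilon> \<delta> in auto)
      also have "prob {w\<in>space P. E (G m) (V m) w > ennreal \<delta>} \<le>
        prob ({w\<in>space P. E (G m) H' w > ennreal (\<delta> / 4)} \<union> {w\<in>space P. E (V m) H' w > ennreal (\<delta> / 4)})"
      proof (rule finite_measure_mono)
        show "{w\<in>space P. E (G m) (V m) w > ennreal \<delta>} \<subseteq>
          {w\<in>space P. E (G m) H' w > ennreal (\<delta> / 4)} \<union> {w\<in>space P. E (V m) H' w > ennreal (\<delta> / 4)}"
        proof (rule subsetI, rule ccontr)
          fix w assume "w \<in> {w\<in>space P. E (G m) (V m) w > ennreal \<delta>}"
            and "w \<notin> {w\<in>space P. E (G m) H' w > ennreal (\<delta> / 4)} \<union> {w\<in>space P. E (V m) H' w > ennreal (\<delta> / 4)}"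
          then have w: "w \<in> space P" and gt: "E (G m) (V m) w > ennreal \<delta>"
            and le: "E (G m) H' w \<le> ennreal (\<delta> / 4)" "E (V m) H' w \<le> ennreal (\<delta> / 4)"
            by (auto simp: not_less)
          have "E (G m) (V m) w \<le> 2 * E (G m) H' w + 2 * E (V m) H' w"
            by (rule E_triangle[OF Gm Vm w])
          also have "\<dots> \<le> 2 * ennreal (\<delta> / 4) + 2 * ennreal (\<delta> / 4)"
            using le by (intro add_mono mult_left_mono) auto
          also have "\<dots> = ennreal (\<delta> / 2) + ennreal (\<delta> / 2)"
            using ennreal_mult[of 2 "\<delta> / 4"] \<delta> by simp
          also have "\<dots> = ennreal \<delta>"
            using ennreal_plus[of "\<delta> / 2" "\<delta> / 2"] \<delta> by simp
          finally show False using gt by simp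
        qed
        show "{w\<in>space P. E (G m) H' w > ennreal (\<delta> / 4)} \<union> {w\<in>space P. E (V m) H' w > ennreal (\<delta> / 4)} \<in> events"
          using Em[OF Gm[of m] H'm] Em[OF Vm[of m] H'm] by measurable
      qed
      also have "\<dots> \<le> prob {w\<in>space P. E (G m) H' w > ennreal (\<delta> / 4)} + prob {w\<in>space P. E (V m) H' w > ennreal (\<delta> / 4)}"
        using Em[OF Gm[of m] H'm] Em[OF Vm[of m] H'm] by (intro measure_subadditive) auto
      finally show ?thesis by simp
    qed
    show "(\<lambda>m. prob {w\<in>space P. \<bar>R m w - J w\<bar> > \<epsilon>}) \<longlonglongrightarrow> 0"
    proof (rule order_tendstoI)
      fix a :: real assume "a < 0"
      then show "eventually (\<lambda>m. a < prob {w\<in>space P. \<bar>R m w - J w\<bar> > \<epsilon>}) sequentially"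
        by (intro always_eventually allI less_le_trans[OF _ measure_nonneg])
    next
      fix a :: real assume a: "0 < a"
      \<comment> \<open>Chosen so that the Chebyshev term is at most a/2; the denominator v + 1
        rather than v covers v = 0.\<close>
      define \<delta> where "\<delta> = a / 2 * (\<epsilon> / 2)\<^sup>2 / (v + 1)"
      have \<delta>: "\<delta> > 0" using a \<epsilon> v_nonneg by (simp add: \<delta>_def)
      have "v * \<delta> / (\<epsilon> / 2)\<^sup>2 = a / 2 * (v / (v + 1))" using \<epsilon> by (simp add: \<delta>_def)
      also have "\<dots> \<le> a / 2" using a v_nonneg by (intro mult_left_le) auto
      finally have v\<delta>: "v * \<delta> / (\<epsilon> / 2)\<^sup>2 \<le> a / 2" .
      have \<delta>4: "\<delta> / 4 > 0" and \<epsilon>2: "\<epsilon> / 2 > 0" using \<delta> \<epsilon> by auto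
      have l3: "(\<lambda>m. prob {w\<in>space P. \<bar>I m w - J w\<bar> > \<epsilon> / 2}) \<longlonglongrightarrow> 0"
        unfolding I_def by (rule l2[OF \<epsilon>2])
      have "(\<lambda>m. prob {w\<in>space P. E (G m) H' w > ennreal (\<delta> / 4)} + prob {w\<in>space P. E (V m) H' w > ennreal (\<delta> / 4)}
        + prob {w\<in>space P. \<bar>I m w - J w\<bar> > \<epsilon> / 2}) \<longlonglongrightarrow> 0"
        by (rule tendsto_add_zero[OF tendsto_add_zero[OF G_lim[OF \<delta>4] V_lim[OF \<delta>4]] l3])
      then have "eventually (\<lambda>m. prob {w\<in>space P. E (G m) H' w > ennreal (\<delta> / 4)} + prob {w\<in>space P. E (V m) H' w > ennreal (\<delta> / 4)}
        + prob {w\<in>space P. \<bar>I m w - J w\<bar> > \<epsilon> / 2} < a / 2) sequentially"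
        by (rule order_tendstoD(2)) (use a in simp)
      then show "eventually (\<lambda>m. prob {w\<in>space P. \<bar>R m w - J w\<bar> > \<epsilon>} < a) sequentially"
      proof eventually_elim
        case (elim m)
        then show ?case using bound[OF \<delta>, of m] v\<delta> by linarith
      qed
    qed
  qed
  have Hm: "H s \<in> borel_measurable P" if "s \<in> {0..t}" for s
    using measurable_F_P[OF H[OF that]] .
  note [measurable] = riemann_sum_measurable[OF t Hm]
  \<comment> \<open>The truncation is removed: along each path the two sums eventually
    coincide.\<close>
  have "tendsto_prob P (\<lambda>m w. riemann_sum W H t m w - R m w) (\<lambda>_. 0)"
  proof (rule tendsto_prob_pointwise)
    fix w assume w: "w \<in> space P"
    obtain K where K: "\<And>s. s \<in> {0..t} \<Longrightarrow> \<bar>H s w\<bar> \<le> K"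
      using continuous_on_Icc_bounded[OF cont[OF w]] by blast
    have "eventually (\<lambda>m. K \<le> real m) sequentially"
      using filterlim_real_sequentially by (simp add: filterlim_at_top)
    then have "eventually (\<lambda>m. riemann_sum W H t m w - R m w = 0) sequentially"
    proof eventually_elim
      case (elim m)
      have "\<zeta> m j w = H (grid t m j) w" if "j < Suc m" for j
        using K[OF grid_range[OF t(1), of j m]] elim that by (auto simp: \<zeta>_def)
      then show ?case
        unfolding riemann_sum_def R_def simple_integral_def sum_subtractf[symmetric] by simp
    qed
    then show "(\<lambda>m. riemann_sum W H t m w - R m w) \<longlonglongrightarrow> 0"
      by (rule tendsto_eventually)
  qed measurable
  from tendsto_prob_add[OF _ _ _ _ this R_lim] show ?thesis by simp
qed

end

section \<open>The linear stochastic differential equation\<close>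

text \<open>The left-endpoint bound for the integral of s^k over [a, b]. Summed over a grid of
  [0, t] the right-hand sides telescope to t^(k+1)/(k+1).\<close>

lemma power_mult_diff_le:
  fixes a b :: real
  assumes "0 \<le> a" "a \<le> b"
  shows "a ^ k * (b - a) \<le> (b ^ Suc k - a ^ Suc k) / real (Suc k)"
proof -
  have "real (Suc k) * a ^ k = (\<Sum>p<Suc k. a ^ k)" by simp
  also have "\<dots> \<le> (\<Sum>p<Suc k. b ^ p * a ^ (k - p))"
  proof (rule sum_mono)
    fix p assume "p \<in> {..<Suc k}"
    then have "a ^ k = a ^ p * a ^ (k - p)" by (simp add: power_add[symmetric])
    also have "\<dots> \<le> b ^ p * a ^ (k - p)" using assms by (intro mult_right_mono power_mono) auto
    finally show "a ^ k \<le> b ^ p * a ^ (k - p)" .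
  qed
  finally have "(b - a) * (real (Suc k) * a ^ k) \<le> (b - a) * (\<Sum>p<Suc k. b ^ p * a ^ (k - p))"
    using assms by (intro mult_left_mono) auto
  also have "\<dots> = b ^ Suc k - a ^ Suc k" by (rule diff_power_eq_sum[symmetric])
  finally have "(a ^ k * (b - a)) * real (Suc k) \<le> b ^ Suc k - a ^ Suc k"
    by (simp only: mult_ac)
  then show ?thesis by (subst pos_le_divide_eq) auto
qed

context orthogonal_increments
begin

text \<open>On the event that the path stays bounded by \<open>K\<close>, the Riemann sums agree with predictable sums
  of bounded integrands, so that the isometry gives a Gronwall inequality for the truncated second
  moment; iterating that inequality needs no regularity in \<open>t\<close>.\<close>

lemma truncated_second_moment_le:
  fixes D :: "real \<Rightarrow> 'a \<Rightarrow> real" and K :: real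
  defines "A \<equiv> \<lambda>t. {w\<in>space P. \<forall>s\<in>{0..t}. \<bar>D s w\<bar> \<le> K}"
  assumes A: "\<And>t. t \<in> {0..1} \<Longrightarrow> A t \<in> sets (F t)"
    and D: "\<And>t. t \<in> {0..1} \<Longrightarrow> D t \<in> borel_measurable (F t)"
    and t: "0 < t" "t \<le> 1" and K: "0 \<le> K" and C: "0 \<le> C"
    and lim: "tendsto_prob P (riemann_sum W D t) (D t)"
    and bound: "\<And>s. s \<in> {0..1} \<Longrightarrow> expectation (\<lambda>w. (indicator (A s) w * D s w)\<^sup>2) \<le> C * s ^ k"
  shows "expectation (\<lambda>w. (indicator (A t) w * D t w)\<^sup>2) \<le> (2 * v * C / real (Suc k)) * t ^ Suc k"
proof -
  define e where "e s w = indicator (A s) w * D s w" for s w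
  have eF: "e s \<in> borel_measurable (F s)" if "s \<in> {0..1}" for s
    unfolding e_def[abs_def] using A[OF that] D[OF that] by measurable
  have eP: "e s \<in> borel_measurable P" if "s \<in> {0..1}" for s
    using measurable_F_P[OF eF[OF that]] .
  have e_bound: "\<bar>e s w\<bar> \<le> K" if "s \<in> {0..1}" for s w
    using that K by (auto simp: e_def A_def indicator_def)
  have e2: "integrable P (\<lambda>w. (e s w)\<^sup>2)" if "s \<in> {0..1}" for s
  proof (rule integrable_const_bound[where B = "K\<^sup>2"])
    show "AE w in P. norm ((e s w)\<^sup>2) \<le> K\<^sup>2"
      using e_bound[OF that] K by (auto simp: abs_le_square_iff[symmetric])
    show "(\<lambda>w. (e s w)\<^sup>2) \<in> borel_measurable P" by (rule borel_measurable_power[OF eP[OF that]])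
  qed
  define g where "g m = (\<lambda>j. grid t m j)" for m
  have g01: "g m j \<in> {0..1}" if "j \<le> Suc m" for m j
    using grid_range[OF t(1) that] t(2) by (auto simp: g_def)
  have gs: "g m i < g m j" if "i < j" for m i j
    unfolding g_def using that t(1) by (rule grid_strict[rotated])
  define U where "U m w = (\<Sum>j<Suc m. e (g m j) w * (W (g m (Suc j)) w - W (g m j) w))" for m w
  have U: "integrable P (\<lambda>w. (U m w)\<^sup>2) \<and>
    expectation (\<lambda>w. (U m w)\<^sup>2) = v * (\<Sum>j<Suc m. expectation (\<lambda>w. (e (g m j) w)\<^sup>2) * (g m (Suc j) - g m j))" for m
    unfolding U_def
    by (rule W_isometry[where e = "\<lambda>j. e (g m j)" and s = "g m"])
       (use gs g01 in \<open>auto intro!: eF e2\<close>)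
  have "(\<Sum>j<Suc m. expectation (\<lambda>w. (e (g m j) w)\<^sup>2) * (g m (Suc j) - g m j)) \<le> C * t ^ Suc k / real (Suc k)" for m
  proof -
    have "(\<Sum>j<Suc m. expectation (\<lambda>w. (e (g m j) w)\<^sup>2) * (g m (Suc j) - g m j)) \<le>
      (\<Sum>j<Suc m. C * (((g m (Suc j)) ^ Suc k - (g m j) ^ Suc k) / real (Suc k)))"
    proof (rule sum_mono)
      fix j assume "j \<in> {..<Suc m}"
      then have j: "g m j \<in> {0..1}" "g m j < g m (Suc j)" using g01[of j m] gs by auto
      have "expectation (\<lambda>w. (e (g m j) w)\<^sup>2) * (g m (Suc j) - g m j) \<le> C * (g m j) ^ k * (g m (Suc j) - g m j)"
        using bound[OF j(1)] j(2) unfolding e_def by (intro mult_right_mono) auto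
      also have "\<dots> \<le> C * (((g m (Suc j)) ^ Suc k - (g m j) ^ Suc k) / real (Suc k))"
        unfolding mult.assoc using j C by (intro mult_left_mono power_mult_diff_le) auto
      finally show "expectation (\<lambda>w. (e (g m j) w)\<^sup>2) * (g m (Suc j) - g m j) \<le>
        C * (((g m (Suc j)) ^ Suc k - (g m j) ^ Suc k) / real (Suc k))" .
    qed
    also have "\<dots> = C * ((\<Sum>j<Suc m. (g m (Suc j)) ^ Suc k - (g m j) ^ Suc k) / real (Suc k))"
      by (simp only: sum_distrib_left sum_divide_distrib)
    also have "(\<Sum>j<Suc m. (g m (Suc j)) ^ Suc k - (g m j) ^ Suc k) = t ^ Suc k"
      by (subst sum_lessThan_telescope) (simp add: g_def)
    finally show ?thesis by simp
  qed
  from mult_left_mono[OF this v_nonneg]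
  have EU: "expectation (\<lambda>w. (U m w)\<^sup>2) \<le> v * C * t ^ Suc k / real (Suc k)" for m
    using U[of m] by (simp add: mult.assoc)
  have tt: "t \<in> {0..1}" using t by auto
  define p where "p \<epsilon> m = prob {w\<in>space P. \<bar>riemann_sum W D t m w - D t w\<bar> > \<epsilon>}" for \<epsilon> m
  have main: "expectation (\<lambda>w. (e t w)\<^sup>2) \<le> 2 * (v * C * t ^ Suc k / real (Suc k)) + 2 * \<epsilon>\<^sup>2 + K\<^sup>2 * p \<epsilon> m"
    if \<epsilon>: "\<epsilon> > 0" for \<epsilon> m
  proof -
    define B where "B = {w\<in>space P. \<bar>riemann_sum W D t m w - D t w\<bar> > \<epsilon>}"
    have [measurable]: "riemann_sum W D t m \<in> borel_measurable P"
      by (rule riemann_sum_measurable[OF t]) (use t in \<open>auto intro!: measurable_F_P[OF D]\<close>)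
    have [measurable]: "D t \<in> borel_measurable P" using measurable_F_P[OF D[OF tt]] .
    have [measurable]: "B \<in> events" unfolding B_def by measurable
    \<comment> \<open>Off \<open>B\<close> and on \<open>A t\<close>, the path value differs from
      \<open>U\<close> by at most \<epsilon>, which gives the first two terms and the factor 2. On
      \<open>B\<close> the truncated value is bounded by K, and off \<open>A t\<close> it is
      0.\<close>
    have "expectation (\<lambda>w. (e t w)\<^sup>2) \<le> expectation (\<lambda>w. 2 * (U m w)\<^sup>2 + 2 * \<epsilon>\<^sup>2 + K\<^sup>2 * indicator B w)"
    proof (rule integral_mono)
      show "integrable P (\<lambda>w. (e t w)\<^sup>2)" using e2[OF tt] .
      show "integrable P (\<lambda>w. 2 * (U m w)\<^sup>2 + 2 * \<epsilon>\<^sup>2 + K\<^sup>2 * indicator B w)"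
        using U[of m] integrable_real_indicator[OF \<open>B \<in> events\<close>]
        by (intro Bochner_Integration.integrable_add integrable_mult_right) (auto simp: less_top[symmetric])
      fix w assume w: "w \<in> space P"
      show "(e t w)\<^sup>2 \<le> 2 * (U m w)\<^sup>2 + 2 * \<epsilon>\<^sup>2 + K\<^sup>2 * indicator B w"
      proof (cases "w \<in> B \<or> w \<notin> A t")
        case True
        then have "(e t w)\<^sup>2 \<le> K\<^sup>2 * indicator B w"
          using e_bound[OF tt, of w] K by (auto simp: abs_le_square_iff[symmetric] e_def)
        then show ?thesis using zero_le_power2[of "U m w"] zero_le_power2[of \<epsilon>] by linarith
      next
        case False
        \<comment> \<open>\<open>A t\<close> is contained in every earlier \<open>A s\<close>, so no
          truncation is active at any grid point.\<close>
        have "e (g m j) w = D (g m j) w" if "j < Suc m" for j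
          using False grid_range[OF t(1), of j m] that by (auto simp: e_def A_def g_def indicator_def)
        then have "U m w = riemann_sum W D t m w"
          unfolding U_def riemann_sum_def by (intro sum.cong) (auto simp: g_def)
        then have "\<bar>U m w - D t w\<bar> \<le> \<epsilon>" using False w by (auto simp: B_def)
        then have "\<bar>D t w - U m w\<bar>\<^sup>2 \<le> \<epsilon>\<^sup>2" by (intro power_mono) auto
        moreover have "(D t w)\<^sup>2 \<le> 2 * (U m w)\<^sup>2 + 2 * (D t w - U m w)\<^sup>2"
          using zero_le_power2[of "D t w - 2 * U m w"] by (simp add: power2_eq_square algebra_simps)
        moreover have "e t w = D t w" using False by (simp add: e_def)
        ultimately show ?thesis using False by simp
      qed
    qed
    also have "\<dots> = 2 * expectation (\<lambda>w. (U m w)\<^sup>2) + 2 * \<epsilon>\<^sup>2 + K\<^sup>2 * p \<epsilon> m"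
    proof -
      have "integrable P (\<lambda>w. K\<^sup>2 * indicator B w :: real)" "integrable P (\<lambda>w. 2 * (U m w)\<^sup>2)"
        using U[of m] integrable_real_indicator[OF \<open>B \<in> events\<close>] by (auto simp: less_top[symmetric])
      then show ?thesis unfolding p_def B_def[symmetric] by (simp add: prob_space)
    qed
    finally show ?thesis using EU[of m] by linarith
  qed
  have "expectation (\<lambda>w. (e t w)\<^sup>2) \<le> 2 * (v * C * t ^ Suc k / real (Suc k)) + 2 * \<epsilon>\<^sup>2" if \<epsilon>: "\<epsilon> > 0" for \<epsilon>
  proof -
    have "p \<epsilon> \<longlonglongrightarrow> 0" using lim \<epsilon> unfolding tendsto_prob_def p_def[abs_def] by auto
    then have "(\<lambda>m. 2 * (v * C * t ^ Suc k / real (Suc k)) + 2 * \<epsilon>\<^sup>2 + K\<^sup>2 * p \<epsilon> m) \<longlonglongrightarrow>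
      2 * (v * C * t ^ Suc k / real (Suc k)) + 2 * \<epsilon>\<^sup>2 + K\<^sup>2 * 0"
      by (intro tendsto_intros)
    then have "expectation (\<lambda>w. (e t w)\<^sup>2) \<le> 2 * (v * C * t ^ Suc k / real (Suc k)) + 2 * \<epsilon>\<^sup>2 + K\<^sup>2 * 0"
      by (rule LIMSEQ_le_const) (use main[OF \<epsilon>] in blast)
    then show ?thesis by simp
  qed
  note less = this
  have "expectation (\<lambda>w. (e t w)\<^sup>2) \<le> 2 * (v * C * t ^ Suc k / real (Suc k))"
  proof (rule field_le_epsilon)
    fix \<eta> :: real assume "\<eta> > 0"
    then show "expectation (\<lambda>w. (e t w)\<^sup>2) \<le> 2 * (v * C * t ^ Suc k / real (Suc k)) + \<eta>"
      using less[of "sqrt (\<eta> / 2)"] by simp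
  qed
  then show ?thesis unfolding e_def by (simp add: mult_ac)
qed

text \<open>Continuity reduces the condition to countably many rational times, which places the
  event in \<open>F t\<close> itself. Its indicator can then multiply an integrand at time t, which
  replaces a stopping time.\<close>

lemma bounded_path_event:
  fixes D :: "real \<Rightarrow> 'a \<Rightarrow> real" and K :: real
  assumes D: "\<And>t. t \<in> {0..1} \<Longrightarrow> D t \<in> borel_measurable (F t)"
    and cont: "\<And>w. w \<in> space P \<Longrightarrow> continuous_on {0..1} (\<lambda>t. D t w)"
    and t: "t \<in> {0..1}"
  shows "{w\<in>space P. \<forall>s\<in>{0..t}. \<bar>D s w\<bar> \<le> K} \<in> sets (F t)"
proof -
  let ?Q = "\<rat> \<inter> {0..t}"
  have eq: "{w\<in>space P. \<forall>s\<in>{0..t}. \<bar>D s w\<bar> \<le> K} = {w\<in>space P. \<forall>s\<in>?Q. \<bar>D s w\<bar> \<le> K}"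
  proof safe
    fix w s assume w: "w \<in> space P" and le: "\<forall>s\<in>?Q. \<bar>D s w\<bar> \<le> K" and s: "s \<in> {0..t}"
    show "\<bar>D s w\<bar> \<le> K"
    proof (rule ccontr)
      assume "\<not> \<bar>D s w\<bar> \<le> K"
      then have gt: "0 < \<bar>D s w\<bar> - K" by simp
      \<comment> \<open>Time 0 is rational, so only positive times remain; these are approached by
        rationals from the left, which stay inside [0, t].\<close>
      have "0 < s" using s le \<open>\<not> \<bar>D s w\<bar> \<le> K\<close> by (cases "s = 0") auto
      have s01: "s \<in> {0..1}" using s t by auto
      from cont[OF w, unfolded continuous_on_iff, rule_format, OF s01 gt] obtain d where d: "d > 0"
        "\<And>u. u \<in> {0..1} \<Longrightarrow> dist u s < d \<Longrightarrow> dist (D u w) (D s w) < \<bar>D s w\<bar> - K"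
        by blast
      obtain q where q: "q \<in> \<rat>" "max 0 (s - d) < q" "q < s"
        using Rats_dense_in_real[of "max 0 (s - d)" s] \<open>0 < s\<close> d(1) by auto
      then have "dist (D q w) (D s w) < \<bar>D s w\<bar> - K" using s t by (intro d(2)) (auto simp: dist_real_def)
      moreover have "\<bar>D q w\<bar> \<le> K" using le q s by auto
      ultimately show False by (simp add: dist_real_def)
    qed
  qed auto
  have "{w\<in>space (F t). \<forall>s\<in>?Q. \<bar>D s w\<bar> \<le> K} \<in> sets (F t)"
  proof (rule sets.sets_Collect_countable_All')
    show "countable ?Q" by (intro countable_Int1 countable_rat)
    fix s assume "s \<in> ?Q"
    then have "D s \<in> borel_measurable (F t)"
      using t by (intro measurable_F_mono[OF _ D[of s]]) auto
    then show "{w\<in>space (F t). \<bar>D s w\<bar> \<le> K} \<in> sets (F t)" by measurable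
  qed
  then show ?thesis unfolding eq space_F .
qed

text \<open>Starting from the trivial bound K^2, each use of
  \<open>truncated_second_moment_le\<close> contributes a factor 2 v and one more factor of a
  factorial. The resulting bound K^2 (2 v)^k / k! holds for all k and tends to 0, so the truncated
  moment vanishes. Every path is bounded, hence covered by some integer level K.\<close>

lemma linear_sde_unique:
  fixes D :: "real \<Rightarrow> 'a \<Rightarrow> real"
  assumes D: "\<And>t. t \<in> {0..1} \<Longrightarrow> D t \<in> borel_measurable (F t)"
    and cont: "\<And>w. w \<in> space P \<Longrightarrow> continuous_on {0..1} (\<lambda>t. D t w)"
    and D0: "AE w in P. D 0 w = 0"
    and lim: "\<And>t. 0 < t \<Longrightarrow> t \<le> 1 \<Longrightarrow> tendsto_prob P (riemann_sum W D t) (D t)"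
    and t: "t \<in> {0..1}"
  shows "AE w in P. D t w = 0"
proof -
  define A where "A K t = {w\<in>space P. \<forall>s\<in>{0..t}. \<bar>D s w\<bar> \<le> K}" for K t :: real
  have A: "A K t \<in> sets (F t)" if "t \<in> {0..1}" for K t
    unfolding A_def by (rule bounded_path_event[OF D cont that])
  define f where "f K t = expectation (\<lambda>w. (indicator (A K t) w * D t w)\<^sup>2)" for K t
  have m: "(\<lambda>w. indicator (A K s) w * D s w) \<in> borel_measurable P" if "s \<in> {0..1}" for K s
    by (rule measurable_F_P[OF borel_measurable_times[OF borel_measurable_indicator[OF A[OF that]] D[OF that]]])
  have int: "integrable P (\<lambda>w. (indicator (A K s) w * D s w)\<^sup>2)" if s: "s \<in> {0..1}" for K s
  proof (rule integrable_const_bound[where B = "K\<^sup>2"])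
    have "\<bar>indicator (A K s) w * D s w\<bar> \<le> \<bar>K\<bar>" for w
      using s by (auto simp: A_def indicator_def intro: order_trans[OF _ abs_ge_self])
    then show "AE w in P. norm ((indicator (A K s) w * D s w)\<^sup>2) \<le> K\<^sup>2"
      by (auto simp: abs_le_square_iff[symmetric])
    show "(\<lambda>w. (indicator (A K s) w * D s w)\<^sup>2) \<in> borel_measurable P" by (rule borel_measurable_power[OF m[OF s]])
  qed
  have f_le: "f K s \<le> K\<^sup>2 * (2 * v) ^ k / fact k * s ^ k" if K: "0 \<le> K" and s: "s \<in> {0..1}" for K k s
    using s
  proof (induction k arbitrary: s)
    case 0
    have "f K s \<le> expectation (\<lambda>w. K\<^sup>2)"
      unfolding f_def
    proof (rule integral_mono[OF int[OF 0]])
      fix w assume "w \<in> space P"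
      have "\<bar>indicator (A K s) w * D s w\<bar> \<le> \<bar>K\<bar>"
        using 0 K by (auto simp: A_def indicator_def)
      then show "(indicator (A K s) w * D s w)\<^sup>2 \<le> K\<^sup>2" by (simp add: abs_le_square_iff)
    qed simp
    then show ?case by (simp add: prob_space)
  next
    case (Suc k)
    show ?case
    proof (cases "s = 0")
      \<comment> \<open>The limit relation is available at positive times only; at time 0 the
        initial condition takes its place.\<close>
      case True
      have "f K s = expectation (\<lambda>w. 0)"
        unfolding f_def
      proof (rule integral_cong_AE)
        show "AE w in P. (indicator (A K s) w * D s w)\<^sup>2 = 0"
          using D0 True by (auto elim: eventually_mono)
        show "(\<lambda>w. (indicator (A K s) w * D s w)\<^sup>2) \<in> borel_measurable P"
          by (rule borel_measurable_power[OF m[OF Suc.prems]])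
      qed simp
      then show ?thesis using True by simp
    next
      case False
      then have s: "0 < s" "s \<le> 1" using Suc.prems by auto
      have "f K s \<le> (2 * v * (K\<^sup>2 * (2 * v) ^ k / fact k) / real (Suc k)) * s ^ Suc k"
        unfolding f_def A_def
        by (rule truncated_second_moment_le[OF _ D s K _ lim[OF s]])
           (use A Suc.IH v_nonneg in \<open>auto simp: f_def A_def\<close>)
      also have "2 * v * (K\<^sup>2 * (2 * v) ^ k / fact k) / real (Suc k) = K\<^sup>2 * (2 * v) ^ Suc k / fact (Suc k)"
        by (simp add: mult_ac)
      finally show ?thesis .
    qed
  qed
  have f0: "f K t = 0" if K: "0 \<le> K" for K
  proof (rule antisym)
    have "(\<lambda>k. inverse (fact k) * (2 * v) ^ k) \<longlonglongrightarrow> 0"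
      by (rule summable_LIMSEQ_zero[OF summable_exp])
    then have "(\<lambda>k. K\<^sup>2 * (inverse (fact k) * (2 * v) ^ k)) \<longlonglongrightarrow> 0"
      by (rule tendsto_mult_right_zero)
    moreover have "f K t \<le> K\<^sup>2 * (inverse (fact k) * (2 * v) ^ k)" for k
    proof -
      have "f K t \<le> K\<^sup>2 * (2 * v) ^ k / fact k * t ^ k" by (rule f_le[OF K t])
      also have "\<dots> \<le> K\<^sup>2 * (2 * v) ^ k / fact k"
        using t v_nonneg by (intro mult_left_le) (auto intro!: power_le_one)
      finally show ?thesis by (simp add: divide_inverse mult_ac)
    qed
    ultimately show "f K t \<le> 0" by (intro LIMSEQ_le_const) auto
    show "0 \<le> f K t" unfolding f_def by (intro integral_nonneg_AE) auto
  qed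
  have "AE w in P. \<forall>n::nat. (indicator (A (real n) t) w * D t w)\<^sup>2 = 0"
    unfolding AE_all_countable
  proof
    fix n :: nat
    show "AE w in P. (indicator (A (real n) t) w * D t w)\<^sup>2 = 0"
      using f0[of "real n"] integral_nonneg_eq_0_iff_AE[OF int[OF t, of "real n"]] unfolding f_def by auto
  qed
  then show ?thesis
  proof (rule AE_mp, intro AE_I2 impI)
    fix w assume w: "w \<in> space P" and z: "\<forall>n::nat. (indicator (A (real n) t) w * D t w)\<^sup>2 = 0"
    obtain K where K: "\<And>s. s \<in> {0..1} \<Longrightarrow> \<bar>D s w\<bar> \<le> K"
      using continuous_on_Icc_bounded[OF cont[OF w]] by blast
    obtain n :: nat where "K \<le> real n" using real_arch_simple by blast
    then have "w \<in> A (real n) t" using w t K by (force simp: A_def)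
    with z[rule_format, of n] show "D t w = 0" by simp
  qed
qed

end

section \<open>Geometric Brownian motion\<close>

lemma normal_density_exp_tilt:
  assumes "q > 0"
  shows "normal_density 0 (sqrt q) x * exp (c * x) = exp (c\<^sup>2 * q / 2) * normal_density (c * q) (sqrt q) x"
proof -
  have "- x\<^sup>2 / (2 * q) + c * x = c\<^sup>2 * q / 2 + - (x - c * q)\<^sup>2 / (2 * q)"
    using assms by (simp add: field_simps power2_eq_square)
  then show ?thesis
    using assms by (simp add: normal_density_def exp_add[symmetric])
qed

context prob_space
begin

text \<open>Completing the square turns the weight exp(c x) into a shift of the mean by c q, up to
  the constant exp(c^2 q / 2). The moments are then the mass and the mean of a shifted
  Gaussian.\<close>

lemma normal_exp_moments:
  assumes X: "distributed M lborel X (normal_density 0 (sqrt q))" and q: "q > 0"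
  shows "integrable M (\<lambda>w. exp (c * X w))" "expectation (\<lambda>w. exp (c * X w)) = exp (c\<^sup>2 * q / 2)"
    "integrable M (\<lambda>w. X w * exp (c * X w))"
    "expectation (\<lambda>w. X w * exp (c * X w)) = c * q * exp (c\<^sup>2 * q / 2)"
proof -
  have sq: "0 < sqrt q" using q by simp
  have eq: "normal_density 0 (sqrt q) x * exp (c * x) = exp (c\<^sup>2 * q / 2) * normal_density (c * q) (sqrt q) x"
    "normal_density 0 (sqrt q) x * (x * exp (c * x)) = exp (c\<^sup>2 * q / 2) * (normal_density (c * q) (sqrt q) x * x)" for x
    using normal_density_exp_tilt[OF q, of x c] by (auto simp: mult_ac)
  have "integrable lborel (\<lambda>x. exp (c\<^sup>2 * q / 2) * normal_density (c * q) (sqrt q) x)"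
    using sq by (intro integrable_mult_right integrable_normal_density)
  then show "integrable M (\<lambda>w. exp (c * X w))"
    using distributed_integrable[OF X, of "\<lambda>x. exp (c * x)"] by (simp add: eq)
  show "expectation (\<lambda>w. exp (c * X w)) = exp (c\<^sup>2 * q / 2)"
    using distributed_integral[OF X, of "\<lambda>x. exp (c * x)", symmetric] sq by (simp add: eq)
  have "integrable lborel (\<lambda>x. exp (c\<^sup>2 * q / 2) * (normal_density (c * q) (sqrt q) x * x))"
    using sq by (intro integrable_mult_right integrable_normal_moment_nz_1)
  then show "integrable M (\<lambda>w. X w * exp (c * X w))"
    using distributed_integrable[OF X, of "\<lambda>x. x * exp (c * x)"] by (simp add: eq)
  show "expectation (\<lambda>w. X w * exp (c * X w)) = c * q * exp (c\<^sup>2 * q / 2)"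
    using distributed_integral[OF X, of "\<lambda>x. x * exp (c * x)", symmetric] integral_normal_moment_nz_1[OF sq, of "c * q"]
    by (simp add: eq)
qed

end

text \<open>A zero row of \<Gamma> gives v = 0, where the increments are constant and no Gaussian
  density describes them; this case is therefore kept apart from \<open>W_normal\<close>.\<close>

locale scaled_brownian = orthogonal_increments P F W v
  for P :: "'a measure" and F W v +
  assumes W_normal: "\<And>s t. 0 \<le> s \<Longrightarrow> s < t \<Longrightarrow> t \<le> 1 \<Longrightarrow> v > 0 \<Longrightarrow>
      distributed P lborel (\<lambda>w. W t w - W s w) (normal_density 0 (sqrt (v * (t - s))))"
    and W_degenerate: "v = 0 \<Longrightarrow> W t w = 0"
    and W_0: "AE w in P. W 0 w = 0"
    and W_continuous: "\<And>w. w \<in> space P \<Longrightarrow> continuous_on {0..1} (\<lambda>t. W t w)"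
begin

definition stoch_exp :: "real \<Rightarrow> 'a \<Rightarrow> real" where
  "stoch_exp t w = exp (W t w - v * t / 2)"

lemma stoch_exp_adapted: "t \<in> {0..1} \<Longrightarrow> stoch_exp t \<in> borel_measurable (F t)"
  unfolding stoch_exp_def[abs_def] using W_adapted[of t] by measurable

lemma stoch_exp_second_moment:
  assumes t: "t \<in> {0..1}"
  shows "integrable P (\<lambda>w. (stoch_exp t w)\<^sup>2)" "expectation (\<lambda>w. (stoch_exp t w)\<^sup>2) = exp (v * t)"
proof -
  note Wm[measurable] = W_measurable[OF t] W_measurable[of 0, simplified]
  have Ym[measurable]: "stoch_exp t \<in> borel_measurable P" using measurable_F_P[OF stoch_exp_adapted[OF t]] .
  have eq: "AE w in P. (stoch_exp t w)\<^sup>2 = exp (- (v * t)) * exp (2 * (W t w - W 0 w))"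
    using W_0
  proof eventually_elim
    case (elim w)
    have "(stoch_exp t w)\<^sup>2 = exp (- (v * t) + 2 * (W t w - W 0 w))"
      by (simp add: stoch_exp_def elim power2_eq_square exp_add[symmetric])
    then show ?case by (simp only: exp_add)
  qed
  have *: "integrable P (\<lambda>w. exp (2 * (W t w - W 0 w))) \<and>
    expectation (\<lambda>w. exp (2 * (W t w - W 0 w))) = exp (2 * (v * t))"
  proof (cases "v = 0 \<or> t = 0")
    case True
    then have "W t w - W 0 w = 0" "v * t = 0" for w using W_degenerate by auto
    then show ?thesis by (simp add: prob_space)
  next
    case False
    with t v_nonneg have "0 < t" "0 < v" "t \<le> 1" by auto
    note n = normal_exp_moments[OF W_normal[OF order_refl this(1,3,2)], of 2]
    have "0 < v * (t - 0)" using \<open>0 < t\<close> \<open>0 < v\<close> by simp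
    from n(1,2)[OF this] show ?thesis by simp
  qed
  show "integrable P (\<lambda>w. (stoch_exp t w)\<^sup>2)"
    using * by (subst integrable_cong_AE[OF _ _ eq]) auto
  have "expectation (\<lambda>w. (stoch_exp t w)\<^sup>2) = expectation (\<lambda>w. exp (- (v * t)) * exp (2 * (W t w - W 0 w)))"
    by (rule integral_cong_AE[OF _ _ eq]) auto
  also have "\<dots> = exp (- (v * t)) * exp (2 * (v * t))"
    using * by simp
  also have "\<dots> = exp (v * t)" by (simp add: exp_add[symmetric])
  finally show "expectation (\<lambda>w. (stoch_exp t w)\<^sup>2) = exp (v * t)" .
qed

text \<open>The relative error of one Euler step for the stochastic exponential. It depends on the
  increment of \<open>W\<close> alone and is thus independent of the past.\<close>

definition exp_remainder :: "real \<Rightarrow> real \<Rightarrow> 'a \<Rightarrow> real" where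
  "exp_remainder s t w = exp (W t w - W s w - v * (t - s) / 2) - 1 - (W t w - W s w)"

lemma stoch_exp_increment: "stoch_exp t w - stoch_exp s w - stoch_exp s w * (W t w - W s w) = stoch_exp s w * exp_remainder s t w"
proof -
  have "stoch_exp t w = stoch_exp s w * exp (W t w - W s w - v * (t - s) / 2)"
    unfolding stoch_exp_def exp_add[symmetric] by (simp add: field_simps)
  then show ?thesis unfolding exp_remainder_def by (simp add: algebra_simps)
qed

text \<open>Put q = v (t - s), let X be the increment and Y = exp(X - q/2). Then E Y = 1, E Y^2 =
  exp q, E X Y = q and E X^2 = q; expanding the square of Y - 1 - X gives the value. It is of second
  order in q, and the correction -q/2 in the exponent is what makes the mean vanish.\<close>

lemma exp_remainder_moments:
  assumes st: "0 \<le> s" "s < t" "t \<le> 1"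
  shows "integrable P (\<lambda>w. (exp_remainder s t w)\<^sup>2)" "expectation (exp_remainder s t) = 0"
    "expectation (\<lambda>w. (exp_remainder s t w)\<^sup>2) = exp (v * (t - s)) - 1 - v * (t - s)"
proof -
  have "integrable P (\<lambda>w. (exp_remainder s t w)\<^sup>2) \<and> expectation (exp_remainder s t) = 0 \<and>
    expectation (\<lambda>w. (exp_remainder s t w)\<^sup>2) = exp (v * (t - s)) - 1 - v * (t - s)"
  proof (cases "v = 0")
    case True
    have "exp_remainder s t w = 0" for w unfolding exp_remainder_def by (simp add: W_degenerate[OF True] True)
    then have "exp_remainder s t = (\<lambda>_. 0)" by (rule ext)
    then show ?thesis by (simp add: True)
  next
    case False
    then have v: "v > 0" using v_nonneg by simp
    define q where "q = v * (t - s)"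
    have q: "q > 0" using v st by (simp add: q_def)
    define X where "X w = W t w - W s w" for w
    have X: "distributed P lborel X (normal_density 0 (sqrt q))"
      unfolding X_def[abs_def] q_def by (rule W_normal[OF st v])
    have X2: "integrable P (\<lambda>w. (X w)\<^sup>2)" "expectation (\<lambda>w. (X w)\<^sup>2) = q" "expectation X = 0"
      unfolding X_def[abs_def] q_def using W_integrable[OF st] W_variance[OF st] W_mean[OF st] by auto
    have Xm: "X \<in> borel_measurable P"
      using distributed_measurable[OF X] by simp
    have X1: "integrable P X"
      using integrable_mult_L2[OF Xm borel_measurable_const[of 1] X2(1)] by simp
    note m1 = normal_exp_moments[OF X q, of 1, simplified] and m2 = normal_exp_moments[OF X q, of 2, simplified]
    have ea: "exp (a - q / 2) = exp (- q / 2) * exp a" for a :: real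
      by (simp add: exp_add[symmetric])
    have exp_remainder: "exp_remainder s t w = exp (- q / 2) * exp (X w) - 1 - X w" for w
      unfolding exp_remainder_def X_def ea[symmetric] by (simp add: q_def)
    have E1: "expectation (exp_remainder s t) = 0"
    proof -
      have "expectation (exp_remainder s t) = exp (- q / 2) * expectation (\<lambda>w. exp (X w)) - 1 - expectation X"
        unfolding exp_remainder[abs_def] using m1(1) X1 by (simp add: prob_space)
      then show ?thesis using m1(2) X2(3) by (simp add: exp_add[symmetric])
    qed
    have sq: "(exp_remainder s t w)\<^sup>2 = exp (- q) * exp (2 * X w) + 1 + (X w)\<^sup>2 - 2 * exp (- q / 2) * exp (X w)
        - 2 * exp (- q / 2) * (X w * exp (X w)) + 2 * X w" for w
    proof -
      have "(exp (- q / 2) * exp (X w))\<^sup>2 = exp (- q) * exp (2 * X w)"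
        by (simp add: power2_eq_square exp_add[symmetric])
      moreover have "(a - 1 - b)\<^sup>2 = a\<^sup>2 + 1 + b\<^sup>2 - 2 * a - 2 * (b * a) + 2 * b" for a b :: real
        by (simp add: power2_eq_square algebra_simps)
      ultimately show ?thesis unfolding exp_remainder by (simp add: mult_ac)
    qed
    have I2: "integrable P (\<lambda>w. (exp_remainder s t w)\<^sup>2)"
      unfolding sq using m1(1,3) m2(1) X1 X2(1) by auto
    have "expectation (\<lambda>w. (exp_remainder s t w)\<^sup>2) = exp (- q) * exp (2 * q) + 1 + q - 2 * exp (- q / 2) * exp (q / 2)
        - 2 * exp (- q / 2) * (q * exp (q / 2)) + 2 * 0"
      unfolding sq using m1 m2 X1 X2 by (simp add: prob_space)
    also have "\<dots> = exp q - 1 - q"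
      by (simp add: exp_add[symmetric] mult.assoc)
    finally show ?thesis using I2 E1 by (simp add: q_def)
  qed
  then show "integrable P (\<lambda>w. (exp_remainder s t w)\<^sup>2)" "expectation (exp_remainder s t) = 0"
    "expectation (\<lambda>w. (exp_remainder s t w)\<^sup>2) = exp (v * (t - s)) - 1 - v * (t - s)" by auto
qed

text \<open>This takes the place of Ito's formula. The Euler errors are orthogonal, so their second
  moments add up: m + 1 terms of order the squared mesh, hence a total of the order of the
  mesh.\<close>

lemma stoch_exp_riemann_sum:
  assumes t: "0 < t" "t \<le> 1"
  shows "tendsto_prob P (riemann_sum W stoch_exp t) (\<lambda>w. stoch_exp t w - stoch_exp 0 w)"
proof -
  define g where "g m j = grid t m j" for m j
  have g01: "g m j \<in> {0..1}" if "j \<le> Suc m" for m j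
    using grid_range[OF t(1) that] t(2) by (auto simp: g_def)
  have gs: "g m j < g m (Suc j)" for m j
    unfolding g_def using t(1) by (rule grid_strict) simp
  have gst: "0 \<le> g m j" "g m (Suc j) \<le> 1" if "j < Suc m" for m j
    using g01[of j m] g01[of "Suc j" m] that by auto
  have diff: "riemann_sum W stoch_exp t m w - (stoch_exp t w - stoch_exp 0 w) = - (\<Sum>j<Suc m. stoch_exp (g m j) w * exp_remainder (g m j) (g m (Suc j)) w)" for m w
  proof -
    have "(\<Sum>j<Suc m. stoch_exp (g m (Suc j)) w - stoch_exp (g m j) w) = stoch_exp t w - stoch_exp 0 w"
      by (subst sum_lessThan_telescope) (simp add: g_def)
    then show ?thesis
      unfolding riemann_sum_def stoch_exp_increment[symmetric] sum_subtractf by (simp add: g_def)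
  qed
  have E: "integrable P (\<lambda>w. (\<Sum>j<Suc m. stoch_exp (g m j) w * exp_remainder (g m j) (g m (Suc j)) w)\<^sup>2) \<and>
    expectation (\<lambda>w. (\<Sum>j<Suc m. stoch_exp (g m j) w * exp_remainder (g m j) (g m (Suc j)) w)\<^sup>2) =
      (\<Sum>j<Suc m. expectation (\<lambda>w. (stoch_exp (g m j) w)\<^sup>2) * expectation (\<lambda>w. (exp_remainder (g m j) (g m (Suc j)) w)\<^sup>2)) \<and>
    (\<lambda>w. \<Sum>j<Suc m. stoch_exp (g m j) w * exp_remainder (g m j) (g m (Suc j)) w) \<in> borel_measurable (F (g m (Suc m)))" for m
  proof (rule expectation_orthogonal_sum)
    fix j assume j: "j < Suc m"
    have g: "g m j \<in> {0..1}" "g m (Suc j) \<in> {0..1}" using g01[of j m] g01[of "Suc j" m] j by auto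
    show "g m j \<le> g m (Suc j)" using gs[of m j] by simp
    show "stoch_exp (g m j) \<in> borel_measurable (F (g m j))" by (rule stoch_exp_adapted[OF g(1)])
    have [measurable]: "W (g m (Suc j)) \<in> borel_measurable (F (g m (Suc j)))" by (rule W_adapted[OF g(2)])
    have [measurable]: "W (g m j) \<in> borel_measurable (F (g m (Suc j)))"
      using gs[of m j] by (intro measurable_F_mono[OF _ W_adapted[OF g(1)]]) simp
    show "exp_remainder (g m j) (g m (Suc j)) \<in> borel_measurable (F (g m (Suc j)))"
      unfolding exp_remainder_def[abs_def] by measurable
    show "integrable P (\<lambda>w. (stoch_exp (g m j) w)\<^sup>2)" by (rule stoch_exp_second_moment[OF g(1)])
    show "integrable P (\<lambda>w. (exp_remainder (g m j) (g m (Suc j)) w)\<^sup>2)" "expectation (exp_remainder (g m j) (g m (Suc j))) = 0"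
      using exp_remainder_moments[OF gst(1)[OF j] gs gst(2)[OF j]] by auto
    fix X :: "'a \<Rightarrow> real" assume X: "X \<in> borel_measurable (F (g m j))"
    have "indep_var borel X borel (\<lambda>w. W (g m (Suc j)) w - W (g m j) w)"
      by (rule W_indep[OF gst(1)[OF j] gs gst(2)[OF j] X])
    from indep_var_compose[OF this, of "\<lambda>x. x" borel "\<lambda>x. exp (x - v * (g m (Suc j) - g m j) / 2) - 1 - x" borel]
    show "indep_var borel X borel (exp_remainder (g m j) (g m (Suc j)))"
      by (simp add: comp_def exp_remainder_def[abs_def])
  qed
  define h where "h m = t / real (Suc m)" for m
  have h_lim: "h \<longlonglongrightarrow> 0"
    unfolding h_def[abs_def] by (rule LIMSEQ_Suc[OF lim_const_over_n])
  have h0: "0 \<le> h m" for m using t by (simp add: h_def)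
  have "(\<lambda>m. expectation (\<lambda>w. (riemann_sum W stoch_exp t m w - (stoch_exp t w - stoch_exp 0 w))\<^sup>2)) \<longlonglongrightarrow> 0"
  proof (rule Lim_null_comparison)
    have "(\<lambda>m. exp v * t * v\<^sup>2 * h m) \<longlonglongrightarrow> exp v * t * v\<^sup>2 * 0"
      by (intro tendsto_intros h_lim)
    then show "(\<lambda>m. exp v * t * v\<^sup>2 * h m) \<longlonglongrightarrow> 0" by simp
    \<comment> \<open>\<open>exp_bound\<close> gives exp q at most 1 + q + q^2 only for q in [0, 1],
      so the mesh has to be small first.\<close>
    have "(\<lambda>m. v * h m) \<longlonglongrightarrow> v * 0" by (intro tendsto_intros h_lim)
    then have "eventually (\<lambda>m. v * h m < 1) sequentially"
      by (intro order_tendstoD(2)) auto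
    then show "eventually (\<lambda>m. norm (expectation (\<lambda>w. (riemann_sum W stoch_exp t m w - (stoch_exp t w - stoch_exp 0 w))\<^sup>2)) \<le> exp v * t * v\<^sup>2 * h m) sequentially"
    proof eventually_elim
      case (elim m)
      have "expectation (\<lambda>w. (riemann_sum W stoch_exp t m w - (stoch_exp t w - stoch_exp 0 w))\<^sup>2) =
        (\<Sum>j<Suc m. expectation (\<lambda>w. (stoch_exp (g m j) w)\<^sup>2) * expectation (\<lambda>w. (exp_remainder (g m j) (g m (Suc j)) w)\<^sup>2))"
        unfolding diff power2_minus using E[of m] by blast
      also have "\<dots> \<le> (\<Sum>j<Suc m. exp v * (v * h m)\<^sup>2)"
      proof (rule sum_mono, rule mult_mono)
        fix j assume "j \<in> {..<Suc m}"
        then have j: "j < Suc m" by simp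
        have g: "g m j \<in> {0..1}" using g01[of j m] j by auto
        show "expectation (\<lambda>w. (stoch_exp (g m j) w)\<^sup>2) \<le> exp v"
          unfolding stoch_exp_second_moment(2)[OF g] using g v_nonneg by (auto intro!: mult_left_le)
        have gh: "g m (Suc j) - g m j = h m" unfolding g_def h_def by (rule grid_step)
        have "exp (v * h m) \<le> 1 + v * h m + (v * h m)\<^sup>2"
          using elim v_nonneg h0[of m] by (intro exp_bound) auto
        then show "expectation (\<lambda>w. (exp_remainder (g m j) (g m (Suc j)) w)\<^sup>2) \<le> (v * h m)\<^sup>2"
          unfolding exp_remainder_moments(3)[OF gst(1)[OF j] gs gst(2)[OF j]] gh by simp
      qed (auto intro!: integral_nonneg_AE)
      also have "\<dots> = exp v * v\<^sup>2 * (real (Suc m) * h m) * h m"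
        by (simp add: power2_eq_square mult_ac)
      also have "real (Suc m) * h m = t" by (simp add: h_def)
      finally have "expectation (\<lambda>w. (riemann_sum W stoch_exp t m w - (stoch_exp t w - stoch_exp 0 w))\<^sup>2) \<le> exp v * t * v\<^sup>2 * h m"
        by (simp add: mult_ac)
      moreover have "0 \<le> expectation (\<lambda>w. (riemann_sum W stoch_exp t m w - (stoch_exp t w - stoch_exp 0 w))\<^sup>2)"
        by (intro integral_nonneg_AE) auto
      ultimately show ?case by simp
    qed
  qed
  moreover have Ym: "stoch_exp s \<in> borel_measurable P" if "s \<in> {0..1}" for s
    using measurable_F_P[OF stoch_exp_adapted[OF that]] .
  moreover have "integrable P (\<lambda>w. (riemann_sum W stoch_exp t m w - (stoch_exp t w - stoch_exp 0 w))\<^sup>2)" for m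
    unfolding diff power2_minus using E[of m] by blast
  moreover have "riemann_sum W stoch_exp t m \<in> borel_measurable P" for m
    using t by (intro riemann_sum_measurable Ym) auto
  moreover have "(\<lambda>w. stoch_exp t w - stoch_exp 0 w) \<in> borel_measurable P"
    using t by (intro borel_measurable_diff Ym) auto
  ultimately show ?thesis by (intro tendsto_prob_L2)
qed

text \<open>By linearity, the difference of \<open>X\<close> and x times the stochastic exponential
  satisfies the same limit relation with initial value 0, and uniqueness applies.\<close>

lemma linear_sde_solution:
  fixes X :: "real \<Rightarrow> 'a \<Rightarrow> real"
  assumes X: "\<And>t. t \<in> {0..1} \<Longrightarrow> X t \<in> borel_measurable (F t)"
    and cont: "\<And>w. w \<in> space P \<Longrightarrow> continuous_on {0..1} (\<lambda>t. X t w)"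
    and X0: "AE w in P. X 0 w = x"
    and lim: "\<And>t. 0 < t \<Longrightarrow> t \<le> 1 \<Longrightarrow> tendsto_prob P (riemann_sum W X t) (\<lambda>w. X t w - X 0 w)"
    and t: "t \<in> {0..1}"
  shows "AE w in P. X t w = x * exp (W t w - v * t / 2)"
proof -
  define D where "D t w = X t w - x * stoch_exp t w" for t w
  have Y0: "AE w in P. stoch_exp 0 w = 1" using W_0 by eventually_elim (simp add: stoch_exp_def)
  have Xm: "X s \<in> borel_measurable P" if "s \<in> {0..1}" for s using measurable_F_P[OF X[OF that]] .
  have Ym: "stoch_exp s \<in> borel_measurable P" if "s \<in> {0..1}" for s using measurable_F_P[OF stoch_exp_adapted[OF that]] .
  have "AE w in P. D t w = 0"
  proof (rule linear_sde_unique[OF _ _ _ _ t])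
    show "D t \<in> borel_measurable (F t)" if "t \<in> {0..1}" for t
      unfolding D_def[abs_def] using X[OF that] stoch_exp_adapted[OF that] by measurable
    show "continuous_on {0..1} (\<lambda>t. D t w)" if "w \<in> space P" for w
      unfolding D_def stoch_exp_def by (intro continuous_intros cont W_continuous that) simp
    show "AE w in P. D 0 w = 0"
      using X0 Y0 by eventually_elim (simp add: D_def)
    fix t :: real assume t: "0 < t" "t \<le> 1"
    have eq: "riemann_sum W D t m w = riemann_sum W X t m w + (- x) * riemann_sum W stoch_exp t m w" for m w
      unfolding riemann_sum_def D_def sum_distrib_left sum.distrib[symmetric]
      by (intro sum.cong) (auto simp: algebra_simps)
    have Rm: "riemann_sum W X t m \<in> borel_measurable P" "riemann_sum W stoch_exp t m \<in> borel_measurable P" for m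
      using t by (auto intro!: riemann_sum_measurable Ym Xm)
    have m: "(\<lambda>w. X t w - X 0 w) \<in> borel_measurable P" "(\<lambda>w. stoch_exp t w - stoch_exp 0 w) \<in> borel_measurable P"
      using t by (auto intro!: borel_measurable_diff Ym Xm)
    have "tendsto_prob P (\<lambda>m w. (- x) * riemann_sum W stoch_exp t m w) (\<lambda>w. (- x) * (stoch_exp t w - stoch_exp 0 w))"
      by (rule tendsto_prob_cmult[OF Rm(2) m(2) stoch_exp_riemann_sum[OF t]])
    from tendsto_prob_add[OF Rm(1) m(1) borel_measurable_times[OF borel_measurable_const Rm(2)]
        borel_measurable_times[OF borel_measurable_const m(2)] lim[OF t] this]
    have lim': "tendsto_prob P (riemann_sum W D t) (\<lambda>w. X t w - X 0 w + (- x) * (stoch_exp t w - stoch_exp 0 w))"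
      unfolding eq[symmetric, abs_def] .
    have ae: "AE w in P. X t w - X 0 w + (- x) * (stoch_exp t w - stoch_exp 0 w) = D t w"
      using X0 Y0 by eventually_elim (simp add: D_def algebra_simps)
    have RDm: "riemann_sum W D t m \<in> borel_measurable P" for m
      unfolding eq[abs_def] using Rm by measurable
    have Dm: "D t \<in> borel_measurable P"
      unfolding D_def[abs_def] using t by (intro borel_measurable_diff borel_measurable_times borel_measurable_const Xm Ym) auto
    have Ym': "(\<lambda>w. X t w - X 0 w + (- x) * (stoch_exp t w - stoch_exp 0 w)) \<in> borel_measurable P"
      by (intro borel_measurable_add borel_measurable_times borel_measurable_const m)
    show "tendsto_prob P (riemann_sum W D t) (D t)"
      by (rule tendsto_prob_cong_AE[OF RDm Ym' RDm Dm _ ae lim']) simp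
  qed
  then show ?thesis by eventually_elim (simp add: D_def stoch_exp_def)
qed

end

section \<open>The Black-Scholes model is a geometric Brownian motion\<close>

context filtered_prob_space
begin

lemma inner_increment_normal:
  fixes B :: "real \<Rightarrow> 'a \<Rightarrow> real^'l" and a :: "real^'l"
  assumes B: "standard_brownian_motion P F B" and st: "0 \<le> s" "s < t" "t \<le> 1" and a: "a \<noteq> 0"
  shows "distributed P lborel (\<lambda>w. a \<bullet> B t w - a \<bullet> B s w) (normal_density 0 (sqrt ((norm a)\<^sup>2 * (t - s))))"
proof -
  \<comment> \<open>Only nonzero coefficients are kept, because a summand with coefficient 0 has no
    Gaussian density.\<close>
  define I where "I = {k. a $ k \<noteq> 0}"
  have ind: "indep_vars (\<lambda>_. borel) (\<lambda>k w. (B t w - B s w) $ k) UNIV"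
    and dist: "distributed P lborel (\<lambda>w. (B t w - B s w) $ k) (normal_density 0 (sqrt (t - s)))" for k
    using B st unfolding standard_brownian_motion_def by auto
  have "indep_vars (\<lambda>_. borel) (\<lambda>k w. (B t w - B s w) $ k) I"
    by (rule indep_vars_subset[OF ind]) simp
  then have ind': "indep_vars (\<lambda>_. borel) (\<lambda>k w. a $ k * (B t w - B s w) $ k) I"
    by (rule indep_vars_compose2) simp
  have d: "distributed P lborel (\<lambda>w. a $ k * (B t w - B s w) $ k) (normal_density 0 (\<bar>a $ k\<bar> * sqrt (t - s)))"
    if "k \<in> I" for k
    using normal_density_affine[OF dist[of k], of "a $ k" 0] that st by (simp add: I_def)
  have "I \<noteq> {}" using a by (auto simp: I_def vec_eq_iff)
  then have "distributed P lborel (\<lambda>w. \<Sum>k\<in>I. a $ k * (B t w - B s w) $ k)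
    (normal_density (\<Sum>k\<in>I. 0) (sqrt (\<Sum>k\<in>I. (\<bar>a $ k\<bar> * sqrt (t - s))\<^sup>2)))"
    using st by (intro sum_indep_normal ind' d) (auto simp: I_def)
  also have "(\<lambda>w. \<Sum>k\<in>I. a $ k * (B t w - B s w) $ k) = (\<lambda>w. a \<bullet> B t w - a \<bullet> B s w)"
  proof
    fix w
    have "(\<Sum>k\<in>I. a $ k * (B t w - B s w) $ k) = (\<Sum>k\<in>UNIV. a $ k * (B t w - B s w) $ k)"
      by (intro sum.mono_neutral_left) (auto simp: I_def)
    also have "\<dots> = a \<bullet> (B t w - B s w)" by (simp add: inner_vec_def)
    finally show "(\<Sum>k\<in>I. a $ k * (B t w - B s w) $ k) = a \<bullet> B t w - a \<bullet> B s w"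
      by (simp only: inner_diff_right)
  qed
  also have "(\<Sum>k\<in>I. (\<bar>a $ k\<bar> * sqrt (t - s))\<^sup>2) = (\<Sum>k\<in>UNIV. (a $ k)\<^sup>2 * (t - s))"
    using st by (intro sum.mono_neutral_cong_left) (auto simp: I_def power_mult_distrib)
  also have "\<dots> = (norm a)\<^sup>2 * (t - s)"
    unfolding power2_norm_eq_inner inner_vec_def by (simp add: sum_distrib_right power2_eq_square)
  finally show ?thesis by simp
qed

lemma brownian_increment_measurable:
  fixes B :: "real \<Rightarrow> 'a \<Rightarrow> real^'l"
  assumes B: "standard_brownian_motion P F B" and st: "0 \<le> s" "s < t" "t \<le> 1"
  shows "(\<lambda>w. B t w - B s w) \<in> borel_measurable (F t)"
proof -
  have "B t \<in> borel_measurable (F t)" "B s \<in> borel_measurable (F s)"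
    using B st unfolding standard_brownian_motion_def adapted_def by auto
  then show ?thesis
    using less_imp_le[OF st(2)] by - (rule borel_measurable_diff, assumption, rule measurable_F_mono)
qed

lemma brownian_increment_indep:
  fixes B :: "real \<Rightarrow> 'a \<Rightarrow> real^'l" and X :: "'a \<Rightarrow> real" and g :: "real^'l \<Rightarrow> real"
  assumes B: "standard_brownian_motion P F B" and st: "0 \<le> s" "s < t" "t \<le> 1"
    and X: "X \<in> borel_measurable (F s)" and g: "g \<in> borel_measurable borel"
  shows "indep_var borel X borel (\<lambda>w. g (B t w - B s w))"
proof (rule indep_var_of_indep_set[OF _ _ X])
  let ?Z = "\<lambda>w. B t w - B s w"
  have "(\<lambda>w. g (?Z w)) \<in> borel_measurable (vimage_algebra (space P) ?Z borel)"
    by (rule measurable_compose[OF measurable_vimage_algebra1 g]) simp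
  then have "sets (vimage_algebra (space P) (\<lambda>w. g (?Z w)) borel) \<subseteq> sets (vimage_algebra (space P) ?Z borel)"
    by (auto simp: sets_vimage_algebra2 dest!: measurable_sets)
  then show "indep_set (sets (F s)) (sets (vimage_algebra (space P) (\<lambda>w. g (?Z w)) borel))"
    using B st unfolding standard_brownian_motion_def indep_sets2_eq by blast
  show "random_variable borel (\<lambda>w. g (?Z w))"
    by (rule measurable_compose[OF measurable_F_P[OF brownian_increment_measurable[OF B st]] g])
qed

lemma brownian_inner_scaled_brownian:
  fixes B :: "real \<Rightarrow> 'a \<Rightarrow> real^'l" and a :: "real^'l"
  assumes B: "standard_brownian_motion P F B"
  shows "scaled_brownian P F (\<lambda>t w. a \<bullet> B t w) ((norm a)\<^sup>2)"
proof unfold_locales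
  fix t :: real assume "t \<in> {0..1}"
  then have "B t \<in> borel_measurable (F t)"
    using B unfolding standard_brownian_motion_def adapted_def by auto
  then show "(\<lambda>w. a \<bullet> B t w) \<in> borel_measurable (F t)"
    by (intro borel_measurable_inner borel_measurable_const)
next
  fix s t :: real and X :: "'a \<Rightarrow> real" assume st: "0 \<le> s" "s < t" "t \<le> 1" and X: "X \<in> borel_measurable (F s)"
  have "(\<lambda>x. a \<bullet> x) \<in> borel_measurable borel"
    by (intro borel_measurable_inner borel_measurable_const) simp
  from brownian_increment_indep[OF B st X this]
  show "indep_var borel X borel (\<lambda>w. a \<bullet> B t w - a \<bullet> B s w)"
    by (simp add: inner_diff_right)
next
  fix s t :: real assume st: "0 \<le> s" "s < t" "t \<le> 1"
  have "integrable P (\<lambda>w. (a \<bullet> B t w - a \<bullet> B s w)\<^sup>2) \<and> expectation (\<lambda>w. a \<bullet> B t w - a \<bullet> B s w) = 0 \<and>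
    expectation (\<lambda>w. (a \<bullet> B t w - a \<bullet> B s w)\<^sup>2) = (norm a)\<^sup>2 * (t - s)"
  proof (cases "a = 0")
    case False
    define q where "q = (norm a)\<^sup>2 * (t - s)"
    have q: "0 < sqrt q" using False st by (simp add: q_def)
    note n = inner_increment_normal[OF B st False, folded q_def]
    have m: "expectation (\<lambda>w. a \<bullet> B t w - a \<bullet> B s w) = 0"
      by (rule normal_distributed_expectation[OF q n])
    moreover have "expectation (\<lambda>w. (a \<bullet> B t w - a \<bullet> B s w)\<^sup>2) = q"
      using normal_distributed_variance[OF q n] q unfolding m by simp
    moreover have "integrable P (\<lambda>w. (a \<bullet> B t w - a \<bullet> B s w)\<^sup>2)"
      using distributed_integrable[OF n, of "\<lambda>x. x\<^sup>2"] integrable_normal_moment[OF q, of 0 2] by simp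
    ultimately show ?thesis by (simp add: q_def)
  qed simp
  then show "integrable P (\<lambda>w. (a \<bullet> B t w - a \<bullet> B s w)\<^sup>2)" "expectation (\<lambda>w. a \<bullet> B t w - a \<bullet> B s w) = 0"
    "expectation (\<lambda>w. (a \<bullet> B t w - a \<bullet> B s w)\<^sup>2) = (norm a)\<^sup>2 * (t - s)" by auto
next
  fix s t :: real assume "0 \<le> s" "s < t" "t \<le> 1" "0 < (norm a)\<^sup>2"
  then show "distributed P lborel (\<lambda>w. a \<bullet> B t w - a \<bullet> B s w) (normal_density 0 (sqrt ((norm a)\<^sup>2 * (t - s))))"
    using inner_increment_normal[OF B] by auto
next
  show "AE w in P. a \<bullet> B 0 w = 0"
    using B unfolding standard_brownian_motion_def by (auto elim: eventually_mono)
  fix w assume "w \<in> space P"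
  then have "continuous_on {0..1} (\<lambda>t. B t w)"
    using B unfolding standard_brownian_motion_def continuous_paths_def by auto
  then show "continuous_on {0..1} (\<lambda>t. a \<bullet> B t w)" by (intro continuous_intros)
qed auto

end

lemma borel_measurable_nth:
  "f \<in> borel_measurable M \<Longrightarrow> (\<lambda>x. f x $ i :: real) \<in> borel_measurable M"
  by (rule measurable_compose[OF _ borel_measurable_continuous_onI[OF continuous_on_component[OF continuous_on_id]]])

text \<open>The model speaks of one integral per component of \<open>B\<close>, the scalar equation
  of one integrator. Both are limits of Riemann sums, and the sums over the components combine into
  Riemann sums of coordinate i against the inner product of row i of \<Gamma> with
  \<open>B\<close>.\<close>

lemma black_scholes_solution:
  fixes M :: "real \<Rightarrow> 'a \<Rightarrow> real^'l"
  assumes bs: "black_scholes_model P F B \<Gamma> x M" and t: "t \<in> {0..1}"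
  shows "AE w in P. M t w $ i = x $ i * exp (\<Gamma> $ i \<bullet> B t w - (norm (\<Gamma> $ i))\<^sup>2 * t / 2)"
proof -
  interpret filtered_prob_space P F using bs unfolding black_scholes_model_def by auto
  have B: "standard_brownian_motion P F B" using bs unfolding black_scholes_model_def by auto
  interpret W: scaled_brownian P F "\<lambda>t w. \<Gamma> $ i \<bullet> B t w" "(norm (\<Gamma> $ i))\<^sup>2"
    by (rule brownian_inner_scaled_brownian[OF B])
  have MF: "(\<lambda>w. M t w $ i) \<in> borel_measurable (F t)" if "t \<in> {0..1}" for t
    using bs that unfolding black_scholes_model_def adapted_def by (intro borel_measurable_nth) auto
  have Mc: "continuous_on {0..1} (\<lambda>t. M t w $ i)" if "w \<in> space P" for w
    using bs that unfolding black_scholes_model_def continuous_paths_def by (intro continuous_on_component) auto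
  show ?thesis
  proof (rule W.linear_sde_solution[OF MF Mc _ _ t])
    show "AE w in P. M 0 w $ i = x $ i"
      using bs unfolding black_scholes_model_def by (auto elim: eventually_mono)
    fix t :: real assume t: "0 < t" "t \<le> 1"
    then have t01: "t \<in> {0..1}" by simp
    from bs have "\<forall>t\<in>{0..1}. \<forall>i. \<exists>J.
        (\<forall>k. has_ito_integral P F (\<lambda>s w. B s w $ k) (\<lambda>s w. M s w $ i * \<Gamma> $ i $ k) t (J k)) \<and>
        (AE w in P. M t w $ i = M 0 w $ i + (\<Sum>k\<in>UNIV. J k w))"
      unfolding black_scholes_model_def by blast
    from this[rule_format, OF t01, of i] obtain J where
      J: "\<And>k. has_ito_integral P F (\<lambda>s w. B s w $ k) (\<lambda>s w. M s w $ i * \<Gamma> $ i $ k) t (J k)"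
      and M: "AE w in P. M t w $ i = M 0 w $ i + (\<Sum>k\<in>UNIV. J k w)" by blast
    have HF: "(\<lambda>w. M s w $ i * \<Gamma> $ i $ k) \<in> borel_measurable (F s)" if "s \<in> {0..t}" for s k
      using t that by (intro borel_measurable_times borel_measurable_const MF) auto
    have Jm: "J k \<in> borel_measurable P" for k using J[of k] unfolding has_ito_integral_def by blast
    let ?R = "\<lambda>k. riemann_sum (\<lambda>s w. B s w $ k) (\<lambda>s w. M s w $ i * \<Gamma> $ i $ k) t"
    have R: "tendsto_prob P (?R k) (J k) \<and> (\<forall>m. ?R k m \<in> borel_measurable P)" for k
    proof -
      \<comment> \<open>A component is the inner product with a unit vector, so the general instance
        for inner products covers it with variance rate 1.\<close>
      have eq: "(\<lambda>s w. axis k 1 \<bullet> B s w) = (\<lambda>s w. B s w $ k)"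
        by (simp add: inner_axis')
      interpret K: scaled_brownian P F "\<lambda>s w. B s w $ k" "(norm (axis k 1 :: real^'l))\<^sup>2"
        using brownian_inner_scaled_brownian[OF B, of "axis k 1"] unfolding eq .
      have "tendsto_prob P (?R k) (J k)"
      proof (rule K.ito_integral_riemann_sum[OF J t HF])
        fix w assume "w \<in> space P"
        then have "continuous_on {0..t} (\<lambda>s. M s w $ i)"
          using t by (intro continuous_on_subset[OF Mc]) auto
        then show "continuous_on {0..t} (\<lambda>s. M s w $ i * \<Gamma> $ i $ k)"
          by (rule continuous_on_mult_right)
      qed
      moreover have "?R k m \<in> borel_measurable P" for m
        by (rule K.riemann_sum_measurable[OF t measurable_F_P[OF HF]])
      ultimately show ?thesis by blast
    qed
    have "tendsto_prob P (\<lambda>m w. \<Sum>k\<in>UNIV. ?R k m w) (\<lambda>w. \<Sum>k\<in>UNIV. J k w)"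
      using R Jm by (intro tendsto_prob_sum) auto
    also have "(\<lambda>m w. \<Sum>k\<in>UNIV. ?R k m w) = riemann_sum (\<lambda>t w. \<Gamma> $ i \<bullet> B t w) (\<lambda>t w. M t w $ i) t"
    proof (intro ext)
      fix m w
      have "(\<Sum>k\<in>UNIV. M s w $ i * \<Gamma> $ i $ k * (B u w $ k - B s w $ k)) =
        M s w $ i * (\<Gamma> $ i \<bullet> B u w - \<Gamma> $ i \<bullet> B s w)" for s u
      proof -
        have "\<Gamma> $ i \<bullet> B u w - \<Gamma> $ i \<bullet> B s w = (\<Sum>k\<in>UNIV. \<Gamma> $ i $ k * (B u w $ k - B s w $ k))"
          by (simp only: inner_diff_right[symmetric]) (simp add: inner_vec_def)
        then show ?thesis by (simp add: sum_distrib_left mult.assoc)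
      qed
      then show "(\<Sum>k\<in>UNIV. ?R k m w) = riemann_sum (\<lambda>t w. \<Gamma> $ i \<bullet> B t w) (\<lambda>t w. M t w $ i) t m w"
        unfolding riemann_sum_def by (subst sum.swap) simp
    qed
    finally have lim: "tendsto_prob P (riemann_sum (\<lambda>t w. \<Gamma> $ i \<bullet> B t w) (\<lambda>t w. M t w $ i) t) (\<lambda>w. \<Sum>k\<in>UNIV. J k w)" .
    have MP: "(\<lambda>w. M s w $ i) \<in> borel_measurable P" if "s \<in> {0..1}" for s
      using measurable_F_P[OF MF[OF that]] .
    have Rm: "riemann_sum (\<lambda>t w. \<Gamma> $ i \<bullet> B t w) (\<lambda>t w. M t w $ i) t m \<in> borel_measurable P" for m
      using t by (intro W.riemann_sum_measurable[OF t MP]) auto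
    have SJ: "(\<lambda>w. \<Sum>k\<in>UNIV. J k w) \<in> borel_measurable P"
      by (intro borel_measurable_sum Jm)
    have Mm: "(\<lambda>w. M t w $ i - M 0 w $ i) \<in> borel_measurable P"
      using t01 by (intro borel_measurable_diff MP) auto
    have ae: "AE w in P. (\<Sum>k\<in>UNIV. J k w) = M t w $ i - M 0 w $ i"
      using M by eventually_elim simp
    show "tendsto_prob P (riemann_sum (\<lambda>t w. \<Gamma> $ i \<bullet> B t w) (\<lambda>t w. M t w $ i) t) (\<lambda>w. M t w $ i - M 0 w $ i)"
      by (rule tendsto_prob_cong_AE[OF Rm SJ Rm Mm _ ae lim]) simp
  qed
qed

section \<open>Gaussian product measures\<close>

lemma density_PiM:
  fixes f :: "'i \<Rightarrow> 'a \<Rightarrow> ennreal"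
  assumes I: "finite I" and M: "\<And>i. sigma_finite_measure (M i)"
    and D: "\<And>i. sigma_finite_measure (density (M i) (f i))"
    and f: "\<And>i. f i \<in> borel_measurable (M i)"
  shows "density (PiM I M) (\<lambda>x. \<Prod>i\<in>I. f i (x i)) = PiM I (\<lambda>i. density (M i) (f i))"
proof -
  interpret M: product_sigma_finite M by (rule product_sigma_finite.intro) (rule M)
  interpret D: product_sigma_finite "\<lambda>i. density (M i) (f i)" by (rule product_sigma_finite.intro) (rule D)
  note f[measurable]
  show ?thesis
  proof (rule D.PiM_eqI[OF I])
    show "sets (density (PiM I M) (\<lambda>x. \<Prod>i\<in>I. f i (x i))) = sets (PiM I (\<lambda>i. density (M i) (f i)))"
      by (simp cong: sets_PiM_cong)
    fix A assume A: "\<And>i. i \<in> I \<Longrightarrow> A i \<in> sets (density (M i) (f i))"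
    then have A': "A i \<in> sets (M i)" if "i \<in> I" for i using that by simp
    have A'': "Pi\<^sub>E I A \<in> sets (PiM I M)" using I A' by (intro sets_PiM_I_finite) auto
    have "emeasure (density (PiM I M) (\<lambda>x. \<Prod>i\<in>I. f i (x i))) (Pi\<^sub>E I A) =
      (\<integral>\<^sup>+x. (\<Prod>i\<in>I. f i (x i)) * indicator (Pi\<^sub>E I A) x \<partial>PiM I M)"
      by (rule emeasure_density[OF _ A'']) measurable
    also have "\<dots> = (\<integral>\<^sup>+x. (\<Prod>i\<in>I. f i (x i) * indicator (A i) (x i)) \<partial>PiM I M)"
    proof (rule nn_integral_cong)
      fix x assume x: "x \<in> space (PiM I M)"
      have "indicator (Pi\<^sub>E I A) x = (\<Prod>i\<in>I. indicator (A i) (x i) :: ennreal)"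
      proof (cases "x \<in> Pi\<^sub>E I A")
        case True
        then show ?thesis by (auto simp: PiE_def Pi_def intro!: prod.neutral[symmetric])
      next
        case False
        then obtain i where "i \<in> I" "x i \<notin> A i" using x by (auto simp: space_PiM PiE_def)
        then have "(\<Prod>i\<in>I. indicator (A i) (x i) :: ennreal) = 0" using I by (intro prod_zero) (auto intro!: bexI[of _ i])
        then show ?thesis using False by simp
      qed
      then show "(\<Prod>i\<in>I. f i (x i)) * indicator (Pi\<^sub>E I A) x = (\<Prod>i\<in>I. f i (x i) * indicator (A i) (x i))"
        by (simp add: prod.distrib)
    qed
    also have "\<dots> = (\<Prod>i\<in>I. \<integral>\<^sup>+x. f i x * indicator (A i) x \<partial>M i)"
      by (rule M.product_nn_integral_prod[OF I]) (use A' in measurable)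
    also have "\<dots> = (\<Prod>i\<in>I. emeasure (density (M i) (f i)) (A i))"
      using A' by (intro prod.cong refl emeasure_density[symmetric] f)
    finally show "emeasure (density (PiM I M) (\<lambda>x. \<Prod>i\<in>I. f i (x i))) (Pi\<^sub>E I A) =
      (\<Prod>i\<in>I. emeasure (density (M i) (f i)) (A i))" .
  qed
qed

lemma borel_measurable_vec_lambda:
  assumes "\<And>i. (\<lambda>x. f i x) \<in> borel_measurable M"
  shows "(\<lambda>x. (\<chi> i. f i x) :: real^'n) \<in> borel_measurable M"
proof (subst borel_measurable_euclidean_space, rule ballI)
  fix b :: "real^'n" assume "b \<in> Basis"
  then obtain i where b: "b = axis i 1" by (auto simp: Basis_vec_def)
  show "(\<lambda>x. (\<chi> i. f i x) \<bullet> b) \<in> borel_measurable M"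
    unfolding b inner_axis by (simp add: assms)
qed

text \<open>Identifies Lebesgue measure on vectors with the product over coordinates. Through it,
  independent coordinates yield a product density and Fubini can be applied to one coordinate at a
  time.\<close>

lemma distr_PiM_lborel_vec:
  "distr (PiM UNIV (\<lambda>_::'n::finite. lborel)) borel (\<lambda>f. (\<chi> i. f i) :: real^'n) = lborel"
proof (rule lborel_eqI[symmetric])
  fix l u :: "real^'n" assume le: "\<And>b. b \<in> Basis \<Longrightarrow> l \<bullet> b \<le> u \<bullet> b"
  interpret product_sigma_finite "\<lambda>_::'n. lborel :: real measure" by standard
  have le': "l $ i \<le> u $ i" for i using le[of "axis i 1"] by (simp add: inner_axis axis_in_Basis_iff)
  have m: "(\<lambda>f. (\<chi> i. f i) :: real^'n) \<in> measurable (PiM UNIV (\<lambda>_::'n. lborel)) borel"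
    by (intro borel_measurable_vec_lambda) measurable
  have "emeasure (distr (PiM UNIV (\<lambda>_::'n. lborel)) borel (\<lambda>f. (\<chi> i. f i) :: real^'n)) (box l u) =
    emeasure (PiM UNIV (\<lambda>_::'n. lborel)) (Pi\<^sub>E UNIV (\<lambda>i. {l $ i <..< u $ i}))"
    by (subst emeasure_distr[OF m]) (auto intro!: arg_cong[where f = "emeasure _"] simp: mem_box_cart space_PiM PiE_def Pi_def)
  also have "\<dots> = (\<Prod>i\<in>UNIV. ennreal (u $ i - l $ i))"
    using le' by (subst emeasure_PiM) auto
  also have "\<dots> = ennreal (\<Prod>i\<in>UNIV. u $ i - l $ i)"
    using le' by (intro prod_ennreal) auto
  also have "(\<Prod>i\<in>UNIV. u $ i - l $ i) = (\<Prod>b\<in>Basis. (u - l) \<bullet> b)"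
  proof -
    have B: "(Basis :: (real^'n) set) = (\<lambda>i. axis i 1) ` UNIV" by (auto simp: Basis_vec_def)
    have "inj (\<lambda>i::'n. axis i (1::real))" by (auto intro!: injI simp: axis_eq_axis)
    then have "(\<Prod>b\<in>Basis. (u - l) \<bullet> b) = (\<Prod>i\<in>UNIV. (u - l) \<bullet> axis i 1)"
      unfolding B by (subst prod.reindex) (simp_all add: comp_def)
    then show ?thesis by (simp add: inner_axis)
  qed
  finally show "emeasure (distr (PiM UNIV (\<lambda>_::'n. lborel)) borel (\<lambda>f. (\<chi> i. f i) :: real^'n)) (box l u) =
    ennreal (\<Prod>b\<in>Basis. (u - l) \<bullet> b)" .
qed simp

definition gauss_density :: "real \<Rightarrow> real^'l \<Rightarrow> real" where
  "gauss_density h b = (\<Prod>i\<in>UNIV. normal_density 0 (sqrt h) (b $ i))"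

definition gauss :: "real \<Rightarrow> (real^'l) measure" where
  "gauss h = density lborel (gauss_density h)"

lemma gauss_density_measurable [measurable]: "gauss_density h \<in> borel_measurable borel"
  unfolding gauss_density_def[abs_def]
  by (intro borel_measurable_prod measurable_compose[OF _ borel_measurable_normal_density] borel_measurable_nth) simp

lemma gauss_density_pos: "0 < h \<Longrightarrow> 0 < gauss_density h b"
  unfolding gauss_density_def by (intro prod_pos normal_density_pos) simp

lemma gauss_density_ratio:
  fixes b c :: "real^'l"
  assumes "0 < h"
  shows "gauss_density h b = gauss_density h c * exp (((norm c)\<^sup>2 - (norm b)\<^sup>2) / (2 * h))"
proof -
  have "normal_density 0 (sqrt h) (b $ i) = normal_density 0 (sqrt h) (c $ i) * exp (((c $ i)\<^sup>2 - (b $ i)\<^sup>2) / (2 * h))" for i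
    using assms by (simp add: normal_density_def exp_add[symmetric] diff_divide_distrib)
  then have "gauss_density h b = gauss_density h c * (\<Prod>i\<in>UNIV. exp (((c $ i)\<^sup>2 - (b $ i)\<^sup>2) / (2 * h)))"
    unfolding gauss_density_def by (simp add: prod.distrib)
  also have "(\<Prod>i\<in>UNIV. exp (((c $ i)\<^sup>2 - (b $ i)\<^sup>2) / (2 * h))) = exp (\<Sum>i\<in>UNIV. ((c $ i)\<^sup>2 - (b $ i)\<^sup>2) / (2 * h))"
    by (rule exp_sum[symmetric]) simp
  also have "(\<Sum>i\<in>UNIV. ((c $ i)\<^sup>2 - (b $ i)\<^sup>2) / (2 * h)) = ((norm c)\<^sup>2 - (norm b)\<^sup>2) / (2 * h)"
    unfolding power2_norm_eq_inner inner_vec_def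
    by (simp add: sum_subtractf sum_divide_distrib[symmetric] power2_eq_square)
  finally show ?thesis .
qed

lemma (in prob_space) distr_indep_normal_vec:
  fixes Z :: "'a \<Rightarrow> real^'l"
  assumes ind: "indep_vars (\<lambda>_. borel) (\<lambda>k w. Z w $ k) UNIV" and h: "0 < h"
    and dist: "\<And>k. distributed M lborel (\<lambda>w. Z w $ k) (normal_density 0 (sqrt h))"
  shows "distr M borel Z = gauss h"
proof -
  have m: "(\<lambda>f. (\<chi> i. f i) :: real^'l) \<in> measurable (PiM UNIV (\<lambda>_::'l. borel)) borel"
    by (intro borel_measurable_vec_lambda) measurable
  have rv: "random_variable borel (\<lambda>w. Z w $ k)" for k
    using distributed_measurable[OF dist[of k]] by simp
  have rv': "(\<lambda>w. \<lambda>k\<in>UNIV. Z w $ k) \<in> measurable M (PiM UNIV (\<lambda>_::'l. borel))"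
    using rv by measurable
  have "distr M (PiM UNIV (\<lambda>_::'l. borel)) (\<lambda>w. \<lambda>k\<in>UNIV. Z w $ k) = PiM UNIV (\<lambda>k. distr M borel (\<lambda>w. Z w $ k))"
    by (rule indep_vars_iff_distr_eq_PiM[THEN iffD1, OF _ rv ind]) simp
  also have "\<dots> = PiM UNIV (\<lambda>k::'l. density lborel (\<lambda>x. ennreal (normal_density 0 (sqrt h) x)))"
  proof (intro PiM_cong refl)
    fix k :: 'l
    have "distr M borel (\<lambda>w. Z w $ k) = distr M lborel (\<lambda>w. Z w $ k)"
      by (rule distr_cong) auto
    then show "distr M borel (\<lambda>w. Z w $ k) = density lborel (\<lambda>x. ennreal (normal_density 0 (sqrt h) x))"
      using distributed_distr_eq_density[OF dist[of k]] by simp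
  qed
  also have "\<dots> = density (PiM UNIV (\<lambda>_::'l. lborel)) (\<lambda>x. \<Prod>k\<in>UNIV. ennreal (normal_density 0 (sqrt h) (x k)))"
  proof (rule density_PiM[symmetric])
    show "sigma_finite_measure (density lborel (\<lambda>x. ennreal (normal_density 0 (sqrt h) x)))"
      using prob_space_normal_density[of "sqrt h" 0] h
      by (intro prob_space_imp_sigma_finite) auto
  qed (auto intro: lborel.sigma_finite_measure_axioms)
  finally have law: "distr M (PiM UNIV (\<lambda>_::'l. borel)) (\<lambda>w. \<lambda>k\<in>UNIV. Z w $ k) =
    density (PiM UNIV (\<lambda>_::'l. lborel)) (\<lambda>x. \<Prod>k\<in>UNIV. ennreal (normal_density 0 (sqrt h) (x k)))" .
  have "distr M borel Z = distr (distr M (PiM UNIV (\<lambda>_::'l. borel)) (\<lambda>w. \<lambda>k\<in>UNIV. Z w $ k)) borel (\<lambda>f. (\<chi> i. f i) :: real^'l)"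
    by (subst distr_distr[OF m rv']) (simp add: comp_def restrict_UNIV)
  also have "\<dots> = distr (density (PiM UNIV (\<lambda>_::'l. lborel)) (\<lambda>x. ennreal (gauss_density h (\<chi> i. x i)))) borel (\<lambda>f. (\<chi> i. f i) :: real^'l)"
    unfolding law gauss_density_def by (simp add: prod_ennreal)
  also have "\<dots> = density (distr (PiM UNIV (\<lambda>_::'l. lborel)) borel (\<lambda>f. (\<chi> i. f i) :: real^'l)) (\<lambda>b. ennreal (gauss_density h b))"
    by (rule density_distr[symmetric]) (auto intro!: borel_measurable_vec_lambda)
  also have "\<dots> = gauss h" unfolding distr_PiM_lborel_vec gauss_def ..
  finally show ?thesis .
qed

section \<open>Linear change of variables for Lebesgue and Gaussian measures\<close>

lemma matrix_inv_mult:
  fixes A :: "real^'n^'n"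
  assumes "invertible A"
  shows "A ** matrix_inv A = mat 1" "matrix_inv A ** A = mat 1"
  using someI_ex[OF assms[unfolded invertible_def]] unfolding matrix_inv_def by auto

lemma borel_measurable_matrix_vector_mult:
  fixes D :: "real^'n^'m"
  assumes "f \<in> borel_measurable M"
  shows "(\<lambda>x. D *v f x) \<in> borel_measurable M"
  by (rule measurable_compose[OF assms])
     (intro borel_measurable_continuous_onI linear_continuous_on matrix_vector_mul_bounded_linear)

lemma prod_Basis_cart:
  fixes f :: "real^'n \<Rightarrow> 'b::comm_monoid_mult"
  shows "(\<Prod>b\<in>Basis. f b) = (\<Prod>i\<in>UNIV. f (axis i 1))"
proof -
  have B: "(Basis :: (real^'n) set) = (\<lambda>i. axis i 1) ` UNIV" by (auto simp: Basis_vec_def)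
  have "inj (\<lambda>i::'n. axis i (1::real))" by (auto intro!: injI simp: axis_eq_axis)
  then show ?thesis unfolding B by (subst prod.reindex) (simp_all add: comp_def)
qed

lemma nn_integral_lborel_vec:
  fixes g :: "real^'n \<Rightarrow> ennreal"
  assumes "g \<in> borel_measurable borel"
  shows "(\<integral>\<^sup>+x. g x \<partial>lborel) = (\<integral>\<^sup>+f. g (\<chi> i. f i) \<partial>PiM UNIV (\<lambda>_. lborel))"
  unfolding distr_PiM_lborel_vec[symmetric] using assms
  by (intro nn_integral_distr borel_measurable_vec_lambda) simp_all

text \<open>Integrate over coordinate m first. With the others fixed, the shear is a translation by
  c times coordinate n, which does not move because m and n differ; Lebesgue measure on the line is
  translation invariant.\<close>

lemma nn_integral_lborel_shear:
  fixes g :: "real^'n \<Rightarrow> ennreal"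
  assumes g: "g \<in> borel_measurable borel" and "m \<noteq> n"
  shows "(\<integral>\<^sup>+x. g (\<chi> i. if i = m then x $ m + c * x $ n else x $ i) \<partial>lborel) = (\<integral>\<^sup>+x. g x \<partial>lborel)"
proof -
  interpret product_sigma_finite "\<lambda>_::'n. lborel :: real measure" by (rule product_sigma_finite.intro) standard
  let ?I = "UNIV - {m}" and ?V = "\<lambda>f. (\<chi> i. f i) :: real^'n"
  have ins: "UNIV = insert m ?I" by auto
  have V: "?V \<in> measurable (PiM UNIV (\<lambda>_. lborel)) borel"
    by (intro borel_measurable_vec_lambda) measurable
  have gV: "(\<lambda>f. g (?V f)) \<in> borel_measurable (PiM UNIV (\<lambda>_. lborel))"
    using measurable_compose[OF V g] .
  define T where "T x = (\<chi> i. if i = m then x $ m + c * x $ n else x $ i)" for x :: "real^'n"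
  have T: "T \<in> borel_measurable borel"
    unfolding T_def[abs_def]
  proof (rule borel_measurable_vec_lambda)
    fix i show "(\<lambda>x::real^'n. if i = m then x $ m + c * x $ n else x $ i) \<in> borel_measurable borel"
      by (cases "i = m") (auto intro!: borel_measurable_add borel_measurable_times borel_measurable_nth)
  qed
  have gT: "(\<lambda>x. g (T x)) \<in> borel_measurable borel" using measurable_compose[OF T g] .
  have gTV: "(\<lambda>f. g (T (?V f))) \<in> borel_measurable (PiM UNIV (\<lambda>_. lborel))"
    using measurable_compose[OF V gT] .
  have shift: "(\<integral>\<^sup>+y. g (?V (f(m := y + a))) \<partial>lborel) = (\<integral>\<^sup>+y. g (?V (f(m := y))) \<partial>lborel)" for f a
  proof -
    have "(\<lambda>y. ?V (f(m := y))) \<in> borel_measurable borel"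
    proof (rule borel_measurable_vec_lambda)
      fix i show "(\<lambda>y. (f(m := y)) i) \<in> borel_measurable borel" by (cases "i = m") auto
    qed
    then have m: "(\<lambda>y. g (?V (f(m := y)))) \<in> borel_measurable borel" using g by (rule measurable_compose)
    have "(\<integral>\<^sup>+y. g (?V (f(m := y))) \<partial>lborel) = (\<integral>\<^sup>+y. g (?V (f(m := y))) \<partial>distr lborel borel ((+) a))"
      by (simp add: lborel_distr_plus)
    also have "\<dots> = (\<integral>\<^sup>+y. g (?V (f(m := a + y))) \<partial>lborel)"
      using m by (intro nn_integral_distr) simp_all
    finally show ?thesis by (simp add: add.commute)
  qed
  have "(\<integral>\<^sup>+x. g (T x) \<partial>lborel) = (\<integral>\<^sup>+f. g (T (?V f)) \<partial>PiM (insert m ?I) (\<lambda>_. lborel))"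
    using nn_integral_lborel_vec[OF gT] ins by simp
  also have "\<dots> = (\<integral>\<^sup>+f. \<integral>\<^sup>+y. g (T (?V (f(m := y)))) \<partial>lborel \<partial>PiM ?I (\<lambda>_. lborel))"
    using gTV ins by (intro product_nn_integral_insert) auto
  also have "\<dots> = (\<integral>\<^sup>+f. \<integral>\<^sup>+y. g (?V (f(m := y + c * f n))) \<partial>lborel \<partial>PiM ?I (\<lambda>_. lborel))"
  proof -
    have "T (?V (f(m := y))) = ?V (f(m := y + c * f n))" for f y
      using \<open>m \<noteq> n\<close> by (auto simp: T_def vec_eq_iff)
    then show ?thesis by simp
  qed
  also have "\<dots> = (\<integral>\<^sup>+f. \<integral>\<^sup>+y. g (?V (f(m := y))) \<partial>lborel \<partial>PiM ?I (\<lambda>_. lborel))"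
    by (simp only: shift)
  also have "\<dots> = (\<integral>\<^sup>+f. g (?V f) \<partial>PiM (insert m ?I) (\<lambda>_. lborel))"
    using gV ins by (intro product_nn_integral_insert[symmetric]) auto
  also have "\<dots> = (\<integral>\<^sup>+x. g x \<partial>lborel)"
    using nn_integral_lborel_vec[OF g] ins by simp
  finally show ?thesis unfolding T_def .
qed

text \<open>The library's change of variables for linear maps assumes a well-ordered index type.\<close>

lemma distr_lborel_matrix:
  fixes A :: "real^'n^'n"
  shows "det A \<noteq> 0 \<Longrightarrow> distr lborel borel (\<lambda>x. A *v x) = density lborel (\<lambda>_. ennreal (1 / \<bar>det A\<bar>))"
proof (induction A rule: induct_matrix_elementary)
  case (1 A B)
  note mult = 1
  then have d: "det A \<noteq> 0" "det B \<noteq> 0" by (auto simp: det_mul)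
  note m = borel_measurable_matrix_vector_mult[OF measurable_ident]
  have "distr lborel borel (\<lambda>x. (A ** B) *v x) = distr (distr lborel borel (\<lambda>x. B *v x)) borel (\<lambda>x. A *v x)"
    using m by (subst distr_distr) (auto simp: comp_def matrix_vector_mul_assoc)
  also have "\<dots> = distr (density lborel (\<lambda>_. ennreal (1 / \<bar>det B\<bar>))) borel (\<lambda>x. A *v x)"
    using mult d by simp
  also have "\<dots> = density (distr lborel borel (\<lambda>x. A *v x)) (\<lambda>_. ennreal (1 / \<bar>det B\<bar>))"
    using m by (intro density_distr[symmetric]) auto
  also have "\<dots> = density (density lborel (\<lambda>_. ennreal (1 / \<bar>det A\<bar>))) (\<lambda>_. ennreal (1 / \<bar>det B\<bar>))"
    using mult d by simp
  also have "\<dots> = density lborel (\<lambda>_. ennreal (1 / \<bar>det (A ** B)\<bar>))"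
    by (simp add: density_density_eq ennreal_mult[symmetric] det_mul abs_mult)
  finally show ?case .
next
  case (2 A i)
  then show ?case by (simp add: det_zero_row)
next
  case (3 A)
  note diagonal = 3
  have det: "det A = (\<Prod>i\<in>UNIV. A $ i $ i)" using diagonal by (intro det_diagonal) auto
  have nz: "A $ i $ i \<noteq> 0" for i using diagonal(2) unfolding det by auto
  define c where "c b = b \<bullet> (A *v b)" for b :: "real^'n"
  have Ax: "(A *v x) $ i = A $ i $ i * x $ i" for x i
  proof -
    have "(A *v x) $ i = (\<Sum>j\<in>UNIV. if j = i then A $ i $ i * x $ i else 0)"
      unfolding matrix_vector_mult_def vec_lambda_beta
      by (rule sum.cong) (use diagonal(1)[of i] in auto)
    then show ?thesis by simp
  qed
  have c: "c (axis i 1) = A $ i $ i" for i by (simp add: c_def inner_axis' Ax)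
  have Basis: "\<exists>i. b = axis i 1" if "b \<in> Basis" for b :: "real^'n" using that by (auto simp: Basis_vec_def)
  have cnz: "c b \<noteq> 0" if "b \<in> Basis" for b using Basis[OF that] nz c by auto
  have "(\<Prod>b\<in>Basis. \<bar>c b\<bar>) = \<bar>det A\<bar>"
    unfolding prod_Basis_cart c det by (simp add: abs_prod)
  moreover have "(0::real^'n) + (\<Sum>j\<in>Basis. (c j * (x \<bullet> j)) *\<^sub>R j) = A *v x" for x
  proof -
    have "c j * (x \<bullet> j) = (A *v x) \<bullet> j" if "j \<in> Basis" for j
      using Basis[OF that] by (auto simp: c inner_axis Ax)
    then have "(\<Sum>j\<in>Basis. (c j * (x \<bullet> j)) *\<^sub>R j) = (\<Sum>j\<in>Basis. ((A *v x) \<bullet> j) *\<^sub>R j)"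
      by (intro sum.cong) auto
    then show ?thesis by (simp add: euclidean_representation)
  qed
  ultimately have lin: "lborel = density (distr lborel borel (\<lambda>x. A *v x)) (\<lambda>_. ennreal \<bar>det A\<bar>)"
    using lborel_affine_euclidean[of c "0::real^'n"] cnz by simp
  have "density lborel (\<lambda>_. ennreal (1 / \<bar>det A\<bar>)) = density (density (distr lborel borel (\<lambda>x. A *v x)) (\<lambda>_. ennreal \<bar>det A\<bar>)) (\<lambda>_. ennreal (1 / \<bar>det A\<bar>))"
    using lin by simp
  also have "\<dots> = distr lborel borel (\<lambda>x. A *v x)"
    using diagonal(2) by (simp add: density_density_eq ennreal_mult[symmetric] density_1)
  finally show ?case ..
next
  case (4 m n)
  let ?\<tau> = "Transposition.transpose m n" and ?A = "(\<chi> i j. mat 1 $ i $ Transposition.transpose m n j) :: real^'n^'n"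
  have perm: "?\<tau> permutes UNIV" by (simp add: permutes_swap_id)
  have det: "\<bar>det ?A\<bar> = 1"
    using det_permute_columns[OF perm, of "mat 1 :: real^'n^'n"] by (simp add: abs_mult sign_def)
  have Ax: "(?A *v x) $ i = x $ ?\<tau> i" for x i
  proof -
    have "(?A *v x) $ i = (\<Sum>j\<in>UNIV. if j = ?\<tau> i then x $ ?\<tau> i else 0)"
      unfolding matrix_vector_mult_def vec_lambda_beta
    proof (rule sum.cong)
      fix j
      have "i = ?\<tau> j \<longleftrightarrow> j = ?\<tau> i" by (metis transpose_involutory)
      then show "mat 1 $ i $ ?\<tau> j * x $ j = (if j = ?\<tau> i then x $ ?\<tau> i else 0)"
        by (simp add: mat_def)
    qed simp
    then show ?thesis by simp
  qed
  have m: "(\<lambda>x. ?A *v x) \<in> borel_measurable borel"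
    by (rule borel_measurable_matrix_vector_mult) simp
  have "lborel = distr lborel borel (\<lambda>x. ?A *v x)"
  proof (rule lborel_eqI)
    fix l u :: "real^'n" assume le: "\<And>b. b \<in> Basis \<Longrightarrow> l \<bullet> b \<le> u \<bullet> b"
    have le': "l $ i \<le> u $ i" for i using le[of "axis i 1"] by (simp add: inner_axis axis_in_Basis_iff)
    let ?p = "\<lambda>y. (\<chi> i. y $ ?\<tau> i) :: real^'n"
    \<comment> \<open>A coordinate swap pulls boxes back to boxes with permuted sides, whose volume
      is the same product in another order.\<close>
    have "(\<lambda>x. ?A *v x) -` box l u = box (?p l) (?p u)"
    proof (rule set_eqI)
      fix x
      have "(\<forall>i. l $ i < x $ ?\<tau> i \<and> x $ ?\<tau> i < u $ i) \<longleftrightarrow> (\<forall>i. l $ ?\<tau> i < x $ i \<and> x $ i < u $ ?\<tau> i)"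
        by (metis transpose_involutory)
      then show "x \<in> (\<lambda>x. ?A *v x) -` box l u \<longleftrightarrow> x \<in> box (?p l) (?p u)"
        by (simp add: mem_box_cart Ax)
    qed
    then have "emeasure (distr lborel borel (\<lambda>x. ?A *v x)) (box l u) = emeasure lborel (box (?p l) (?p u))"
      using m by (subst emeasure_distr) auto
    also have "\<dots> = ennreal (\<Prod>b\<in>Basis. (?p u - ?p l) \<bullet> b)"
    proof (rule emeasure_lborel_box)
      fix b :: "real^'n" assume "b \<in> Basis"
      then obtain i where "b = axis i 1" by (auto simp: Basis_vec_def)
      then show "?p l \<bullet> b \<le> ?p u \<bullet> b" by (simp add: inner_axis le')
    qed
    also have "(\<Prod>b\<in>Basis. (?p u - ?p l) \<bullet> b) = (\<Prod>i\<in>UNIV. (u - l) $ ?\<tau> i)"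
      unfolding prod_Basis_cart by (simp add: inner_axis)
    also have "\<dots> = (\<Prod>i\<in>UNIV. (u - l) $ i)"
      by (rule prod.permute[OF perm, symmetric, unfolded comp_def])
    also have "\<dots> = (\<Prod>b\<in>Basis. (u - l) \<bullet> b)"
      unfolding prod_Basis_cart by (simp add: inner_axis)
    finally show "emeasure (distr lborel borel (\<lambda>x. ?A *v x)) (box l u) = ennreal (\<Prod>b\<in>Basis. (u - l) \<bullet> b)" .
  qed simp
  then show ?case unfolding det by (simp add: density_1)
next
  case (5 m n c)
  note mn = 5(1)
  let ?A = "(\<chi> i j. if i = m \<and> j = n then c else of_bool (i = j)) :: real^'n^'n"
  have "?A = (\<chi> k. if k = m then row m (mat 1) + c *s row n (mat 1) else row k (mat 1))"
    using mn by (auto simp: vec_eq_iff row_def mat_def)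
  then have det: "det ?A = 1"
    using det_row_operation[OF mn, of "mat 1 :: real^'n^'n" c] by simp
  have Ax: "?A *v x = (\<chi> i. if i = m then x $ m + c * x $ n else x $ i)" for x
  proof -
    have "(?A *v x) $ i = (if i = m then x $ m + c * x $ n else x $ i)" for i
    proof -
      have "(?A *v x) $ i = (\<Sum>j\<in>UNIV. (if j = i then x $ i else 0) + (if i = m \<and> j = n then c * x $ n else 0))"
        unfolding matrix_vector_mult_def vec_lambda_beta
        by (rule sum.cong) (use mn in auto)
      then show ?thesis by (simp add: sum.distrib)
    qed
    then show ?thesis by (simp add: vec_eq_iff)
  qed
  have m: "(\<lambda>x. ?A *v x) \<in> borel_measurable borel"
    by (rule borel_measurable_matrix_vector_mult) simp
  have "distr lborel borel (\<lambda>x. ?A *v x) = lborel"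
  proof (rule measure_eqI)
    fix S assume "S \<in> sets (distr lborel borel (\<lambda>x. ?A *v x))"
    then have S: "S \<in> sets borel" by simp
    have "emeasure (distr lborel borel (\<lambda>x. ?A *v x)) S =
      (\<integral>\<^sup>+y. indicator S y \<partial>distr lborel borel (\<lambda>x. ?A *v x))"
      using S by (intro nn_integral_indicator[symmetric]) simp
    also have "\<dots> = (\<integral>\<^sup>+x. indicator S (?A *v x) \<partial>lborel)"
      using S m by (intro nn_integral_distr) simp_all
    also have "\<dots> = (\<integral>\<^sup>+x. indicator S x \<partial>lborel)"
      unfolding Ax using S by (intro nn_integral_lborel_shear mn) auto
    finally show "emeasure (distr lborel borel (\<lambda>x. ?A *v x)) S = emeasure lborel S" using S by simp
  qed simp
  then show ?case unfolding det by (simp add: density_1)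
qed

lemma lborel_linear_image:
  fixes A :: "real^'n^'n"
  assumes A: "invertible A"
  shows "distr lborel borel (\<lambda>x. A *v x + c) = density lborel (\<lambda>_. ennreal (1 / \<bar>det A\<bar>))"
proof -
  have lin: "distr lborel borel (\<lambda>x. A *v x) = density lborel (\<lambda>_. ennreal (1 / \<bar>det A\<bar>))"
    using A by (intro distr_lborel_matrix) (simp add: invertible_det_nz)
  have m: "(\<lambda>x. A *v x) \<in> borel_measurable borel"
    by (rule borel_measurable_matrix_vector_mult) simp
  have "distr lborel borel (\<lambda>x. A *v x + c) = distr (distr lborel borel (\<lambda>x. A *v x)) borel ((+) c)"
    using m by (subst distr_distr) (auto simp: comp_def add.commute)
  also have "\<dots> = distr (density lborel (\<lambda>_. ennreal (1 / \<bar>det A\<bar>))) borel ((+) c)"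
    unfolding lin ..
  also have "\<dots> = density (distr lborel borel ((+) c)) (\<lambda>_. ennreal (1 / \<bar>det A\<bar>))"
    by (rule density_distr[symmetric]) auto
  finally show ?thesis by (simp add: lborel_distr_plus)
qed

text \<open>The density is taken with respect to the Gaussian itself rather than Lebesgue measure.
  The normalising constants cancel, and its logarithm is a difference of two squared norms minus ln
  |det A|.\<close>

lemma distr_gauss_affine:
  fixes A :: "real^'l^'l"
  assumes A: "invertible A" and h: "0 < h"
  shows "distr (gauss h) borel (\<lambda>b. A *v b + c) =
    density (gauss h) (\<lambda>y. ennreal (exp (((norm y)\<^sup>2 - (norm (matrix_inv A *v (y - c)))\<^sup>2) / (2 * h)) / \<bar>det A\<bar>))"
proof -
  let ?S = "\<lambda>y. matrix_inv A *v (y - c)"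
  have mv: "(\<lambda>x. D *v f x) \<in> borel_measurable borel" if "f \<in> borel_measurable borel" for D :: "real^'l^'l" and f :: "real^'l \<Rightarrow> real^'l"
    by (rule measurable_compose[OF that])
       (intro borel_measurable_continuous_onI linear_continuous_on matrix_vector_mul_bounded_linear)
  have S[measurable]: "?S \<in> borel_measurable borel" by (intro mv) simp
  have T[measurable]: "(\<lambda>b. A *v b + c) \<in> borel_measurable borel" by (intro borel_measurable_add mv) auto
  have ST: "?S (A *v b + c) = b" for b using A by (simp add: matrix_vector_mul_assoc matrix_inv_mult)
  have "distr (gauss h) borel (\<lambda>b. A *v b + c) = distr (density lborel (\<lambda>b. ennreal (gauss_density h (?S (A *v b + c))))) borel (\<lambda>b. A *v b + c)"
    unfolding gauss_def ST ..
  also have "\<dots> = density (distr lborel borel (\<lambda>b. A *v b + c)) (\<lambda>y. ennreal (gauss_density h (?S y)))"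
    by (rule density_distr[symmetric]) measurable
  also have "\<dots> = density lborel (\<lambda>y. ennreal (1 / \<bar>det A\<bar>) * ennreal (gauss_density h (?S y)))"
    unfolding lborel_linear_image[OF A] by (rule density_density_eq) measurable
  also have "\<dots> = density lborel (\<lambda>y. ennreal (gauss_density h y) *
      ennreal (exp (((norm y)\<^sup>2 - (norm (?S y))\<^sup>2) / (2 * h)) / \<bar>det A\<bar>))"
  proof (intro density_cong AE_I2)
    fix y
    have "ennreal (1 / \<bar>det A\<bar>) * ennreal (gauss_density h (?S y)) = ennreal (1 / \<bar>det A\<bar> * gauss_density h (?S y))"
      using gauss_density_pos[OF h, of "?S y"] by (intro ennreal_mult[symmetric]) simp_all
    also have "1 / \<bar>det A\<bar> * gauss_density h (?S y) = gauss_density h y * (exp (((norm y)\<^sup>2 - (norm (?S y))\<^sup>2) / (2 * h)) / \<bar>det A\<bar>)"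
      by (subst gauss_density_ratio[OF h, of "?S y" y]) simp
    finally show "ennreal (1 / \<bar>det A\<bar>) * ennreal (gauss_density h (?S y)) = ennreal (gauss_density h y) *
      ennreal (exp (((norm y)\<^sup>2 - (norm (?S y))\<^sup>2) / (2 * h)) / \<bar>det A\<bar>)"
      using gauss_density_pos[OF h, of y] ennreal_mult[of "gauss_density h y" "exp (((norm y)\<^sup>2 - (norm (?S y))\<^sup>2) / (2 * h)) / \<bar>det A\<bar>"]
      by simp
  qed measurable
  also have "\<dots> = density (gauss h) (\<lambda>y. ennreal (exp (((norm y)\<^sup>2 - (norm (?S y))\<^sup>2) / (2 * h)) / \<bar>det A\<bar>))"
    unfolding gauss_def by (rule density_density_eq[symmetric]) measurable
  finally show ?thesis .
qed

section \<open>Finite-dimensional distributions\<close>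

lemma (in filtered_prob_space) brownian_increment_law:
  fixes B :: "real \<Rightarrow> 'a \<Rightarrow> real^'l"
  assumes B: "standard_brownian_motion P F B" and st: "0 \<le> s" "s < t" "t \<le> 1"
  shows "distr P borel (\<lambda>w. B t w - B s w) = gauss (t - s)"
  by (rule distr_indep_normal_vec) (use B st in \<open>auto simp: standard_brownian_motion_def\<close>)

text \<open>Brownian motion is defined by independence of each increment from the past. Peeling off
  the last increment repeatedly turns this into joint independence. The map S is built in so that
  affine images of the increments are covered directly.\<close>

lemma (in filtered_prob_space) distr_brownian_increments:
  fixes B :: "real \<Rightarrow> 'a \<Rightarrow> real^'l" and S :: "real^'l \<Rightarrow> real^'l" and N :: nat
  assumes B: "standard_brownian_motion P F B" and N: "0 < N" and S: "S \<in> borel_measurable borel"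
  defines "\<Delta> \<equiv> \<lambda>k w. B (real (Suc k) / real N) w - B (real k / real N) w"
  shows "distr P (PiM {..<N} (\<lambda>_. borel)) (\<lambda>w. \<lambda>k\<in>{..<N}. S (\<Delta> k w)) =
    PiM {..<N} (\<lambda>_. distr (gauss (1 / real N)) borel S)"
proof -
  define r where "r k = real k / real N" for k
  have r: "0 \<le> r k" "r k < r (Suc k)" for k
    using N by (auto simp: r_def divide_strict_right_mono)
  have r1: "r (Suc k) \<le> 1" if "k < N" for k using that N by (simp add: r_def)
  have rd: "r (Suc k) - r k = 1 / real N" for k
    unfolding r_def diff_divide_distrib[symmetric] by simp
  have \<Delta>F: "\<Delta> k \<in> borel_measurable (F (r (Suc k)))" if "k < N" for k
    unfolding \<Delta>_def r_def[symmetric] by (rule brownian_increment_measurable[OF B r r1[OF that]])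
  have law: "distr P borel (\<Delta> k) = gauss (1 / real N)" if "k < N" for k
    unfolding \<Delta>_def r_def[symmetric] brownian_increment_law[OF B r r1[OF that]] rd ..
  have SF: "(\<lambda>w. S (\<Delta> k w)) \<in> borel_measurable (F (r (Suc k)))" if "k < N" for k
    using measurable_compose[OF \<Delta>F[OF that] S] .
  have SP: "(\<lambda>w. S (\<Delta> k w)) \<in> borel_measurable P" if "k < N" for k
    using measurable_F_P[OF SF[OF that]] .
  have SD: "distr P borel (\<lambda>w. S (\<Delta> k w)) = distr (gauss (1 / real N)) borel S" if "k < N" for k
    unfolding law[OF that, symmetric]
    using distr_distr[OF S measurable_F_P[OF \<Delta>F[OF that]]] by (simp add: comp_def)
  let ?D = "distr (gauss (1 / real N)) borel S"
  have "prob_space ?D" unfolding SD[OF N, symmetric] by (rule prob_space_distr[OF SP[OF N]])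
  then interpret D: prob_space ?D .
  interpret product_sigma_finite "\<lambda>_::nat. ?D"
    by (rule product_sigma_finite.intro) (rule D.sigma_finite_measure_axioms)
  have m: "(\<lambda>w. \<lambda>k\<in>{..<N}. S (\<Delta> k w)) \<in> measurable P (PiM {..<N} (\<lambda>_. borel))"
    by (rule measurable_restrict) (use SP in auto)
  show ?thesis
  proof (rule PiM_eqI)
    show "sets (distr P (PiM {..<N} (\<lambda>_. borel)) (\<lambda>w. \<lambda>k\<in>{..<N}. S (\<Delta> k w))) = sets (PiM {..<N} (\<lambda>_. ?D))"
      by (simp cong: sets_PiM_cong)
    fix A :: "nat \<Rightarrow> (real^'l) set" assume "\<And>k. k \<in> {..<N} \<Longrightarrow> A k \<in> sets ?D"
    then have A: "A k \<in> sets borel" if "k < N" for k using that by simp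
    \<comment> \<open>An event about the first n increments belongs to the past at time
      \<open>r n\<close>, so the next increment is independent of it.\<close>
    define E where "E n = {w\<in>space P. \<forall>k<n. S (\<Delta> k w) \<in> A k}" for n
    have E: "E n \<in> sets (F (r n)) \<and> prob (E n) = (\<Prod>k<n. measure ?D (A k))" if "n \<le> N" for n
      using that
    proof (induction n)
      case 0
      have "E 0 = space P" by (simp add: E_def)
      then show ?case using sets.top[of "F (r 0)"] by (simp add: prob_space space_F)
    next
      case (Suc n)
      then have n: "n < N" and IH: "E n \<in> sets (F (r n))" "prob (E n) = (\<Prod>k<n. measure ?D (A k))" by auto
      let ?X = "(\<lambda>w. S (\<Delta> n w)) -` A n \<inter> space P"
      have eq: "E (Suc n) = E n \<inter> ?X" by (auto simp: E_def less_Suc_eq)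
      have XF: "?X \<in> sets (F (r (Suc n)))" using measurable_sets[OF SF[OF n] A[OF n]] by (simp add: space_F)
      have "(\<lambda>w. S (\<Delta> n w)) \<in> borel_measurable (vimage_algebra (space P) (\<Delta> n) borel)"
        by (rule measurable_compose[OF measurable_vimage_algebra1 S]) simp
      from measurable_sets[OF this A[OF n]] have "?X \<in> sets (vimage_algebra (space P) (\<Delta> n) borel)"
        by simp
      moreover have "indep_set (sets (F (r n))) (sets (vimage_algebra (space P) (\<Delta> n) borel))"
        using B r[of n] r1[OF n] unfolding standard_brownian_motion_def \<Delta>_def r_def[symmetric] by blast
      ultimately have "prob (E n \<inter> ?X) = prob (E n) * prob ?X"
        using IH(1) unfolding indep_sets2_eq by blast
      also have "prob ?X = measure ?D (A n)"
        unfolding SD[OF n, symmetric] by (rule measure_distr[OF SP[OF n] A[OF n], symmetric])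
      finally have "prob (E (Suc n)) = (\<Prod>k<Suc n. measure ?D (A k))"
        unfolding eq IH(2) by simp
      moreover have "E (Suc n) \<in> sets (F (r (Suc n)))"
        unfolding eq by (rule sets.Int[OF subsetD[OF sets_F_mono[OF less_imp_le[OF r(2)]] IH(1)] XF])
      ultimately show ?case by blast
    qed
    have box: "Pi\<^sub>E {..<N} A \<in> sets (PiM {..<N} (\<lambda>_. borel))"
      using A by (intro sets_PiM_I_finite) auto
    have "emeasure (distr P (PiM {..<N} (\<lambda>_. borel)) (\<lambda>w. \<lambda>k\<in>{..<N}. S (\<Delta> k w))) (Pi\<^sub>E {..<N} A) =
      emeasure P ((\<lambda>w. \<lambda>k\<in>{..<N}. S (\<Delta> k w)) -` (Pi\<^sub>E {..<N} A) \<inter> space P)"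
      by (rule emeasure_distr[OF m box])
    also have "(\<lambda>w. \<lambda>k\<in>{..<N}. S (\<Delta> k w)) -` (Pi\<^sub>E {..<N} A) \<inter> space P = E N"
      unfolding E_def by (rule set_eqI) (simp add: PiE_iff Ball_def conj_commute)
    also have "emeasure P (E N) = (\<Prod>k<N. emeasure ?D (A k))"
      unfolding emeasure_eq_measure D.emeasure_eq_measure using conjunct2[OF E[OF order_refl]]
      by (simp only: prod_ennreal[OF measure_nonneg])
    finally show "emeasure (distr P (PiM {..<N} (\<lambda>_. borel)) (\<lambda>w. \<lambda>k\<in>{..<N}. S (\<Delta> k w))) (Pi\<^sub>E {..<N} A) =
      (\<Prod>k\<in>{..<N}. emeasure ?D (A k))" .
  qed simp
qed

text \<open>The log density of a step is quadratic, so these moments are all that the entropy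
  requires. The sum of squared row norms is the squared Frobenius norm of D; the terms linear in the
  increment have mean 0.\<close>

lemma (in filtered_prob_space) brownian_increment_quadratic:
  fixes B :: "real \<Rightarrow> 'a \<Rightarrow> real^'l" and D :: "real^'l^'l" and c :: "real^'l"
  assumes B: "standard_brownian_motion P F B" and st: "0 \<le> s" "s < t" "t \<le> 1"
  shows "integrable P (\<lambda>w. (norm (D *v (B t w - B s w) + c))\<^sup>2)"
    "expectation (\<lambda>w. (norm (D *v (B t w - B s w) + c))\<^sup>2) = (t - s) * (\<Sum>i\<in>UNIV. (norm (D $ i))\<^sup>2) + (norm c)\<^sup>2"
proof -
  define X where "X i w = D $ i \<bullet> B t w - D $ i \<bullet> B s w" for i w
  have X: "integrable P (\<lambda>w. (X i w)\<^sup>2) \<and> integrable P (X i) \<and> expectation (X i) = 0 \<and>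
    expectation (\<lambda>w. (X i w)\<^sup>2) = (norm (D $ i))\<^sup>2 * (t - s)" for i
  proof -
    interpret W: scaled_brownian P F "\<lambda>t w. D $ i \<bullet> B t w" "(norm (D $ i))\<^sup>2"
      by (rule brownian_inner_scaled_brownian[OF B])
    have m: "X i \<in> borel_measurable P"
      unfolding X_def[abs_def] using st by (intro borel_measurable_diff W.W_measurable) auto
    have i2: "integrable P (\<lambda>w. (X i w)\<^sup>2)" unfolding X_def by (rule W.W_integrable[OF st])
    have "integrable P (X i)"
      using integrable_mult_L2[OF m borel_measurable_const[of 1] i2] by simp
    then show ?thesis using i2 W.W_mean[OF st] W.W_variance[OF st] by (simp add: X_def[abs_def])
  qed
  have eq: "(norm (D *v (B t w - B s w) + c))\<^sup>2 = (\<Sum>i\<in>UNIV. (X i w)\<^sup>2 + 2 * c $ i * X i w + (c $ i)\<^sup>2)" for w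
  proof -
    have "(D *v b) $ i = D $ i \<bullet> b" for b i by (simp add: matrix_vector_mult_def inner_vec_def)
    then have "(D *v (B t w - B s w) + c) $ i = X i w + c $ i" for i
      by (simp add: X_def inner_diff_right)
    then show ?thesis
      unfolding power2_norm_eq_inner inner_vec_def by (simp add: power2_eq_square algebra_simps)
  qed
  show "integrable P (\<lambda>w. (norm (D *v (B t w - B s w) + c))\<^sup>2)"
    unfolding eq using X by (intro Bochner_Integration.integrable_sum Bochner_Integration.integrable_add) auto
  have "expectation (\<lambda>w. (norm (D *v (B t w - B s w) + c))\<^sup>2) =
    (\<Sum>i\<in>UNIV. expectation (\<lambda>w. (X i w)\<^sup>2 + 2 * c $ i * X i w + (c $ i)\<^sup>2))"
    unfolding eq using X by (intro Bochner_Integration.integral_sum Bochner_Integration.integrable_add) auto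
  also have "\<dots> = (\<Sum>i\<in>UNIV. (norm (D $ i))\<^sup>2 * (t - s) + (c $ i)\<^sup>2)"
    using X by (intro sum.cong) (auto simp: prob_space)
  also have "\<dots> = (t - s) * (\<Sum>i\<in>UNIV. (norm (D $ i))\<^sup>2) + (norm c)\<^sup>2"
    unfolding power2_norm_eq_inner[of c] inner_vec_def[of c]
    by (simp add: sum.distrib sum_distrib_left mult.commute power2_eq_square[of "c $ _"])
  finally show "expectation (\<lambda>w. (norm (D *v (B t w - B s w) + c))\<^sup>2) =
    (t - s) * (\<Sum>i\<in>UNIV. (norm (D $ i))\<^sup>2) + (norm c)\<^sup>2" .
qed

section \<open>The grid sigma-algebra\<close>

lemma space_path_sigma [simp]: "space (path_sigma T) = path_space"
  unfolding path_sigma_def by (rule space_measure_of) auto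

lemma measurable_path_sigma_coordinate:
  assumes "t \<in> T"
  shows "(\<lambda>w. w t) \<in> measurable (path_sigma T :: (real \<Rightarrow> 'b::topological_space) measure) borel"
proof (rule measurableI)
  fix A :: "'b set" assume "A \<in> sets borel"
  then have "{w \<in> path_space. w t \<in> A} \<in> {{w \<in> path_space. w t \<in> A} | t A. t \<in> T \<and> A \<in> sets borel}"
    using assms by blast
  moreover have "(\<lambda>w. w t) -` A \<inter> space (path_sigma T) = {w \<in> path_space. w t \<in> A}" by auto
  ultimately show "(\<lambda>w. w t) -` A \<inter> space (path_sigma T) \<in> sets (path_sigma T)"
    unfolding path_sigma_def by (subst sets_measure_of) (auto intro: sigma_sets.Basic)
qed simp

lemma measurable_into_path_sigma:
  fixes f :: "'a \<Rightarrow> real \<Rightarrow> 'b::topological_space"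
  assumes "\<And>w. w \<in> space M \<Longrightarrow> f w \<in> path_space" "\<And>t. t \<in> T \<Longrightarrow> (\<lambda>w. f w t) \<in> borel_measurable M"
  shows "f \<in> measurable M (path_sigma T)"
  unfolding path_sigma_def
proof (rule measurable_measure_of)
  fix Y :: "(real \<Rightarrow> 'b) set"
  assume "Y \<in> {{w \<in> path_space. w t \<in> A} | t A. t \<in> T \<and> A \<in> sets borel}"
  then obtain t A where Y: "Y = {w \<in> path_space. w t \<in> A}" "t \<in> T" "A \<in> sets borel" by blast
  have "f -` Y \<inter> space M = (\<lambda>w. f w t) -` A \<inter> space M" using assms(1) Y by auto
  then show "f -` Y \<inter> space M \<in> sets M" using measurable_sets[OF assms(2)[OF Y(2)] Y(3)] by simp
qed (use assms(1) in auto)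

text \<open>The path is kept on all of [0, 1], not only at grid times: this is the map whose law is
  \<open>path_law\<close>, on which the grid sigma-algebra then acts by restriction.\<close>

definition grid_path :: "(real \<Rightarrow> 'a \<Rightarrow> 'b::topological_space) \<Rightarrow> 'a \<Rightarrow> real \<Rightarrow> 'b" where
  "grid_path M w = (\<lambda>t\<in>{0..1}. M t w)"

definition log_return :: "nat \<Rightarrow> nat \<Rightarrow> (real \<Rightarrow> real^'l) \<Rightarrow> real^'l" where
  "log_return N k w = (\<chi> i. ln (w (real (Suc k) / real N) $ i / w (real k / real N) $ i))"

text \<open>The diagonal of \<Gamma> times its transpose, that is, the rate of quadratic variation
  of the log coordinates. Half of it per unit of time is the Ito correction in the log
  returns.\<close>

definition row_norms :: "real^'l^'l \<Rightarrow> real^'l" where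
  "row_norms \<Gamma> = (\<chi> i. (norm (\<Gamma> $ i))\<^sup>2)"

text \<open>The Brownian increment that produces the \<open>k\<close>-th logarithmic return in the model with
  parameter \<open>\<Gamma>\<close>.\<close>

definition noise :: "real^'l^'l \<Rightarrow> nat \<Rightarrow> nat \<Rightarrow> (real \<Rightarrow> real^'l) \<Rightarrow> real^'l" where
  "noise \<Gamma> N k w = matrix_inv \<Gamma> *v (log_return N k w + (1 / (2 * real N)) *\<^sub>R row_norms \<Gamma>)"

abbreviation noises :: "real^'l^'l \<Rightarrow> nat \<Rightarrow> (real \<Rightarrow> real^'l) \<Rightarrow> nat \<Rightarrow> real^'l" where
  "noises \<Gamma> N w \<equiv> \<lambda>k\<in>{..<N}. noise \<Gamma> N k w"

text \<open>The condition under which \<open>exp\<close> undoes the logarithm in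
  \<open>log_return\<close>. Only quotients are required to be positive, so coordinates may be
  negative throughout.\<close>

definition regular_path :: "real^'l \<Rightarrow> nat \<Rightarrow> (real \<Rightarrow> real^'l) \<Rightarrow> bool" where
  "regular_path x N w \<longleftrightarrow> w 0 = x \<and>
    (\<forall>k<N. \<forall>i. 0 < w (real (Suc k) / real N) $ i / w (real k / real N) $ i)"

text \<open>The explicit solution at the grid times, as a function of the increments. It inverts the
  decoding by \<open>noise\<close> on regular paths, so the noises carry all the information of the
  grid.\<close>

definition rebuild :: "real^'l^'l \<Rightarrow> real^'l \<Rightarrow> nat \<Rightarrow> (nat \<Rightarrow> real^'l) \<Rightarrow> nat \<Rightarrow> real^'l" where
  "rebuild \<Gamma> x N b = (\<lambda>k\<in>{..N}. \<chi> i. x $ i *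
     exp (\<Sum>j<k. (\<Gamma> *v b j) $ i - (norm (\<Gamma> $ i))\<^sup>2 / (2 * real N)))"

lemma rebuild_noise:
  assumes \<Gamma>: "invertible \<Gamma>" and x: "\<And>i. x $ i \<noteq> 0" and N: "0 < N" and reg: "regular_path x N w"
  shows "rebuild \<Gamma> x N (noises \<Gamma> N w) = (\<lambda>k\<in>{..N}. w (real k / real N))"
proof (rule ext)
  fix k
  have noise: "(\<Gamma> *v noise \<Gamma> N j w) $ i - (norm (\<Gamma> $ i))\<^sup>2 / (2 * real N) = log_return N j w $ i" for j i
    using matrix_inv_mult[OF \<Gamma>] by (simp add: noise_def matrix_vector_mul_assoc row_norms_def)
  have *: "w (real k / real N) $ i = x $ i * exp (\<Sum>j<k. log_return N j w $ i)" if "k \<le> N" for k i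
    using that
  proof (induction k)
    case 0
    then show ?case using reg by (simp add: regular_path_def)
  next
    case (Suc k)
    have "0 < w (real (Suc k) / real N) $ i / w (real k / real N) $ i"
      using reg Suc.prems by (simp add: regular_path_def)
    \<comment> \<open>Division by 0 gives 0, so a positive quotient also shows that its denominator
      is not 0.\<close>
    then have "exp (log_return N k w $ i) = w (real (Suc k) / real N) $ i / w (real k / real N) $ i"
      "w (real k / real N) $ i \<noteq> 0"
      unfolding log_return_def by (auto simp: exp_ln)
    then have "w (real (Suc k) / real N) $ i = w (real k / real N) $ i * exp (log_return N k w $ i)"
      by simp
    then show ?case using Suc by (simp add: exp_add)
  qed
  show "rebuild \<Gamma> x N (noises \<Gamma> N w) k = (\<lambda>k\<in>{..N}. w (real k / real N)) k"
  proof (cases "k \<le> N")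
    case True
    then have "(\<Sum>j<k. (\<Gamma> *v (noises \<Gamma> N w) j) $ i - (norm (\<Gamma> $ i))\<^sup>2 / (2 * real N)) =
      (\<Sum>j<k. log_return N j w $ i)" for i
      by (intro sum.cong) (auto simp: noise[symmetric])
    then show ?thesis using True *[OF True] by (simp add: rebuild_def vec_eq_iff)
  qed (simp add: rebuild_def)
qed

lemma measurable_rebuild:
  "rebuild \<Gamma> x N \<in> measurable (PiM {..<N} (\<lambda>_. borel)) (PiM {..N} (\<lambda>_. borel))"
  unfolding rebuild_def[abs_def]
proof (rule measurable_restrict, rule borel_measurable_vec_lambda)
  fix k i assume k: "k \<in> {..N}"
  have "(\<lambda>b. (\<Gamma> *v b j) $ i) \<in> borel_measurable (PiM {..<N} (\<lambda>_. borel))" if "j \<in> {..<k}" for j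
    using k that by (intro borel_measurable_nth borel_measurable_matrix_vector_mult measurable_component_singleton) auto
  then show "(\<lambda>b. x $ i * exp (\<Sum>j<k. (\<Gamma> *v b j) $ i - (norm (\<Gamma> $ i))\<^sup>2 / (2 * real N)))
    \<in> borel_measurable (PiM {..<N} (\<lambda>_. borel))"
    by (intro borel_measurable_times borel_measurable_const borel_measurable_sum borel_measurable_diff
        measurable_compose[OF _ borel_measurable_exp])
qed

lemma grid_sigma_cylinder:
  fixes A :: "(real \<Rightarrow> 'b::topological_space) set"
  assumes "A \<in> sets (grid_sigma N)"
  obtains C where "C \<in> sets (PiM {..N} (\<lambda>_. borel))"
    "A = {w\<in>path_space. (\<lambda>k\<in>{..N}. w (real k / real N)) \<in> C}"
proof -
  let ?f = "\<lambda>w::real \<Rightarrow> 'b. \<lambda>k\<in>{..N}. w (real k / real N)" and ?M = "PiM {..N} (\<lambda>_. borel :: 'b measure)"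
  have f: "?f \<in> path_space \<rightarrow> space ?M" by (auto simp: space_PiM)
  let ?V = "vimage_algebra path_space ?f ?M"
  have "sets (grid_sigma N) \<subseteq> sets ?V"
    unfolding grid_sigma_def path_sigma_def
  proof (subst sets_measure_of)
    show "sigma_sets path_space {{w \<in> path_space. w t \<in> A} | t A. t \<in> (\<lambda>k. real k / real N) ` {0..N} \<and> A \<in> sets borel} \<subseteq> sets ?V"
    proof (rule sets.sigma_sets_subset[of _ ?V, simplified])
      show "{{w \<in> path_space. w t \<in> A} | t A. t \<in> (\<lambda>k. real k / real N) ` {0..N} \<and> A \<in> sets borel} \<subseteq> sets ?V"
      proof safe
        fix k and A :: "'b set" assume k: "k \<in> {0..N}" and A: "A \<in> sets borel"
        have "(\<lambda>b. b k) -` A \<inter> space ?M \<in> sets ?M"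
          using k A by (intro measurable_sets[OF measurable_component_singleton]) auto
        moreover have "{w \<in> path_space. w (real k / real N) \<in> A} = ?f -` ((\<lambda>b. b k) -` A \<inter> space ?M) \<inter> path_space"
          using k f by auto
        ultimately show "{w \<in> path_space. w (real k / real N) \<in> A} \<in> sets ?V"
          unfolding sets_vimage_algebra2[OF f] by blast
      qed
    qed
  qed auto
  with assms have "A \<in> {?f -` C \<inter> path_space | C. C \<in> sets ?M}"
    unfolding sets_vimage_algebra2[OF f] by blast
  then obtain C where "C \<in> sets ?M" "A = ?f -` C \<inter> path_space" by blast
  then show thesis using that[of C] by auto
qed

text \<open>Up to regularity of the path, an event of the grid is an event of the noise; this
  transfers relative entropy from path space to Gaussian product measures.\<close>

lemma grid_sigma_noise_event:
  fixes A :: "(real \<Rightarrow> real^'l) set"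
  assumes A: "A \<in> sets (grid_sigma N)" and \<Gamma>: "invertible \<Gamma>" and x: "\<And>i. x $ i \<noteq> 0" and N: "0 < N"
  obtains C where "C \<in> sets (PiM {..<N} (\<lambda>_. borel))"
    "\<And>w. w \<in> path_space \<Longrightarrow> regular_path x N w \<Longrightarrow> w \<in> A \<longleftrightarrow> (noises \<Gamma> N w) \<in> C"
proof -
  from A obtain C where C: "C \<in> sets (PiM {..N} (\<lambda>_. borel))"
    "A = {w\<in>path_space. (\<lambda>k\<in>{..N}. w (real k / real N)) \<in> C}"
    by (rule grid_sigma_cylinder)
  let ?C = "rebuild \<Gamma> x N -` C \<inter> space (PiM {..<N} (\<lambda>_. borel))"
  have "?C \<in> sets (PiM {..<N} (\<lambda>_. borel))" using measurable_sets[OF measurable_rebuild C(1)] .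
  moreover have "w \<in> A \<longleftrightarrow> (noises \<Gamma> N w) \<in> ?C"
    if "w \<in> path_space" "regular_path x N w" for w
  proof -
    have "(noises \<Gamma> N w) \<in> space (PiM {..<N} (\<lambda>_. borel))" by (simp add: space_PiM)
    then show ?thesis using that(1) rebuild_noise[OF \<Gamma> x N that(2)] unfolding C(2) by simp
  qed
  ultimately show thesis by (rule that)
qed

section \<open>The law of the decoded noise under one model\<close>

lemma grid_time: "0 < N \<Longrightarrow> k \<le> N \<Longrightarrow> real k / real N \<in> {0..1}"
  by simp

lemma noise_measurable:
  assumes "k < N"
  shows "noise \<Gamma> N k \<in> borel_measurable (grid_sigma N)"
proof -
  have c: "(\<lambda>w. w (real k / real N)) \<in> borel_measurable (grid_sigma N)" if "k \<le> N" for k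
    unfolding grid_sigma_def using that by (intro measurable_path_sigma_coordinate) auto
  have "log_return N k \<in> borel_measurable (grid_sigma N)"
    unfolding log_return_def[abs_def] using assms
    by (intro borel_measurable_vec_lambda borel_measurable_ln borel_measurable_divide borel_measurable_nth c) auto
  then show ?thesis
    unfolding noise_def[abs_def]
    by (intro borel_measurable_matrix_vector_mult borel_measurable_add borel_measurable_const)
qed

text \<open>A coordinate started at 0 remains there, and its returns would reveal nothing of the
  noise; hence the condition on \<open>x\<close>.\<close>

locale black_scholes = filtered_prob_space P F
  for P :: "'a measure" and F +
  fixes B :: "real \<Rightarrow> 'a \<Rightarrow> real^'l" and \<Gamma> x M
  assumes model: "black_scholes_model P F B \<Gamma> x M"
    and x: "\<And>i. x $ i \<noteq> 0"
begin

lemma brownian: "standard_brownian_motion P F B"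
  using model by (simp add: black_scholes_model_def)

lemma grid_path_measurable: "grid_path M \<in> measurable P (path_sigma {0..1})"
proof (rule measurable_into_path_sigma)
  fix w assume "w \<in> space P"
  then have "continuous_on {0..1} (\<lambda>t. M t w)"
    using model by (simp add: black_scholes_model_def continuous_paths_def)
  then have "continuous_on {0..1} (grid_path M w)"
    by (rule continuous_on_eq) (simp add: grid_path_def)
  then show "grid_path M w \<in> path_space" by (simp add: path_space_def grid_path_def)
next
  fix t :: real assume t: "t \<in> {0..1}"
  then have "M t \<in> borel_measurable (F t)"
    using model by (simp add: black_scholes_model_def adapted_def)
  then show "(\<lambda>w. grid_path M w t) \<in> borel_measurable P"
    using t measurable_F_P by (simp add: grid_path_def)
qed

lemma grid_path_in: "w \<in> space P \<Longrightarrow> grid_path M w \<in> path_space"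
  using measurable_space[OF grid_path_measurable] by simp

lemma path_law_eq: "path_law P M = distr P (path_sigma {0..1}) (grid_path M)"
  by (simp add: path_law_def grid_path_def[abs_def])

lemma subalgebra_grid: "0 < N \<Longrightarrow> subalgebra (path_law P M) (grid_sigma N)"
  unfolding subalgebra_def path_law_def grid_sigma_def
proof
  assume N: "0 < N"
  show "sets (path_sigma ((\<lambda>k. real k / real N) ` {0..N})) \<subseteq>
    sets (distr P (path_sigma {0..1}) (\<lambda>w. \<lambda>t\<in>{0..1}. M t w))"
  proof (simp add: path_sigma_def, subst (1 2) sets_measure_of)
    show "sigma_sets path_space {{w \<in> path_space. w t \<in> A} |t A. t \<in> (\<lambda>k. real k / real N) ` {0..N} \<and> A \<in> sets borel}
      \<subseteq> sigma_sets path_space {{w \<in> path_space. w t \<in> A} |t A. 0 \<le> t \<and> t \<le> 1 \<and> A \<in> sets borel}"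
      using grid_time[OF N] by (intro sigma_sets_mono') fastforce
  qed auto
qed simp

abbreviation \<Delta> :: "nat \<Rightarrow> nat \<Rightarrow> 'a \<Rightarrow> real^'l" where
  "\<Delta> N k w \<equiv> B (real (Suc k) / real N) w - B (real k / real N) w"

lemma AE_grid:
  assumes N: "0 < N"
  shows "AE w in P. regular_path x N (grid_path M w) \<and>
    (\<forall>k<N. log_return N k (grid_path M w) = \<Gamma> *v \<Delta> N k w - (1 / (2 * real N)) *\<^sub>R row_norms \<Gamma>)"
proof -
  \<comment> \<open>The exceptional null set of the explicit solution depends on time and
    coordinate; the grid involves finitely many of both.\<close>
  have "AE w in P. \<forall>k\<in>{..N}. \<forall>i\<in>UNIV. M (real k / real N) w $ i =
    x $ i * exp (\<Gamma> $ i \<bullet> B (real k / real N) w - (norm (\<Gamma> $ i))\<^sup>2 * (real k / real N) / 2)"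
    using N by (intro AE_finite_allI black_scholes_solution[OF model] grid_time) auto
  moreover have "AE w in P. M 0 w = x"
    using model by (simp add: black_scholes_model_def)
  ultimately show ?thesis
  proof eventually_elim
    case (elim w)
    let ?p = "grid_path M w"
    have p: "?p (real k / real N) $ i =
      x $ i * exp (\<Gamma> $ i \<bullet> B (real k / real N) w - (norm (\<Gamma> $ i))\<^sup>2 * (real k / real N) / 2)" if "k \<le> N" for k i
      using elim(1) grid_time[OF N that] that by (simp add: grid_path_def)
    have ratio: "?p (real (Suc k) / real N) $ i / ?p (real k / real N) $ i =
      exp ((\<Gamma> *v \<Delta> N k w) $ i - (norm (\<Gamma> $ i))\<^sup>2 / (2 * real N))" if "k < N" for k i
    proof -
      have "(\<Gamma> *v b) $ i = \<Gamma> $ i \<bullet> b" for b by (simp add: matrix_vector_mult_def inner_vec_def)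
      then have "(\<Gamma> *v \<Delta> N k w) $ i - (norm (\<Gamma> $ i))\<^sup>2 / (2 * real N) =
        (\<Gamma> $ i \<bullet> B (real (Suc k) / real N) w - (norm (\<Gamma> $ i))\<^sup>2 * (real (Suc k) / real N) / 2) -
        (\<Gamma> $ i \<bullet> B (real k / real N) w - (norm (\<Gamma> $ i))\<^sup>2 * (real k / real N) / 2)"
        using N by (simp add: inner_diff_right field_simps)
      then show ?thesis
        using p[of k i] p[of "Suc k" i] that x[of i] by (simp add: exp_diff)
    qed
    show ?case
    proof
      show "regular_path x N ?p"
        unfolding regular_path_def using elim(2) ratio by (simp add: grid_path_def)
      show "\<forall>k<N. log_return N k ?p = \<Gamma> *v \<Delta> N k w - (1 / (2 * real N)) *\<^sub>R row_norms \<Gamma>"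
        unfolding log_return_def by (simp add: ratio vec_eq_iff row_norms_def del: of_nat_Suc)
    qed
  qed
qed

text \<open>The path is driven through \<Gamma> but decoded with another matrix \<Gamma>'. The
  linear part of the result does not depend on the grid, and the mismatch of the two Ito corrections
  leaves a shift of order 1/N.\<close>

lemma AE_noise:
  assumes N: "0 < N" and \<Gamma>': "invertible \<Gamma>'"
  shows "AE w in P. regular_path x N (grid_path M w) \<and>
    (\<forall>k<N. noise \<Gamma>' N k (grid_path M w) = (matrix_inv \<Gamma>' ** \<Gamma>) *v \<Delta> N k w +
      (1 / real N) *\<^sub>R ((1 / 2) *\<^sub>R (matrix_inv \<Gamma>' *v (row_norms \<Gamma>' - row_norms \<Gamma>))))"
  using AE_grid[OF N]
proof eventually_elim
  case (elim w)
  have "noise \<Gamma>' N k (grid_path M w) = (matrix_inv \<Gamma>' ** \<Gamma>) *v \<Delta> N k w +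
      (1 / real N) *\<^sub>R ((1 / 2) *\<^sub>R (matrix_inv \<Gamma>' *v (row_norms \<Gamma>' - row_norms \<Gamma>)))" if "k < N" for k
  proof -
    have "log_return N k (grid_path M w) + (1 / (2 * real N)) *\<^sub>R row_norms \<Gamma>' =
      \<Gamma> *v \<Delta> N k w + (1 / (2 * real N)) *\<^sub>R (row_norms \<Gamma>' - row_norms \<Gamma>)"
      using elim that by (simp add: scaleR_diff_right)
    then show ?thesis
      unfolding noise_def
      by (simp add: matrix_vector_right_distrib matrix_vector_mul_assoc matrix_vector_mult_scaleR mult.commute)
  qed
  then show ?case using elim by blast
qed

lemma increments_measurable: "0 < N \<Longrightarrow> k < N \<Longrightarrow> \<Delta> N k \<in> borel_measurable P"
  using brownian_increment_measurable[OF brownian, of "real k / real N" "real (Suc k) / real N"]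
  by (intro measurable_F_P[of _ "real (Suc k) / real N"]) (simp add: divide_strict_right_mono)

lemma noise_law:
  assumes N: "0 < N" and \<Gamma>': "invertible \<Gamma>'"
  shows "distr P (PiM {..<N} (\<lambda>_. borel)) (\<lambda>w. noises \<Gamma>' N (grid_path M w)) =
    PiM {..<N} (\<lambda>_. distr (gauss (1 / real N)) borel (\<lambda>b. (matrix_inv \<Gamma>' ** \<Gamma>) *v b +
      (1 / real N) *\<^sub>R ((1 / 2) *\<^sub>R (matrix_inv \<Gamma>' *v (row_norms \<Gamma>' - row_norms \<Gamma>)))))"
    and noise_path_measurable: "\<And>k. k < N \<Longrightarrow> (\<lambda>w. noise \<Gamma>' N k (grid_path M w)) \<in> borel_measurable P"
proof -
  let ?S = "\<lambda>b. (matrix_inv \<Gamma>' ** \<Gamma>) *v b +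
      (1 / real N) *\<^sub>R ((1 / 2) *\<^sub>R (matrix_inv \<Gamma>' *v (row_norms \<Gamma>' - row_norms \<Gamma>)))"
  have "grid_path M \<in> measurable P (grid_sigma N)"
    unfolding grid_sigma_def
  proof (rule measurable_into_path_sigma[OF grid_path_in])
    fix t assume "t \<in> (\<lambda>k. real k / real N) ` {0..N}"
    then have "t \<in> {0..1}" using grid_time[OF N] by auto
    then show "(\<lambda>w. grid_path M w t) \<in> borel_measurable P"
      using measurable_compose[OF grid_path_measurable measurable_path_sigma_coordinate] by blast
  qed
  then show nm: "(\<lambda>w. noise \<Gamma>' N k (grid_path M w)) \<in> borel_measurable P" if "k < N" for k
    using noise_measurable[OF that] by (rule measurable_compose)
  have S: "?S \<in> borel_measurable borel"
    by (intro borel_measurable_add borel_measurable_const borel_measurable_matrix_vector_mult) simp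
  have "distr P (PiM {..<N} (\<lambda>_. borel)) (\<lambda>w. noises \<Gamma>' N (grid_path M w)) =
    distr P (PiM {..<N} (\<lambda>_. borel)) (\<lambda>w. \<lambda>k\<in>{..<N}. ?S (\<Delta> N k w))"
  proof (rule distr_cong_AE)
    show "AE w in P. (noises \<Gamma>' N (grid_path M w)) = (\<lambda>k\<in>{..<N}. ?S (\<Delta> N k w))"
      using AE_noise[OF N \<Gamma>'] by eventually_elim (auto simp: restrict_def fun_eq_iff)
    show "(\<lambda>w. noises \<Gamma>' N (grid_path M w)) \<in> measurable P (PiM {..<N} (\<lambda>_. borel))"
      by (rule measurable_restrict) (simp add: nm)
    show "(\<lambda>w. \<lambda>k\<in>{..<N}. ?S (\<Delta> N k w)) \<in> measurable P (PiM {..<N} (\<lambda>_. borel))"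
      by (rule measurable_restrict, rule measurable_compose[OF increments_measurable[OF N] S]) simp
  qed simp_all
  also have "\<dots> = PiM {..<N} (\<lambda>_. distr (gauss (1 / real N)) borel ?S)"
    by (rule distr_brownian_increments[OF brownian N S])
  finally show "distr P (PiM {..<N} (\<lambda>_. borel)) (\<lambda>w. noises \<Gamma>' N (grid_path M w)) =
    PiM {..<N} (\<lambda>_. distr (gauss (1 / real N)) borel ?S)" .
qed

end

section \<open>Relative entropy on the grid\<close>

lemma relative_entropy_density:
  fixes \<phi> :: "'a \<Rightarrow> real"
  assumes M: "sigma_finite_measure M" and \<phi>: "\<phi> \<in> borel_measurable M" and pos: "\<And>x. 0 < \<phi> x"
    and int: "integrable (density M (\<lambda>x. ennreal (\<phi> x))) (\<lambda>x. ln (\<phi> x))"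
  shows "relative_entropy (density M (\<lambda>x. ennreal (\<phi> x))) M =
    ereal (\<integral>x. ln (\<phi> x) \<partial>density M (\<lambda>x. ennreal (\<phi> x)))"
proof -
  interpret sigma_finite_measure M by (rule M)
  let ?D = "density M (\<lambda>x. ennreal (\<phi> x))"
  have \<phi>': "(\<lambda>x. ennreal (\<phi> x)) \<in> borel_measurable M" using \<phi> by measurable
  have "AE x in M. ennreal (\<phi> x) = RN_deriv M ?D x"
    by (rule RN_deriv_unique[OF \<phi>' refl])
  then have "AE x in M. entropy_density (exp 1) M ?D x = ln (\<phi> x)"
  proof eventually_elim
    case (elim x)
    have "enn2real (RN_deriv M ?D x) = \<phi> x" unfolding elim[symmetric] using pos[of x] by simp
    then show ?case by (simp add: entropy_density_def log_def)
  qed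
  then have ae: "AE x in ?D. entropy_density (exp 1) M ?D x = ln (\<phi> x)"
    unfolding AE_density[OF \<phi>'] by eventually_elim simp
  have m: "entropy_density (exp 1) M ?D \<in> borel_measurable ?D" "(\<lambda>x. ln (\<phi> x)) \<in> borel_measurable ?D"
    using measurable_entropy_density[of "exp 1" M ?D] \<phi> by auto
  have "integrable ?D (entropy_density (exp 1) M ?D)"
    by (subst integrable_cong_AE[OF m ae]) (rule int)
  moreover have "KL_divergence (exp 1) M ?D = (\<integral>x. ln (\<phi> x) \<partial>?D)"
    unfolding KL_divergence_def by (rule integral_cong_AE[OF m ae])
  moreover have "absolutely_continuous M ?D" by (rule absolutely_continuousI_density[OF \<phi>'])
  ultimately show ?thesis by (simp add: relative_entropy_def)
qed

text \<open>The affine map of \<open>noise_law\<close> when a path is decoded with its own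
  parameter: the noise is then the Brownian increment itself.\<close>

lemma matrix_inv_cancel:
  fixes \<Gamma> :: "real^'l^'l"
  assumes "invertible \<Gamma>"
  shows "(matrix_inv \<Gamma> ** \<Gamma>) *v b + r *\<^sub>R (s *\<^sub>R (matrix_inv \<Gamma> *v (d - d))) = b"
  using assms by (simp add: matrix_inv_mult)

lemma sets_gauss [simp, measurable_cong]: "sets (gauss h) = sets borel"
  by (simp add: gauss_def)

lemma (in black_scholes) noise_law_self:
  assumes N: "0 < N" and \<Gamma>: "invertible \<Gamma>"
  shows "distr P (PiM {..<N} (\<lambda>_. borel)) (\<lambda>w. noises \<Gamma> N (grid_path M w)) =
    PiM {..<N} (\<lambda>_. gauss (1 / real N))"
proof -
  have id: "distr (gauss h) borel (\<lambda>b. b) = gauss h" for h by (rule distr_id2) simp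
  show ?thesis using noise_law(1)[OF N \<Gamma>] unfolding matrix_inv_cancel[OF \<Gamma>] id .
qed

lemma (in black_scholes) prob_space_gauss:
  assumes "0 < N"
  shows "prob_space (gauss (1 / real N) :: (real^'l) measure)"
proof -
  have N: "0 \<le> (0::real)" "0 < 1 / real N" "1 / real N \<le> 1" using assms by auto
  have "distr P borel (\<lambda>w. B (1 / real N) w - B 0 w) = gauss (1 / real N - 0)"
    by (rule brownian_increment_law[OF brownian N])
  then show ?thesis
    using prob_space_distr[OF measurable_F_P[OF brownian_increment_measurable[OF brownian N]]] by simp
qed

text \<open>Irregular paths are null under the model, so \<open>A\<close> and \<open>C\<close> may
  be exchanged under the integral. With \<Phi> = 1 this gives probabilities; with \<Phi> the product
  of the step densities it gives the density side of \<open>grid_density\<close>.\<close>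

lemma (in black_scholes) emeasure_grid_event:
  assumes N: "0 < N" and A: "A \<in> sets (grid_sigma N)" and C: "C \<in> sets (PiM {..<N} (\<lambda>_. borel))"
    and \<Gamma>': "invertible \<Gamma>'"
    and AC: "\<And>w. w \<in> path_space \<Longrightarrow> regular_path x N w \<Longrightarrow> w \<in> A \<longleftrightarrow> (noises \<Gamma>' N w) \<in> C"
    and \<Phi>: "\<Phi> \<in> borel_measurable (PiM {..<N} (\<lambda>_. borel))"
  shows "(\<integral>\<^sup>+w. \<Phi> (noises \<Gamma>' N w) * indicator A w \<partial>restr_to_subalg (path_law P M) (grid_sigma N)) =
    (\<integral>\<^sup>+b. \<Phi> b * indicator C b \<partial>distr P (PiM {..<N} (\<lambda>_. borel)) (\<lambda>w. noises \<Gamma>' N (grid_path M w)))"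
proof -
  have n: "(\<lambda>w. noises \<Gamma>' N w) \<in> measurable (grid_sigma N) (PiM {..<N} (\<lambda>_. borel))"
    by (rule measurable_restrict) (simp add: noise_measurable)
  have g: "(\<lambda>w. \<Phi> (noises \<Gamma>' N w) * indicator A w) \<in> borel_measurable (grid_sigma N)"
    by (rule borel_measurable_times_ennreal[OF measurable_compose[OF n \<Phi>] borel_measurable_indicator[OF A]])
  have nP: "(\<lambda>w. noises \<Gamma>' N (grid_path M w)) \<in> measurable P (PiM {..<N} (\<lambda>_. borel))"
    by (rule measurable_restrict) (simp add: noise_path_measurable[OF N \<Gamma>'])
  have g': "(\<lambda>w. \<Phi> (noises \<Gamma>' N w) * indicator A w) \<in> borel_measurable (path_sigma {0..1})"
    using measurable_from_subalg[OF subalgebra_grid[OF N] g] by (simp add: path_law_eq)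
  have h: "(\<lambda>b. \<Phi> b * indicator C b) \<in> borel_measurable (PiM {..<N} (\<lambda>_. borel))"
    by (rule borel_measurable_times_ennreal[OF \<Phi> borel_measurable_indicator[OF C]])
  have "(\<integral>\<^sup>+w. \<Phi> (noises \<Gamma>' N w) * indicator A w \<partial>restr_to_subalg (path_law P M) (grid_sigma N)) =
    (\<integral>\<^sup>+w. \<Phi> (noises \<Gamma>' N w) * indicator A w \<partial>path_law P M)"
    by (rule nn_integral_subalgebra2[OF subalgebra_grid[OF N] g])
  also have "\<dots> = (\<integral>\<^sup>+w. \<Phi> (noises \<Gamma>' N (grid_path M w)) * indicator A (grid_path M w) \<partial>P)"
    unfolding path_law_eq by (rule nn_integral_distr[OF grid_path_measurable]) (simp add: g')
  also have "\<dots> = (\<integral>\<^sup>+w. \<Phi> (noises \<Gamma>' N (grid_path M w)) *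
      indicator C (noises \<Gamma>' N (grid_path M w)) \<partial>P)"
  proof (rule nn_integral_cong_AE)
    show "AE w in P. \<Phi> (noises \<Gamma>' N (grid_path M w)) * indicator A (grid_path M w) =
      \<Phi> (noises \<Gamma>' N (grid_path M w)) * indicator C (noises \<Gamma>' N (grid_path M w))"
      using AE_grid[OF N] AE_space
    proof eventually_elim
      case (elim w)
      then show ?case using AC[OF grid_path_in[OF elim(2)]] by (simp add: indicator_def)
    qed
  qed
  also have "\<dots> = (\<integral>\<^sup>+b. \<Phi> b * indicator C b \<partial>distr P (PiM {..<N} (\<lambda>_. borel)) (\<lambda>w. noises \<Gamma>' N (grid_path M w)))"
    by (rule nn_integral_distr[OF nP, symmetric]) (simp add: h)
  finally show ?thesis .
qed

section \<open>Two models in the noise coordinates of the second\<close>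

locale black_scholes_pair =
  Q: black_scholes P\<^sub>1 F\<^sub>1 B\<^sub>1 \<Gamma>\<^sub>1 x M\<^sub>1 + P: black_scholes P\<^sub>2 F\<^sub>2 B\<^sub>2 \<Gamma>\<^sub>2 x M\<^sub>2
  for P\<^sub>1 :: "'a measure" and F\<^sub>1 and B\<^sub>1 :: "real \<Rightarrow> 'a \<Rightarrow> real^'l" and \<Gamma>\<^sub>1 x M\<^sub>1
    and P\<^sub>2 :: "'b measure" and F\<^sub>2 and B\<^sub>2 :: "real \<Rightarrow> 'b \<Rightarrow> real^'l" and \<Gamma>\<^sub>2 M\<^sub>2 +
  assumes \<Gamma>\<^sub>2: "invertible \<Gamma>\<^sub>2"
begin

text \<open>Decoding with \<open>\<Gamma>\<^sub>2\<close> makes the steps of the second model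
  centred Gaussian with covariance the identity over N, and those of the first their image under b
  to A b + drift/N.\<close>

definition A :: "real^'l^'l" where
  "A = matrix_inv \<Gamma>\<^sub>2 ** \<Gamma>\<^sub>1"

definition drift :: "real^'l" where
  "drift = (1 / 2) *\<^sub>R (matrix_inv \<Gamma>\<^sub>2 *v (row_norms \<Gamma>\<^sub>2 - row_norms \<Gamma>\<^sub>1))"

text \<open>The density, for invertible A, of one decoded step of the first model with respect to
  one of the second, as given by \<open>distr_gauss_affine\<close> with h = 1/N.\<close>

definition step_density :: "nat \<Rightarrow> real^'l \<Rightarrow> real" where
  "step_density N y = exp (((norm y)\<^sup>2 - (norm (matrix_inv A *v (y - (1 / real N) *\<^sub>R drift)))\<^sup>2) / (2 * (1 / real N))) / \<bar>det A\<bar>"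

abbreviation Qg :: "nat \<Rightarrow> (real \<Rightarrow> real^'l) measure" where
  "Qg N \<equiv> restr_to_subalg (path_law P\<^sub>1 M\<^sub>1) (grid_sigma N)"

abbreviation Pg :: "nat \<Rightarrow> (real \<Rightarrow> real^'l) measure" where
  "Pg N \<equiv> restr_to_subalg (path_law P\<^sub>2 M\<^sub>2) (grid_sigma N)"

lemma sets_Qg: "0 < N \<Longrightarrow> sets (Qg N) = sets (grid_sigma N)"
  by (rule sets_restr_to_subalg[OF Q.subalgebra_grid])

lemma sets_Pg: "0 < N \<Longrightarrow> sets (Pg N) = sets (grid_sigma N)"
  by (rule sets_restr_to_subalg[OF P.subalgebra_grid])

lemma Q_noise_law:
  assumes N: "0 < N"
  shows "distr P\<^sub>1 (PiM {..<N} (\<lambda>_. borel)) (\<lambda>w. noises \<Gamma>\<^sub>2 N (grid_path M\<^sub>1 w)) =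
    PiM {..<N} (\<lambda>_. distr (gauss (1 / real N)) borel (\<lambda>b. A *v b + (1 / real N) *\<^sub>R drift))"
  unfolding A_def drift_def by (rule Q.noise_law[OF N \<Gamma>\<^sub>2])

lemma Q_AE_noise:
  assumes N: "0 < N"
  shows "AE w in P\<^sub>1. \<forall>k<N. noise \<Gamma>\<^sub>2 N k (grid_path M\<^sub>1 w) = A *v Q.\<Delta> N k w + (1 / real N) *\<^sub>R drift"
  using Q.AE_noise[OF N \<Gamma>\<^sub>2] unfolding A_def drift_def by eventually_elim blast

lemma step_density_measurable: "step_density N \<in> borel_measurable borel"
proof -
  have "(\<lambda>y. matrix_inv A *v (y - (1 / real N) *\<^sub>R drift)) \<in> borel_measurable borel"
    by (intro borel_measurable_matrix_vector_mult) simp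
  then show ?thesis unfolding step_density_def[abs_def] by measurable
qed

text \<open>An event of the grid corresponds to one event of the noises, the same for both models.
  There the two laws are products of Gaussian laws, so the density is the product of the step
  densities.\<close>

lemma grid_density:
  assumes N: "0 < N" and dA: "det A \<noteq> 0"
  shows "Qg N = density (Pg N) (\<lambda>w. ennreal (\<Prod>k<N. step_density N (noise \<Gamma>\<^sub>2 N k w)))"
proof (rule measure_eqI)
  show "sets (Qg N) = sets (density (Pg N) (\<lambda>w. ennreal (\<Prod>k<N. step_density N (noise \<Gamma>\<^sub>2 N k w))))"
    using sets_Qg[OF N] sets_Pg[OF N] by simp
  fix S assume "S \<in> sets (Qg N)"
  then have S: "S \<in> sets (grid_sigma N)" by (simp add: sets_Qg[OF N])
  then obtain C where C: "C \<in> sets (PiM {..<N} (\<lambda>_. borel))" and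
    SC: "\<And>w. w \<in> path_space \<Longrightarrow> regular_path x N w \<Longrightarrow> w \<in> S \<longleftrightarrow> (noises \<Gamma>\<^sub>2 N w) \<in> C"
    by (rule grid_sigma_noise_event[OF _ \<Gamma>\<^sub>2 Q.x N]) blast
  let ?g = "gauss (1 / real N) :: (real^'l) measure"
  let ?T = "\<lambda>b. A *v b + (1 / real N) *\<^sub>R drift"
  have pos: "0 \<le> step_density N y" for y by (simp add: step_density_def)
  interpret g: prob_space ?g by (rule P.prob_space_gauss[OF N])
  have iA: "invertible A" using dA by (simp add: invertible_det_nz)
  have dg: "distr ?g borel ?T = density ?g (\<lambda>y. ennreal (step_density N y))"
    unfolding step_density_def by (rule distr_gauss_affine[OF iA]) (use N in simp)
  have T: "?T \<in> measurable ?g borel"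
    by (intro borel_measurable_add borel_measurable_const borel_measurable_matrix_vector_mult) simp
  interpret d: prob_space "distr ?g borel ?T" by (rule g.prob_space_distr[OF T])
  have step_densitym: "(\<lambda>y. ennreal (step_density N y)) \<in> borel_measurable borel" using step_density_measurable by measurable
  have "PiM {..<N} (\<lambda>_. distr ?g borel ?T) = density (PiM {..<N} (\<lambda>_. ?g)) (\<lambda>b. \<Prod>k<N. ennreal (step_density N (b k)))"
    unfolding dg
    by (rule density_PiM[symmetric])
       (use g.sigma_finite_measure_axioms d.sigma_finite_measure_axioms step_densitym in \<open>simp_all add: dg\<close>)
  then have dens: "PiM {..<N} (\<lambda>_. distr ?g borel ?T) = density (PiM {..<N} (\<lambda>_. ?g)) (\<lambda>b. ennreal (\<Prod>k<N. step_density N (b k)))"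
    using pos by (simp add: prod_ennreal)
  have setsg: "sets (PiM {..<N} (\<lambda>_. ?g)) = sets (PiM {..<N} (\<lambda>_. borel))"
    by (rule sets_PiM_cong) simp_all
  have \<Phi>: "(\<lambda>b. ennreal (\<Prod>k<N. step_density N (b k))) \<in> borel_measurable (PiM {..<N} (\<lambda>_. borel))"
    by (intro measurable_compose[OF _ measurable_ennreal] borel_measurable_prod
        measurable_compose[OF _ step_density_measurable] measurable_component_singleton)
  \<comment> \<open>The same \<open>C\<close> is used for both models because both are decoded with
    \<open>\<Gamma>\<^sub>2\<close> and start at the same point.\<close>
  note Qe = Q.emeasure_grid_event[OF N S C \<Gamma>\<^sub>2 SC, of "\<lambda>_. 1"]
  note Pe = P.emeasure_grid_event[OF N S C \<Gamma>\<^sub>2 SC \<Phi>]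
  have "emeasure (Qg N) S = emeasure (PiM {..<N} (\<lambda>_. distr ?g borel ?T)) C"
    using Qe S C unfolding Q_noise_law[OF N] by (simp add: sets_Qg[OF N] sets_PiM_cong[OF refl sets_distr])
  also have "\<dots> = (\<integral>\<^sup>+b. ennreal (\<Prod>k<N. step_density N (b k)) * indicator C b \<partial>PiM {..<N} (\<lambda>_. ?g))"
    unfolding dens using \<Phi> C by (subst emeasure_density) (simp_all add: setsg cong: measurable_cong_sets)
  also have "\<dots> = (\<integral>\<^sup>+w. ennreal (\<Prod>k<N. step_density N ((noises \<Gamma>\<^sub>2 N w) k)) * indicator S w \<partial>Pg N)"
    using Pe unfolding P.noise_law_self[OF N \<Gamma>\<^sub>2] by (rule sym)
  also have "\<dots> = (\<integral>\<^sup>+w. ennreal (\<Prod>k<N. step_density N (noise \<Gamma>\<^sub>2 N k w)) * indicator S w \<partial>Pg N)"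
    by (intro nn_integral_cong arg_cong2[where f = "(*)"] arg_cong[where f = ennreal] prod.cong) auto
  also have "\<dots> = emeasure (density (Pg N) (\<lambda>w. ennreal (\<Prod>k<N. step_density N (noise \<Gamma>\<^sub>2 N k w)))) S"
  proof (rule emeasure_density[symmetric])
    have "(\<lambda>w. ennreal (\<Prod>k<N. step_density N (noise \<Gamma>\<^sub>2 N k w))) \<in> borel_measurable (grid_sigma N)"
      by (intro measurable_compose[OF _ measurable_ennreal] borel_measurable_prod
          measurable_compose[OF noise_measurable step_density_measurable]) simp
    then show "(\<lambda>w. ennreal (\<Prod>k<N. step_density N (noise \<Gamma>\<^sub>2 N k w))) \<in> borel_measurable (Pg N)"
      by (simp add: sets_Pg[OF N] cong: measurable_cong_sets)
    show "S \<in> sets (Pg N)" using S by (simp add: sets_Pg[OF N])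
  qed
  finally show "emeasure (Qg N) S = emeasure (density (Pg N) (\<lambda>w. ennreal (\<Prod>k<N. step_density N (noise \<Gamma>\<^sub>2 N k w)))) S" .
qed

lemma prob_space_Pg: "0 < N \<Longrightarrow> prob_space (Pg N)"
proof -
  assume N: "0 < N"
  interpret L: prob_space "path_law P\<^sub>2 M\<^sub>2"
    unfolding P.path_law_eq by (rule P.prob_space_distr[OF P.grid_path_measurable])
  show ?thesis by (rule prob_space_restr_to_subalg[OF P.subalgebra_grid[OF N] L.prob_space_axioms])
qed

text \<open>The log density is a sum of N terms with equal expectation under the first model. With h
  = 1/N each equals (h |A|^2 + h^2 |drift|^2 - h l) / (2h) - ln |det A|, where |A| is the Frobenius
  norm: the factor h cancels in the covariance terms and survives only in the drift term.\<close>

lemma relative_entropy_grid: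
  assumes N: "0 < N" and dA: "det A \<noteq> 0"
  shows "relative_entropy (Qg N) (Pg N) = ereal (real N *
    (((\<Sum>i\<in>UNIV. (norm (A $ i))\<^sup>2) - real CARD('l)) / 2 - ln \<bar>det A\<bar> + (norm drift)\<^sup>2 / (2 * real N)))"
proof -
  define L where "L k w = ln (step_density N (noise \<Gamma>\<^sub>2 N k w))" for k w
  define h where "h = 1 / real N"
  have h: "h > 0" using N by (simp add: h_def)
  have pos: "0 < step_density N y" for y using dA by (simp add: step_density_def)
  have prod_pos: "0 < (\<Prod>k<N. step_density N (noise \<Gamma>\<^sub>2 N k w))" for w by (intro prod_pos pos)
  have ln_prod: "ln (\<Prod>k<N. step_density N (noise \<Gamma>\<^sub>2 N k w)) = (\<Sum>k<N. L k w)" for w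
    unfolding L_def by (rule ln_prod) (use less_imp_neq[OF pos] in force)+
  have Lm: "L k \<in> borel_measurable (grid_sigma N)" if "k < N" for k
    unfolding L_def[abs_def]
    by (rule borel_measurable_ln[OF measurable_compose[OF noise_measurable[OF that] step_density_measurable]])
  have Sm: "(\<lambda>w. \<Sum>k<N. L k w) \<in> borel_measurable (grid_sigma N)"
    by (intro borel_measurable_sum Lm) simp
  have iA: "invertible A" using dA by (simp add: invertible_det_nz)
  \<comment> \<open>The log step density along the first model: the second norm in
    \<open>step_density\<close> undoes the affine map and leaves the plain increment.\<close>
  define X where "X k w = ((norm (A *v Q.\<Delta> N k w + h *\<^sub>R drift))\<^sup>2 - (norm (Q.\<Delta> N k w))\<^sup>2) / (2 * h) - ln \<bar>det A\<bar>" for k w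
  have ae: "AE w in P\<^sub>1. (\<Sum>k<N. L k (grid_path M\<^sub>1 w)) = (\<Sum>k<N. X k w)"
    using Q_AE_noise[OF N]
  proof eventually_elim
    case (elim w)
    have "L k (grid_path M\<^sub>1 w) = X k w" if "k < N" for k
    proof -
      have "noise \<Gamma>\<^sub>2 N k (grid_path M\<^sub>1 w) = A *v Q.\<Delta> N k w + h *\<^sub>R drift" using elim that by (simp add: h_def)
      then show ?thesis
        unfolding L_def X_def step_density_def h_def[symmetric] using dA iA
        by (simp add: ln_div matrix_vector_mul_assoc matrix_inv_mult)
    qed
    then show ?case by simp
  qed
  have X: "integrable P\<^sub>1 (X k) \<and> integral\<^sup>L P\<^sub>1 (X k) =
    ((\<Sum>i\<in>UNIV. (norm (A $ i))\<^sup>2) - real CARD('l)) / 2 - ln \<bar>det A\<bar> + h * (norm drift)\<^sup>2 / 2" if k: "k < N" for k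
  proof -
    have t: "0 \<le> real k / real N" "real k / real N < real (Suc k) / real N" "real (Suc k) / real N \<le> 1"
      "real (Suc k) / real N - real k / real N = h"
      using N k by (auto simp: h_def divide_strict_right_mono diff_divide_distrib[symmetric])
    note q = Q.brownian_increment_quadratic[OF Q.brownian t(1-3)]
    \<comment> \<open>The plain increment is the case of the identity matrix and no shift, with
      squared Frobenius norm l.\<close>
    have "(mat 1 :: real^'l^'l) $ i = axis i 1" for i
      by (simp add: mat_def axis_def vec_eq_iff)
    then have "(\<Sum>i\<in>UNIV. (norm ((mat 1 :: real^'l^'l) $ i))\<^sup>2) = real CARD('l)"
      by simp
    with q(1)[of "mat 1" 0] q(2)[of "mat 1" 0] q(1)[of A "h *\<^sub>R drift"] q(2)[of A "h *\<^sub>R drift"]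
    have i: "integrable P\<^sub>1 (\<lambda>w. (norm (Q.\<Delta> N k w))\<^sup>2)" "integrable P\<^sub>1 (\<lambda>w. (norm (A *v Q.\<Delta> N k w + h *\<^sub>R drift))\<^sup>2)"
      "(\<integral>w. (norm (Q.\<Delta> N k w))\<^sup>2 \<partial>P\<^sub>1) = h * real CARD('l)"
      "(\<integral>w. (norm (A *v Q.\<Delta> N k w + h *\<^sub>R drift))\<^sup>2 \<partial>P\<^sub>1) = h * (\<Sum>i\<in>UNIV. (norm (A $ i))\<^sup>2) + h\<^sup>2 * (norm drift)\<^sup>2"
      unfolding t(4) by (simp_all add: power_mult_distrib)
    have "integral\<^sup>L P\<^sub>1 (X k) = (h * (\<Sum>i\<in>UNIV. (norm (A $ i))\<^sup>2) + h\<^sup>2 * (norm drift)\<^sup>2 - h * real CARD('l)) / (2 * h) - ln \<bar>det A\<bar>"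
      unfolding X_def[abs_def] using i by (simp add: Q.prob_space)
    also have "\<dots> = ((\<Sum>i\<in>UNIV. (norm (A $ i))\<^sup>2) - real CARD('l)) / 2 - ln \<bar>det A\<bar> + h * (norm drift)\<^sup>2 / 2"
      using h by (simp add: field_simps power2_eq_square)
    finally show ?thesis unfolding X_def[abs_def] using i by simp
  qed
  have Xint: "integrable P\<^sub>1 (\<lambda>w. \<Sum>k<N. X k w)" using X by (intro Bochner_Integration.integrable_sum) simp
  have sub: "subalgebra (path_law P\<^sub>1 M\<^sub>1) (grid_sigma N)" by (rule Q.subalgebra_grid[OF N])
  have Sm': "(\<lambda>w. \<Sum>k<N. L k w) \<in> borel_measurable (path_sigma {0..1})"
    using measurable_from_subalg[OF sub Sm] by (simp add: Q.path_law_eq)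
  have SmP: "(\<lambda>w. \<Sum>k<N. L k (grid_path M\<^sub>1 w)) \<in> borel_measurable P\<^sub>1"
    using measurable_compose[OF Q.grid_path_measurable Sm'] .
  have XmP: "(\<lambda>w. \<Sum>k<N. X k w) \<in> borel_measurable P\<^sub>1" using Xint by simp
  have "integrable P\<^sub>1 (\<lambda>w. \<Sum>k<N. L k (grid_path M\<^sub>1 w))"
    by (subst integrable_cong_AE[OF SmP XmP ae]) (rule Xint)
  then have "integrable (path_law P\<^sub>1 M\<^sub>1) (\<lambda>w. \<Sum>k<N. L k w)"
    unfolding Q.path_law_eq integrable_distr_eq[OF Q.grid_path_measurable Sm'] .
  then have int: "integrable (Qg N) (\<lambda>w. \<Sum>k<N. L k w)"
    by (rule integrable_in_subalg[OF sub Sm])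
  have "(\<integral>w. (\<Sum>k<N. L k w) \<partial>Qg N) = (\<integral>w. (\<Sum>k<N. L k w) \<partial>path_law P\<^sub>1 M\<^sub>1)"
    by (rule integral_subalgebra2[OF sub Sm])
  also have "\<dots> = (\<integral>w. (\<Sum>k<N. L k (grid_path M\<^sub>1 w)) \<partial>P\<^sub>1)"
    unfolding Q.path_law_eq by (rule integral_distr[OF Q.grid_path_measurable Sm'])
  also have "\<dots> = (\<integral>w. (\<Sum>k<N. X k w) \<partial>P\<^sub>1)"
    by (rule integral_cong_AE[OF SmP XmP ae])
  also have "\<dots> = (\<Sum>k<N. integral\<^sup>L P\<^sub>1 (X k))"
    using X by (intro Bochner_Integration.integral_sum) simp
  also have "\<dots> = real N * (((\<Sum>i\<in>UNIV. (norm (A $ i))\<^sup>2) - real CARD('l)) / 2 - ln \<bar>det A\<bar> + h * (norm drift)\<^sup>2 / 2)"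
    using X by simp
  finally have val: "(\<integral>w. (\<Sum>k<N. L k w) \<partial>Qg N) = real N * (((\<Sum>i\<in>UNIV. (norm (A $ i))\<^sup>2) - real CARD('l)) / 2 - ln \<bar>det A\<bar> + h * (norm drift)\<^sup>2 / 2)" .
  have "(\<lambda>w. \<Prod>k<N. step_density N (noise \<Gamma>\<^sub>2 N k w)) \<in> borel_measurable (grid_sigma N)"
    by (intro borel_measurable_prod measurable_compose[OF noise_measurable step_density_measurable]) simp
  then have \<Phi>m: "(\<lambda>w. \<Prod>k<N. step_density N (noise \<Gamma>\<^sub>2 N k w)) \<in> borel_measurable (Pg N)"
    by (simp add: sets_Pg[OF N] cong: measurable_cong_sets)
  interpret Pg: prob_space "Pg N" by (rule prob_space_Pg[OF N])
  have "relative_entropy (Qg N) (Pg N) = ereal (\<integral>w. ln (\<Prod>k<N. step_density N (noise \<Gamma>\<^sub>2 N k w)) \<partial>Qg N)"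
    unfolding grid_density[OF N dA]
    by (rule relative_entropy_density[OF Pg.sigma_finite_measure_axioms \<Phi>m prod_pos])
       (use int in \<open>simp add: grid_density[OF N dA, symmetric] ln_prod\<close>)
  then show ?thesis unfolding ln_prod val by (simp add: h_def)
qed

lemma relative_entropy_grid_singular:
  assumes N: "0 < N" and dA: "det A = 0"
  shows "relative_entropy (Qg N) (Pg N) = \<infinity>"
proof -
  have "det (transpose A) = 0" using dA by (simp add: det_transpose)
  \<comment> \<open>A normal vector to the range of A. Its inner product with a decoded step of the
    first model sees only the shift and is constant.\<close>
  then obtain u where u: "u \<noteq> 0" "transpose A *v u = 0"
    using matrix_left_invertible_ker[of "transpose A"] invertible_left_inverse[of "transpose A"]
      invertible_det_nz[of "transpose A"] by blast
  have uA: "u \<bullet> (A *v b) = 0" for b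
    using u(2) by (simp add: dot_lmul_matrix[symmetric])
  define a where "a = u \<bullet> ((1 / real N) *\<^sub>R drift)"
  \<comment> \<open>The first step alone already separates the two laws.\<close>
  define Z where "Z = {w\<in>path_space. u \<bullet> noise \<Gamma>\<^sub>2 N 0 w = a}"
  have um: "(\<lambda>w. u \<bullet> noise \<Gamma>\<^sub>2 N 0 w) \<in> borel_measurable (grid_sigma N)"
    by (intro borel_measurable_inner borel_measurable_const noise_measurable N)
  have Zeq: "Z = (\<lambda>w. u \<bullet> noise \<Gamma>\<^sub>2 N 0 w) -` {a} \<inter> space (grid_sigma N)"
    by (auto simp: Z_def grid_sigma_def)
  have Z: "Z \<in> sets (grid_sigma N)" unfolding Zeq by (rule measurable_sets[OF um]) simp
  then have Z': "Z \<in> sets (path_sigma {0..1})"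
    using Q.subalgebra_grid[OF N] by (auto simp: subalgebra_def Q.path_law_eq)
  have "emeasure (Qg N) Z = emeasure P\<^sub>1 (grid_path M\<^sub>1 -` Z \<inter> space P\<^sub>1)"
    unfolding emeasure_restr_to_subalg[OF Q.subalgebra_grid[OF N] Z]
    unfolding Q.path_law_eq by (rule emeasure_distr[OF Q.grid_path_measurable Z'])
  also have "\<dots> = emeasure P\<^sub>1 (space P\<^sub>1)"
  proof (rule emeasure_eq_AE)
    show "AE w in P\<^sub>1. w \<in> grid_path M\<^sub>1 -` Z \<inter> space P\<^sub>1 \<longleftrightarrow> w \<in> space P\<^sub>1"
      using Q_AE_noise[OF N] AE_space
    proof eventually_elim
      case (elim w)
      then show ?case using N Q.grid_path_in[of w] by (simp add: Z_def inner_add_right uA a_def)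
    qed
    show "grid_path M\<^sub>1 -` Z \<inter> space P\<^sub>1 \<in> sets P\<^sub>1" by (rule measurable_sets[OF Q.grid_path_measurable Z'])
  qed simp
  finally have Q1: "emeasure (Qg N) Z = 1" by (simp add: Q.emeasure_space_1)
  have "emeasure (Pg N) Z = emeasure P\<^sub>2 (grid_path M\<^sub>2 -` Z \<inter> space P\<^sub>2)"
    unfolding emeasure_restr_to_subalg[OF P.subalgebra_grid[OF N] Z]
    unfolding P.path_law_eq by (rule emeasure_distr[OF P.grid_path_measurable Z'])
  also have "\<dots> = 0"
  proof -
    \<comment> \<open>Under the second model the decoded step is the Brownian increment, whose inner
      product with the nonzero u has a density and so avoids the value a almost surely.\<close>
    let ?Y = "\<lambda>w. u \<bullet> B\<^sub>2 (real (Suc 0) / real N) w - u \<bullet> B\<^sub>2 (real 0 / real N) w"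
    have n: "distributed P\<^sub>2 lborel ?Y (normal_density 0 (sqrt ((norm u)\<^sup>2 * (real (Suc 0) / real N - real 0 / real N))))"
      using N by (intro P.inner_increment_normal[OF P.brownian _ _ _ u(1)]) auto
    have "AE y in lborel. y \<noteq> a" by (rule AE_lborel_singleton)
    then have "AE y in distr P\<^sub>2 lborel ?Y. y \<noteq> a"
      unfolding distributed_distr_eq_density[OF n] by (subst AE_density) (auto elim: eventually_mono)
    then have "AE w in P\<^sub>2. ?Y w \<noteq> a"
      by (rule AE_distrD[OF distributed_measurable[OF n]])
    then have "AE w in P\<^sub>2. w \<notin> grid_path M\<^sub>2 -` Z \<inter> space P\<^sub>2"
      using P.AE_noise[OF N \<Gamma>\<^sub>2]
    proof eventually_elim
      case (elim w)
      then have "noise \<Gamma>\<^sub>2 N 0 (grid_path M\<^sub>2 w) = P.\<Delta> N 0 w"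
        using N unfolding matrix_inv_cancel[OF \<Gamma>\<^sub>2] by blast
      then show ?case using elim(1) by (simp add: Z_def inner_diff_right)
    qed
    then show ?thesis
      using AE_iff_null_sets[OF measurable_sets[OF P.grid_path_measurable Z']] by blast
  qed
  finally have P0: "emeasure (Pg N) Z = 0" .
  have "\<not> absolutely_continuous (Pg N) (Qg N)"
  proof
    assume "absolutely_continuous (Pg N) (Qg N)"
    moreover have "Z \<in> null_sets (Pg N)" using P0 Z by (intro null_setsI) (simp_all add: sets_Pg[OF N])
    ultimately have "Z \<in> null_sets (Qg N)" unfolding absolutely_continuous_def by blast
    then show False using Q1 by auto
  qed
  then show ?thesis by (simp add: relative_entropy_def)
qed

text \<open>The inverse of \<open>\<Gamma>\<^sub>2 ** transpose \<Gamma>\<^sub>2\<close> factors as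
  the transposed inverse of \<open>\<Gamma>\<^sub>2\<close> times the inverse. Moving the transposed
  inverse to the end by cyclicity of the trace leaves the trace of A times its transpose.\<close>

lemma trace_eq: "trace (matrix_inv (\<Gamma>\<^sub>2 ** transpose \<Gamma>\<^sub>2) ** (\<Gamma>\<^sub>1 ** transpose \<Gamma>\<^sub>1)) = (\<Sum>i\<in>UNIV. (norm (A $ i))\<^sup>2)"
proof -
  let ?I = "matrix_inv \<Gamma>\<^sub>2"
  let ?K = "\<Gamma>\<^sub>2 ** transpose \<Gamma>\<^sub>2"
  have "det \<Gamma>\<^sub>2 \<noteq> 0" using \<Gamma>\<^sub>2 by (simp add: invertible_det_nz)
  then have K: "invertible ?K" by (simp add: invertible_det_nz det_mul det_transpose)
  have tI: "transpose ?I ** transpose \<Gamma>\<^sub>2 = mat 1"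
    using matrix_inv_mult(1)[OF \<Gamma>\<^sub>2] by (metis matrix_transpose_mul transpose_mat)
  have "transpose ?I ** transpose \<Gamma>\<^sub>2 = mat 1 \<Longrightarrow> transpose \<Gamma>\<^sub>2 ** transpose ?I = mat 1"
    by (simp add: matrix_left_right_inverse)
  then have "(transpose ?I ** ?I) ** ?K = transpose ?I ** (?I ** \<Gamma>\<^sub>2) ** transpose \<Gamma>\<^sub>2"
    by (simp add: matrix_mul_assoc)
  also have "\<dots> = mat 1" using matrix_inv_mult(2)[OF \<Gamma>\<^sub>2] tI by simp
  finally have XK: "(transpose ?I ** ?I) ** ?K = mat 1" .
  have "matrix_inv ?K = (transpose ?I ** ?I) ** ?K ** matrix_inv ?K" unfolding XK by simp
  also have "\<dots> = (transpose ?I ** ?I) ** (?K ** matrix_inv ?K)" by (simp only: matrix_mul_assoc)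
  also have "\<dots> = transpose ?I ** ?I" using matrix_inv_mult(1)[OF K] by simp
  finally have "trace (matrix_inv ?K ** (\<Gamma>\<^sub>1 ** transpose \<Gamma>\<^sub>1)) = trace (transpose ?I ** (A ** transpose \<Gamma>\<^sub>1))"
    by (simp add: A_def matrix_mul_assoc)
  also have "\<dots> = trace ((A ** transpose \<Gamma>\<^sub>1) ** transpose ?I)" by (rule trace_mul_sym)
  also have "(A ** transpose \<Gamma>\<^sub>1) ** transpose ?I = A ** transpose A"
    by (simp add: A_def matrix_transpose_mul matrix_mul_assoc)
  also have "trace (A ** transpose A) = (\<Sum>i\<in>UNIV. (norm (A $ i))\<^sup>2)"
    unfolding power2_norm_eq_inner inner_vec_def
    by (simp add: trace_def matrix_matrix_mult_def transpose_def)
  finally show ?thesis .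
qed

lemma det_eq: "det (\<Gamma>\<^sub>1 ** transpose \<Gamma>\<^sub>1) / det (\<Gamma>\<^sub>2 ** transpose \<Gamma>\<^sub>2) = \<bar>det A\<bar>\<^sup>2"
proof -
  have "det (matrix_inv \<Gamma>\<^sub>2) * det \<Gamma>\<^sub>2 = 1"
    using matrix_inv_mult(2)[OF \<Gamma>\<^sub>2] by (metis det_I det_mul)
  moreover have "det \<Gamma>\<^sub>2 \<noteq> 0" using \<Gamma>\<^sub>2 by (simp add: invertible_det_nz)
  ultimately have "det (matrix_inv \<Gamma>\<^sub>2) = 1 / det \<Gamma>\<^sub>2" by (simp add: field_simps)
  then show ?thesis
    by (simp add: A_def det_mul det_transpose power2_eq_square)
qed

theorem specific_relative_entropy_eq:
  "specific_relative_entropy (path_law P\<^sub>1 M\<^sub>1) (path_law P\<^sub>2 M\<^sub>2) =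
    ereal (1 / 2) *
      (ereal (trace (matrix_inv (\<Gamma>\<^sub>2 ** transpose \<Gamma>\<^sub>2) ** (\<Gamma>\<^sub>1 ** transpose \<Gamma>\<^sub>1)))
       - ereal (real CARD('l))
       - ext_ln (det (\<Gamma>\<^sub>1 ** transpose \<Gamma>\<^sub>1) / det (\<Gamma>\<^sub>2 ** transpose \<Gamma>\<^sub>2)))"
  unfolding trace_eq det_eq specific_relative_entropy_def
proof (cases "det A = 0")
  \<comment> \<open>Every grid entropy is infinite, and so is the right-hand side because
    \<open>ext_ln 0\<close> is minus infinity.\<close>
  case True
  have "ereal (1 / 2 ^ n) * relative_entropy (Qg (2 ^ n)) (Pg (2 ^ n)) = \<infinity>" for n
    using relative_entropy_grid_singular[of "2 ^ n"] True by simp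
  then show "liminf (\<lambda>n. ereal (1 / 2 ^ n) * relative_entropy (Qg (2 ^ n)) (Pg (2 ^ n))) =
    ereal (1 / 2) * (ereal (\<Sum>i\<in>UNIV. (norm (A $ i))\<^sup>2) - ereal (real CARD('l)) - ext_ln (\<bar>det A\<bar>\<^sup>2))"
    using True by (simp add: ext_ln_def Liminf_const)
next
  case False
  \<comment> \<open>The part of the entropy per step that does not depend on the grid. The drift
    adds |drift|^2 / 2 to the whole grid, not to each step, so division by 2^n removes it in the
    limit.\<close>
  define r where "r = ((\<Sum>i\<in>UNIV. (norm (A $ i))\<^sup>2) - real CARD('l)) / 2 - ln \<bar>det A\<bar>"
  have "ereal (1 / 2 ^ n) * relative_entropy (Qg (2 ^ n)) (Pg (2 ^ n)) = ereal (r + (norm drift)\<^sup>2 / 2 * (1 / 2) ^ n)" for n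
    using relative_entropy_grid[of "2 ^ n"] False by (simp add: r_def power_one_over)
  moreover have "(\<lambda>n. ereal (r + (norm drift)\<^sup>2 / 2 * (1 / 2) ^ n)) \<longlonglongrightarrow> ereal (r + (norm drift)\<^sup>2 / 2 * 0)"
    by (intro tendsto_intros LIMSEQ_realpow_zero) auto
  ultimately have "(\<lambda>n. ereal (1 / 2 ^ n) * relative_entropy (Qg (2 ^ n)) (Pg (2 ^ n))) \<longlonglongrightarrow> ereal r"
    by simp
  then have "liminf (\<lambda>n. ereal (1 / 2 ^ n) * relative_entropy (Qg (2 ^ n)) (Pg (2 ^ n))) = ereal r"
    by (intro lim_imp_Liminf) simp_all
  also have "\<dots> = ereal (1 / 2) * (ereal (\<Sum>i\<in>UNIV. (norm (A $ i))\<^sup>2) - ereal (real CARD('l)) - ext_ln (\<bar>det A\<bar>\<^sup>2))"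
    using False ln_realpow[of "\<bar>det A\<bar>" 2] by (simp add: ext_ln_def r_def field_simps del: power2_abs)
  finally show "liminf (\<lambda>n. ereal (1 / 2 ^ n) * relative_entropy (Qg (2 ^ n)) (Pg (2 ^ n))) =
    ereal (1 / 2) * (ereal (\<Sum>i\<in>UNIV. (norm (A $ i))\<^sup>2) - ereal (real CARD('l)) - ext_ln (\<bar>det A\<bar>\<^sup>2))" .
qed

end

theorem lemma1p4:
  fixes P\<^sub>1 :: "'a measure" and P\<^sub>2 :: "'b measure"
    and F\<^sub>1 :: "real \<Rightarrow> 'a measure" and F\<^sub>2 :: "real \<Rightarrow> 'b measure"
    and B\<^sub>1 M\<^sub>1 :: "real \<Rightarrow> 'a \<Rightarrow> real^'l" and B\<^sub>2 M\<^sub>2 :: "real \<Rightarrow> 'b \<Rightarrow> real^'l"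
    and \<Gamma>\<^sub>1 \<Gamma>\<^sub>2 :: "real^'l^'l" and x :: "real^'l"
  assumes "\<And>i. x $ i \<noteq> 0"
    and "invertible (\<Gamma>\<^sub>2 ** transpose \<Gamma>\<^sub>2)"
    and "black_scholes_model P\<^sub>1 F\<^sub>1 B\<^sub>1 \<Gamma>\<^sub>1 x M\<^sub>1"
    and "black_scholes_model P\<^sub>2 F\<^sub>2 B\<^sub>2 \<Gamma>\<^sub>2 x M\<^sub>2"
  shows "specific_relative_entropy (path_law P\<^sub>1 M\<^sub>1) (path_law P\<^sub>2 M\<^sub>2) =
    ereal (1 / 2) *
      (ereal (trace (matrix_inv (\<Gamma>\<^sub>2 ** transpose \<Gamma>\<^sub>2) ** (\<Gamma>\<^sub>1 ** transpose \<Gamma>\<^sub>1)))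
       - ereal (real CARD('l))
       - ext_ln (det (\<Gamma>\<^sub>1 ** transpose \<Gamma>\<^sub>1) / det (\<Gamma>\<^sub>2 ** transpose \<Gamma>\<^sub>2)))"
proof -
  have "filtered_prob_space P\<^sub>1 F\<^sub>1" "filtered_prob_space P\<^sub>2 F\<^sub>2"
    using assms(3,4) by (simp_all add: black_scholes_model_def)
  moreover have "invertible \<Gamma>\<^sub>2"
    using assms(2) by (simp add: invertible_det_nz det_mul det_transpose)
  ultimately have "black_scholes_pair P\<^sub>1 F\<^sub>1 B\<^sub>1 \<Gamma>\<^sub>1 x M\<^sub>1 P\<^sub>2 F\<^sub>2 B\<^sub>2 \<Gamma>\<^sub>2 M\<^sub>2"
    using assms(1,3,4)
    by (intro black_scholes_pair.intro black_scholes.intro black_scholes_axioms.intro black_scholes_pair_axioms.intro)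
  then show ?thesis by (rule black_scholes_pair.specific_relative_entropy_eq)
qed

end
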